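(* There exists $K_0$ such that for every $K\ge K_0$, $d>2^{K-2}\ln 2$ and $r>0$, $$\lim_{n\to\infty}\mathbb{P}\big(\text{the SP-guided decimation algorithm with } r \text{ iterations solves } \mathbf{\Phi}(n,dn)\big)=0,$$ where "solves" means that the output assignment satisfies the formula.
   Context: NAE-$K$-SAT. A (non-reduced) instance $\Phi$ consists of Boolean variables $x_1,\dots,x_n$ and a finite list of clauses, each consisting of $K$ literals (a literal is a variable $x$ or its negation $\bar x$). An assignment satisfies $\Phi$ if every clause has at least one literal with value $1$ and at least one literal with value $0$. Random formula. $\mathbf{\Phi}(n,dn)$ has variables $x_1,\dots,x_n$ and $\lfloor dn\rfloor$ independent clauses; the $K$ variables of each clause are chosen uniformly at random without replacement from $x_1,\dots,x_n$, and each is negated with probability $1/2$, independently over all variables in the clause and over all clauses. $K$, $d$ and the number of iterations $r$ (an integer) do not depend on $n$. Reduced instances. A reduced clause $C$ is a set of at most $K$ literals together with a sign $\mathrm{sign}(C)\in\{+,-,0\}$, where $C$ has exactly $K$ literals if and only if $\mathrm{sign}(C)=0$ (sign $0$ is called unsigned). An assignment satisfies $C$ if: $\mathrm{sign}(C)=+$ and some literal of $C$ has value $0$; or $\mathrm{sign}(C)=-$ and some literal of $C$ has value $1$; or $\mathrm{sign}(C)=0$ and $C$ has both a literal of value $0$ and a literal of value $1$. A reduced instance consists of reduced clauses. Fixing a variable. When a variable is given a value, it is deleted from the instance. A sign-$0$ clause containing it loses the corresponding literal and gets sign $+$ if that literal has value $1$ and sign $-$ if it has value $0$. A clause with sign $+$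 (resp. $-$) in which the literal takes value $0$ (resp. $1$) is satisfied and removed; otherwise it loses that literal and keeps its sign. A clause left with no literals and not satisfied is violated and is removed. SP iterations with $r$ rounds on a (reduced or non-reduced) instance $\Psi$. For each pair $(x,C)$ with variable $x$ appearing in clause $C$ there are quantities $Q^t_{x,C,U},Q^t_{x,C,S},Q^t_{x,C,*},Q^t_{C,x,S},Q^t_{C,x,U}$, $t=0,1,\dots,r$. At $t=0$ all are drawn independently and uniformly from $[0,1]$; then the triple $(Q^0_{x,C,U},Q^0_{x,C,S},Q^0_{x,C,*})$ is divided by its sum and the pair $(Q^0_{C,x,S},Q^0_{C,x,U})$ is divided by its sum. Let $\mathcal{S}_{x,C}$ be the set of clauses other than $C$ containing $x$ with the same polarity as in $C$, and $\mathcal{U}_{x,C}$ the set of those containing $x$ with the opposite polarity. For $t\ge 0$ ($C\setminus x$ is the set of variables of $C$ other than $x$; empty products equal $1$): - if $C$ is unsigned, $Q^{t+1}_{C,x,S}=\prod_{y\in C\setminus x}Q^t_{y,C,U}$ and $Q^{t+1}_{C,x,U}=\prod_{y\in C\setminus x}Q^t_{y,C,S}$; - if $C$ has sign $+$, $Q^{t+1}_{C,x,S}=0$ and $Q^{t+1}_{C,x,U}=\prod_{y\in C\setminus x}Q^t_{y,C,S}$; - if $C$ has sign $-$, $Q^{t+1}_{C,x,U}=0$ and $Q^{t+1}_{C,x,S}=\prod_{y\in C\setminus x}Q^t_{y,C,U}$; - $R^{t+1}_{x,C,*}=\prod_{D\in\mathcal{S}_{x,C}\cup\mathcal{U}_{x,C}}(1-Q^t_{D,x,S}-Q^t_{D,x,U})$;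 - $R^{t+1}_{x,C,S}=\prod_{D\in\mathcal{U}_{x,C}}(1-Q^t_{D,x,S})\prod_{D\in\mathcal{S}_{x,C}}(1-Q^t_{D,x,U})-R^{t+1}_{x,C,*}$; - $R^{t+1}_{x,C,U}=\prod_{D\in\mathcal{U}_{x,C}}(1-Q^t_{D,x,U})\prod_{D\in\mathcal{S}_{x,C}}(1-Q^t_{D,x,S})-R^{t+1}_{x,C,*}$; - $(Q^{t+1}_{x,C,S},Q^{t+1}_{x,C,U},Q^{t+1}_{x,C,*})$ is $(R^{t+1}_{x,C,S},R^{t+1}_{x,C,U},R^{t+1}_{x,C,*})$ divided by its sum. After $r$ rounds, let $\mathcal{S}_x$ (resp. $\mathcal{U}_x$) be the set of clauses in which $x$ appears without (resp. with) negation, and put $$W_x( * )=\prod_{D\in\mathcal{S}_x\cup\mathcal{U}_x}(1-Q^r_{D,x,S}-Q^r_{D,x,U}),$$ $$W_x(1)=\prod_{D\in\mathcal{U}_x}(1-Q^r_{D,x,S})\prod_{D\in\mathcal{S}_x}(1-Q^r_{D,x,U})-W_x( * ),$$ $$W_x(0)=\prod_{D\in\mathcal{S}_x}(1-Q^r_{D,x,S})\prod_{D\in\mathcal{U}_x}(1-Q^r_{D,x,U})-W_x( * );$$ finally $W_x(0),W_x(1),W_x( * )$ are normalized to sum to $1$, keeping the same notation. SP-guided decimation with $r$ iterations. Set $\Phi_0=\Phi$. For $i=1,\dots,n$: run the SP iterations with $r$ rounds on $\Phi_{i-1}$ (with fresh independent randomness), compute $W_{x_i}(0),W_{x_i}(1)$,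 set $\sigma(x_i)=1$ if $W_{x_i}(1)>W_{x_i}(0)$ and $\sigma(x_i)=0$ otherwise; let $\Phi_i$ be obtained from $\Phi_{i-1}$ by fixing $x_i$ to $\sigma(x_i)$. The output is $(\sigma(x_1),\dots,\sigma(x_n))$. (The algorithm continues even if a clause gets violated.) *)

theory Defs
  imports "HOL-Probability.Probability" "HOL-Library.FSet"
begin

section \<open>Instances\<close>

text \<open>The variables of an instance are the natural numbers below \<open>n\<close> (so \<open>x\<close> stands for
  the variable number \<open>x + 1\<close> of the usual enumeration). The literal \<open>(x, True)\<close> is \<open>x\<close>
  itself, and \<open>(x, False)\<close> is its negation.\<close>

type_synonym lit = "nat \<times> bool"

datatype csign = Plus | Minus | Unsigned

datatype clause = Clause (lits: "lit fset") (csign: csign)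

instance csign :: countable
  by countable_datatype

instance clause :: countable
  by countable_datatype

text \<open>Equal clauses may occur several times in an instance; clauses are therefore identified by
  their position in the list. A non-reduced instance has only \<open>Unsigned\<close> clauses.
  That a clause is unsigned iff it has exactly \<open>K\<close> literals is not part of the type: it holds in the
  random formula, and \<open>fix_var\<close> preserves it.\<close>

type_synonym inst = "clause list"

definition lit_val :: "(nat \<Rightarrow> bool) \<Rightarrow> lit \<Rightarrow> bool" where
  "lit_val \<sigma> l \<longleftrightarrow> \<sigma> (fst l) = snd l"

definition sat_clause :: "(nat \<Rightarrow> bool) \<Rightarrow> clause \<Rightarrow> bool" where
  "sat_clause \<sigma> C =
    (case csign C of
       Plus \<Rightarrow> (\<exists>l. l |\<in>| lits C \<and> \<not> lit_val \<sigma> l)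
     | Minus \<Rightarrow> (\<exists>l. l |\<in>| lits C \<and> lit_val \<sigma> l)
     | Unsigned \<Rightarrow> (\<exists>l. l |\<in>| lits C \<and> lit_val \<sigma> l) \<and> (\<exists>l. l |\<in>| lits C \<and> \<not> lit_val \<sigma> l))"

definition satisfies :: "(nat \<Rightarrow> bool) \<Rightarrow> inst \<Rightarrow> bool" where
  "satisfies \<sigma> \<Phi> \<longleftrightarrow> (\<forall>C\<in>set \<Phi>. sat_clause \<sigma> C)"

definition vars :: "clause \<Rightarrow> nat set" where
  "vars C = fst ` fset (lits C)"

text \<open>When \<open>x\<close> occurs in \<open>C\<close> and is given the value \<open>v\<close>, its literal in \<open>C\<close> has value 1
  iff that literal is \<open>(x, v)\<close>. The result \<open>None\<close> means that the clause is removed, either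
  because it is satisfied or because it is violated.\<close>

definition fix_clause :: "nat \<Rightarrow> bool \<Rightarrow> clause \<Rightarrow> clause option" where
  "fix_clause x v C =
    (if x \<notin> vars C then Some C
     else let one = (x, v) |\<in>| lits C;
              rest = ffilter (\<lambda>l. fst l \<noteq> x) (lits C);
              keep = (\<lambda>s. if rest = {||} then None else Some (Clause rest s))
          in case csign C of
               Unsigned \<Rightarrow> keep (if one then Plus else Minus)
             | Plus \<Rightarrow> if one then keep Plus else None
             | Minus \<Rightarrow> if one then None else keep Minus)"

definition fix_var :: "nat \<Rightarrow> bool \<Rightarrow> inst \<Rightarrow> inst" where
  "fix_var x v \<Phi> = List.map_filter (fix_clause x v) \<Phi>"

section \<open>The random formula\<close>

text \<open>For \<open>n < K\<close> there is no \<open>K\<close>-element set of variables and \<open>clause_pmf K n\<close> is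
  unspecified; this is irrelevant for limits as \<open>n\<close> tends to infinity.\<close>

definition clause_pmf :: "nat \<Rightarrow> nat \<Rightarrow> clause pmf" where
  "clause_pmf K n =
    do {
      V \<leftarrow> pmf_of_set {V :: nat fset. fset V \<subseteq> {..<n} \<and> fcard V = K};
      s \<leftarrow> Pi_pmf (fset V) False (\<lambda>_. bernoulli_pmf (1 / 2));
      return_pmf (Clause ((\<lambda>x. (x, s x)) |`| V) Unsigned)
    }"

definition formula_pmf :: "nat \<Rightarrow> real \<Rightarrow> nat \<Rightarrow> inst pmf" where
  "formula_pmf K d n = replicate_pmf (nat \<lfloor>d * real n\<rfloor>) (clause_pmf K n)"

section \<open>Survey propagation\<close>

text \<open>For a variable \<open>x\<close> and a clause \<open>C\<close> at position \<open>j\<close>, the values \<open>Q VS x j\<close>,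
  \<open>Q VU x j\<close>, \<open>Q VStar x j\<close> are the messages $Q_{x,C,S}$, $Q_{x,C,U}$, $Q_{x,C,*}$
  from \<open>x\<close> to \<open>C\<close>, and \<open>Q CS x j\<close>, \<open>Q CU x j\<close> are the messages $Q_{C,x,S}$, $Q_{C,x,U}$
  from \<open>C\<close> to \<open>x\<close>. Only the values with \<open>j < length \<Psi>\<close> and \<open>x \<in> vars (\<Psi> ! j)\<close> are
  meaningful; the others are never used.\<close>

datatype kind = VS | VU | VStar | CS | CU

instance kind :: countable
  by countable_datatype

type_synonym messages = "kind \<Rightarrow> nat \<Rightarrow> nat \<Rightarrow> real"

definition same_pol :: "inst \<Rightarrow> nat \<Rightarrow> nat \<Rightarrow> nat set" where
  "same_pol \<Psi> x j =
    {i. i < length \<Psi> \<and> i \<noteq> j \<and> (\<exists>b. (x, b) |\<in>| lits (\<Psi> ! i) \<and> (x, b) |\<in>| lits (\<Psi> ! j))}"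

definition opp_pol :: "inst \<Rightarrow> nat \<Rightarrow> nat \<Rightarrow> nat set" where
  "opp_pol \<Psi> x j =
    {i. i < length \<Psi> \<and> i \<noteq> j \<and> (\<exists>b. (x, b) |\<in>| lits (\<Psi> ! i) \<and> (x, \<not> b) |\<in>| lits (\<Psi> ! j))}"

definition sp_init :: "messages \<Rightarrow> messages" where
  "sp_init u = (\<lambda>k x j.
    (case k of
       CS \<Rightarrow> u CS x j / (u CS x j + u CU x j)
     | CU \<Rightarrow> u CU x j / (u CS x j + u CU x j)
     | _ \<Rightarrow> u k x j / (u VS x j + u VU x j + u VStar x j)))"

definition R_star :: "inst \<Rightarrow> messages \<Rightarrow> nat \<Rightarrow> nat \<Rightarrow> real" where
  "R_star \<Psi> Q x j = (\<Prod>D\<in>same_pol \<Psi> x j \<union> opp_pol \<Psi> x j. 1 - Q CS x D - Q CU x D)"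

definition R_S :: "inst \<Rightarrow> messages \<Rightarrow> nat \<Rightarrow> nat \<Rightarrow> real" where
  "R_S \<Psi> Q x j =
    (\<Prod>D\<in>opp_pol \<Psi> x j. 1 - Q CS x D) * (\<Prod>D\<in>same_pol \<Psi> x j. 1 - Q CU x D) - R_star \<Psi> Q x j"

definition R_U :: "inst \<Rightarrow> messages \<Rightarrow> nat \<Rightarrow> nat \<Rightarrow> real" where
  "R_U \<Psi> Q x j =
    (\<Prod>D\<in>opp_pol \<Psi> x j. 1 - Q CU x D) * (\<Prod>D\<in>same_pol \<Psi> x j. 1 - Q CS x D) - R_star \<Psi> Q x j"

text \<open>If \<open>x\<close> receives contradictory warnings with certainty, then all three products may vanish.
  In this case the division by zero makes all three normalised values zero, here and in
  \<open>sp_marginal\<close> below.\<close>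

definition sp_step :: "inst \<Rightarrow> messages \<Rightarrow> messages" where
  "sp_step \<Psi> Q = (\<lambda>k x j.
    let others = vars (\<Psi> ! j) - {x};
        total = R_S \<Psi> Q x j + R_U \<Psi> Q x j + R_star \<Psi> Q x j
    in case k of
         CS \<Rightarrow> if csign (\<Psi> ! j) = Plus then 0 else (\<Prod>y\<in>others. Q VU y j)
       | CU \<Rightarrow> if csign (\<Psi> ! j) = Minus then 0 else (\<Prod>y\<in>others. Q VS y j)
       | VS \<Rightarrow> R_S \<Psi> Q x j / total
       | VU \<Rightarrow> R_U \<Psi> Q x j / total
       | VStar \<Rightarrow> R_star \<Psi> Q x j / total)"

definition sp_run :: "nat \<Rightarrow> inst \<Rightarrow> messages \<Rightarrow> messages" where
  "sp_run r \<Psi> u = (sp_step \<Psi> ^^ r) (sp_init u)"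

text \<open>In the following, \<open>occ \<Psi> x True\<close> and \<open>occ \<Psi> x False\<close> are the sets of clauses in which
  \<open>x\<close> appears without and with negation. Thus \<open>W \<Psi> Q x True\<close> and \<open>W \<Psi> Q x False\<close> are the
  unnormalised $W_x(1)$ and $W_x(0)$.\<close>

definition occ :: "inst \<Rightarrow> nat \<Rightarrow> bool \<Rightarrow> nat set" where
  "occ \<Psi> x b = {i. i < length \<Psi> \<and> (x, b) |\<in>| lits (\<Psi> ! i)}"

definition W_star :: "inst \<Rightarrow> messages \<Rightarrow> nat \<Rightarrow> real" where
  "W_star \<Psi> Q x = (\<Prod>D\<in>occ \<Psi> x True \<union> occ \<Psi> x False. 1 - Q CS x D - Q CU x D)"

definition W :: "inst \<Rightarrow> messages \<Rightarrow> nat \<Rightarrow> bool \<Rightarrow> real" where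
  "W \<Psi> Q x v =
    (\<Prod>D\<in>occ \<Psi> x (\<not> v). 1 - Q CS x D) * (\<Prod>D\<in>occ \<Psi> x v. 1 - Q CU x D) - W_star \<Psi> Q x"

definition sp_marginal :: "inst \<Rightarrow> messages \<Rightarrow> nat \<Rightarrow> bool \<Rightarrow> real" where
  "sp_marginal \<Psi> Q x v = W \<Psi> Q x v / (W \<Psi> Q x False + W \<Psi> Q x True + W_star \<Psi> Q x)"

definition sp_choice :: "nat \<Rightarrow> inst \<Rightarrow> messages \<Rightarrow> nat \<Rightarrow> bool" where
  "sp_choice r \<Psi> u x \<longleftrightarrow>
    sp_marginal \<Psi> (sp_run r \<Psi> u) x True > sp_marginal \<Psi> (sp_run r \<Psi> u) x False"

section \<open>SP-guided decimation\<close>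

text \<open>The algorithm uses independent uniform numbers \<open>\<omega> (i, k, x, j)\<close>, where \<open>i\<close> is the
  decimation step (starting from 0) and \<open>k\<close>, \<open>x\<close>, \<open>j\<close> select the initial message.\<close>

type_synonym seed = "nat \<times> kind \<times> nat \<times> nat \<Rightarrow> real"

definition seed_space :: "seed measure" where
  "seed_space = (\<Pi>\<^sub>M e\<in>UNIV. uniform_measure lborel {0..1})"

definition seed_at :: "seed \<Rightarrow> nat \<Rightarrow> messages" where
  "seed_at \<omega> i = (\<lambda>k x j. \<omega> (i, k, x, j))"

text \<open>\<open>decimated r \<omega> \<Phi> i\<close> is the instance left after the variables \<open>0, \<dots>, i - 1\<close> have been
  fixed.\<close>

primrec decimated :: "nat \<Rightarrow> seed \<Rightarrow> inst \<Rightarrow> nat \<Rightarrow> inst" where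
  "decimated r \<omega> \<Phi> 0 = \<Phi>"
| "decimated r \<omega> \<Phi> (Suc i) =
    fix_var i (sp_choice r (decimated r \<omega> \<Phi> i) (seed_at \<omega> i) i) (decimated r \<omega> \<Phi> i)"

definition sp_output :: "nat \<Rightarrow> seed \<Rightarrow> inst \<Rightarrow> nat \<Rightarrow> bool" where
  "sp_output r \<omega> \<Phi> i = sp_choice r (decimated r \<omega> \<Phi> i) (seed_at \<omega> i) i"

definition sp_space :: "nat \<Rightarrow> real \<Rightarrow> nat \<Rightarrow> (inst \<times> seed) measure" where
  "sp_space K d n = measure_pmf (formula_pmf K d n) \<Otimes>\<^sub>M seed_space"

text \<open>The variables that are not among those of \<open>\<Phi>\<close> also receive a value here, but it does not
  matter for satisfaction.\<close>

definition sp_solves :: "nat \<Rightarrow> (inst \<times> seed) set" where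
  "sp_solves r = {(\<Phi>, \<omega>). satisfies (sp_output r \<omega> \<Phi>) \<Phi>}"

section \<open>Success of the algorithm is an event\<close>

lemma prob_space_sp_space: "prob_space (sp_space K d n)"
proof -
  interpret U: prob_space "uniform_measure lborel {0..1::real}"
    by (rule prob_space_uniform_measure) auto
  interpret P: product_prob_space "\<lambda>e::nat \<times> kind \<times> nat \<times> nat. uniform_measure lborel {0..1::real}" UNIV
    by unfold_locales
  have "prob_space seed_space"
    unfolding seed_space_def by (rule P.prob_space_axioms)
  then interpret S: prob_space seed_space .
  interpret pair_prob_space "measure_pmf (formula_pmf K d n)" seed_space
    by unfold_locales
  show ?thesis
    unfolding sp_space_def by (rule prob_space_axioms)
qed

lemma measurable_seed_at [measurable]:
  "(\<lambda>\<omega>. seed_at \<omega> i k x j) \<in> borel_measurable seed_space"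
proof -
  have "(\<lambda>\<omega>. \<omega> (i, k, x, j)) \<in> seed_space \<rightarrow>\<^sub>M uniform_measure lborel {0..1::real}"
    unfolding seed_space_def by (rule measurable_component_singleton) simp
  then show ?thesis
    by (simp add: seed_at_def cong: measurable_cong_sets)
qed

lemma measurable_sp_run:
  "(\<lambda>\<omega>. sp_run r \<Psi> (seed_at \<omega> i) k x j) \<in> borel_measurable seed_space"
proof (induction r arbitrary: k x j)
  case 0
  then show ?case
    by (cases k) (simp_all add: sp_run_def sp_init_def)
next
  case (Suc r)
  note [measurable] = Suc.IH
  have eq: "sp_run (Suc r) \<Psi> u = sp_step \<Psi> (sp_run r \<Psi> u)" for u
    by (simp add: sp_run_def)
  show ?case
    unfolding eq
    by (cases k) (simp_all add: sp_step_def Let_def R_S_def R_U_def R_star_def)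
qed

lemma measurable_sp_choice:
  "Measurable.pred seed_space (\<lambda>\<omega>. sp_choice r \<Psi> (seed_at \<omega> i) x)"
proof -
  note [measurable] = measurable_sp_run
  show ?thesis
    unfolding sp_choice_def sp_marginal_def W_def W_star_def by measurable
qed

lemma measurable_decimated:
  "(\<lambda>\<omega>. decimated r \<omega> \<Phi> i) \<in> seed_space \<rightarrow>\<^sub>M count_space UNIV"
proof (induction i)
  case (Suc i)
  note [measurable] = measurable_sp_choice
  have "(\<lambda>\<omega>. fix_var i (sp_choice r \<Psi> (seed_at \<omega> i) i) \<Psi>) \<in> seed_space \<rightarrow>\<^sub>M count_space UNIV"
    for \<Psi> by measurable
  from measurable_compose_countable[OF this Suc.IH] show ?case by simp
qed simp

lemma measurable_sp_output:
  "Measurable.pred seed_space (\<lambda>\<omega>. sp_output r \<omega> \<Phi> i)"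
  unfolding sp_output_def
  by (rule measurable_compose_countable[OF measurable_sp_choice measurable_decimated])

lemma measurable_satisfies:
  "Measurable.pred seed_space (\<lambda>\<omega>. satisfies (sp_output r \<omega> \<Phi>) \<Phi>)"
proof -
  note [measurable] = measurable_sp_output
  have fset_ex: "(\<exists>l. l |\<in>| A \<and> P l) \<longleftrightarrow> (\<exists>l\<in>fset A. P l)" for A :: "lit fset" and P
    by auto
  have "Measurable.pred seed_space (\<lambda>\<omega>. sat_clause (sp_output r \<omega> \<Phi>) C)" for C
    unfolding sat_clause_def lit_val_def fset_ex by (cases "csign C") simp_all
  then show ?thesis
    unfolding satisfies_def by simp
qed

lemma sp_solves_measurable: "sp_solves r \<in> sets (sp_space K d n)"
proof -
  let ?M = "count_space UNIV \<Otimes>\<^sub>M seed_space :: (inst \<times> seed) measure"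
  have "Measurable.pred ?M (\<lambda>p. satisfies (sp_output r (snd p) \<Phi>) \<Phi>)" for \<Phi>
    by (rule measurable_compose[OF measurable_snd measurable_satisfies])
  from measurable_compose_countable[OF this measurable_fst]
  have "Measurable.pred ?M (\<lambda>p. satisfies (sp_output r (snd p) (fst p)) (fst p))" .
  then have "{p \<in> space ?M. satisfies (sp_output r (snd p) (fst p)) (fst p)} \<in> sets ?M"
    by (rule predE)
  moreover have "space ?M = UNIV"
    by (simp add: space_pair_measure seed_space_def space_PiM)
  moreover have "sets (sp_space K d n) = sets ?M"
    unfolding sp_space_def by (rule sets_pair_measure_cong) simp_all
  ultimately show ?thesis
    by (simp add: sp_solves_def case_prod_unfold)
qed

end

theory Submission
  imports Defs "HOL-Real_Asymp.Real_Asymp"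
begin

text \<open>
  Survey propagation decides a variable from the clauses within bounded distance, so for suitable
  thresholds in place of the coin flips the algorithm is a deterministic rule that scans the
  variables in order and looks only at a bounded neighbourhood in the current instance. Its output
  at a variable differs from what it would produce on a large ball around that variable only if there
  is a long decreasing chain of nearby variables; a first moment count over the trees spanned
  by such chains gives a factor \<open>1 / L!\<close>, so this concerns few variables.

  Take three copies of the random formula that share their first \<open>t\<close> clauses and are otherwise
  independent. By the Efron--Stein inequality the pairwise distances of the three outputs
  concentrate around a mean that moves in small steps from \<open>t = 0\<close> to the value 0 at
  \<open>t = m\<close>. Hence either the outputs of independent copies are already within \<open>n / 50\<close>, or for some
  \<open>t\<close> all pairwise distances lie between \<open>n / 100\<close> and \<open>n / 50\<close>. By Jensen's inequality all three outputs
  are solutions with probability at least the cube of the success probability. On the other hand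
  the expected number of such triples of solutions is exponentially small: for triples it would be
  enough that \<open>d\<close> exceeds \<open>2 ^ (K - 1) * ln 2 / 3\<close> by a constant factor, whereas at the density
  \<open>2 ^ (K - 1) * ln 2 / 2\<close> of the hypothesis the expected number of pairs is not small.
\<close>

text \<open>Fixing the seed would not give a local rule: initial messages are indexed by clause
  positions, so deleting a far clause shifts positions and changes them. Only the probability that a
  variable is set to true depends on the view alone, hence thresholds on that probability. To find
  good ones, success is summed over the assignments that the run may output; once the output is
  prescribed, the decimated instances are fixed and the choices are independent.

  The true output may change at many variables when one clause changes, since a change can travel
  down a decreasing chain. Concentration is therefore proved for \<open>localized\<close>, the
  output computed on a ball, which is stable while degrees are small.

  In the chain count, the short paths between successive chain points may overlap. They are rerouted
  along geodesics into a tree: one edge fewer than nodes, so the powers of \<open>n\<close> cancel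
  up to one, and the order of the chain points supplies the factorial.

  The exponent per variable of the expected number of triples is at most
  \<open>ln 2 + 2 * (101 / 1000) - 27 / 10 * (ln 2 / 2)\<close>, which is negative. For pairs,
  \<open>ln 2 - 2 * (ln 2 / 2)\<close> is already 0 before the choice of the second assignment is
  counted.\<close>

abbreviation Pr :: "'a pmf \<Rightarrow> 'a set \<Rightarrow> real" where
  "Pr \<equiv> measure_pmf.prob"

abbreviation EV :: "'a pmf \<Rightarrow> ('a \<Rightarrow> real) \<Rightarrow> real" where
  "EV \<equiv> measure_pmf.expectation"

section \<open>Sequential local rules\<close>

primrec nbr :: "clause set \<Rightarrow> nat \<Rightarrow> nat \<Rightarrow> nat set" where
  "nbr S 0 x = {x}"
| "nbr S (Suc t) x = nbr S t x \<union> \<Union> {vars C |C. C \<in> S \<and> vars C \<inter> nbr S t x \<noteq> {}}"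

text \<open>Clauses meeting the ball are kept whole, so variables at distance \<open>Suc t\<close>
  still occur. Order and multiplicity of the clauses are preserved.\<close>

definition view :: "nat \<Rightarrow> inst \<Rightarrow> nat \<Rightarrow> inst" where
  "view t \<Phi> x = filter (\<lambda>C. vars C \<inter> nbr (set \<Phi>) t x \<noteq> {}) \<Phi>"

lemma nbr_mono: "s \<le> t \<Longrightarrow> nbr S s x \<subseteq> nbr S t x"
  by (rule lift_Suc_mono_le[of "\<lambda>t. nbr S t x"]) auto

lemma nbr_mono_set: "A \<subseteq> B \<Longrightarrow> nbr A t x \<subseteq> nbr B t x"
proof (induction t)
  case (Suc t)
  show ?case
  proof
    fix y assume "y \<in> nbr A (Suc t) x"
    then consider "y \<in> nbr A t x" | C where "C \<in> A" "vars C \<inter> nbr A t x \<noteq> {}" "y \<in> vars C"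
      by auto
    then show "y \<in> nbr B (Suc t) x"
    proof cases
      case (2 C)
      then have "C \<in> B" "vars C \<inter> nbr B t x \<noteq> {}"
        using Suc by blast+
      with 2 show ?thesis by auto
    qed (use Suc in auto)
  qed
qed simp

lemma nbr_Suc_iff:
  "y \<in> nbr S (Suc t) x \<longleftrightarrow> y \<in> nbr S t x \<or> (\<exists>C\<in>S. y \<in> vars C \<and> (\<exists>z\<in>vars C. z \<in> nbr S t x))"
  by auto

lemma nbr_trans: "y \<in> nbr S a x \<Longrightarrow> z \<in> nbr S b y \<Longrightarrow> z \<in> nbr S (a + b) x"
proof (induction b arbitrary: z)
  case (Suc b)
  then show ?case
    unfolding add_Suc_right nbr_Suc_iff by metis
qed simp

lemma nbr_sym: "y \<in> nbr S t x \<Longrightarrow> x \<in> nbr S t y"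
proof (induction t arbitrary: y)
  case (Suc t)
  from Suc.prems consider "y \<in> nbr S t x" | C z where "C \<in> S" "y \<in> vars C" "z \<in> vars C" "z \<in> nbr S t x"
    unfolding nbr_Suc_iff by blast
  then show ?case
  proof cases
    case 1
    then show ?thesis using Suc.IH by auto
  next
    case 2
    then have "z \<in> nbr S (Suc 0) y"
      unfolding nbr_Suc_iff by auto
    from nbr_trans[OF this Suc.IH[OF 2(4)]] show ?thesis
      by simp
  qed
qed simp

lemma nbr_cong:
  assumes "A \<subseteq> B" "\<And>C. C \<in> B \<Longrightarrow> vars C \<inter> nbr B t x \<noteq> {} \<Longrightarrow> C \<in> A"
  shows "s \<le> Suc t \<Longrightarrow> nbr A s x = nbr B s x"
proof (induction s)
  case (Suc s)
  then have IH: "nbr A s x = nbr B s x" by simp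
  have "vars C \<inter> nbr B t x \<noteq> {}" if "vars C \<inter> nbr B s x \<noteq> {}" for C
    using that nbr_mono[of s t B x] Suc.prems by blast
  then have "C \<in> A \<longleftrightarrow> C \<in> B" if "vars C \<inter> nbr B s x \<noteq> {}" for C
    using that assms by blast
  then have "{vars C |C. C \<in> A \<and> vars C \<inter> nbr B s x \<noteq> {}} = {vars C |C. C \<in> B \<and> vars C \<inter> nbr B s x \<noteq> {}}"
    by blast
  then show ?case
    using IH by simp
qed simp

lemma filter_map_filter_filter:
  assumes "\<And>C D. C \<in> set \<Phi> \<Longrightarrow> f C = Some D \<Longrightarrow> H D \<Longrightarrow> Q C"
  shows "filter H (List.map_filter f (filter Q \<Phi>)) = filter H (List.map_filter f \<Phi>)"
  using assms by (induction \<Phi>) (auto simp: List.map_filter_simps split: option.splits)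

lemma set_map_filter: "set (List.map_filter f \<Phi>) = {D. \<exists>C\<in>set \<Phi>. f C = Some D}"
  by (induction \<Phi>) (auto simp: List.map_filter_simps split: option.splits)

text \<open>Shrinking clauses only shrinks balls. A clause whose image is seen after
  \<open>f\<close> therefore met the ball before \<open>f\<close> and survives \<open>Q\<close>.
  This allows far clauses to be deleted before decimation instead of after it.\<close>

lemma view_map_filter:
  assumes f: "\<And>C D. C \<in> set \<Phi> \<Longrightarrow> f C = Some D \<Longrightarrow> vars D \<subseteq> vars C"
    and Q: "\<And>C. C \<in> set \<Phi> \<Longrightarrow> vars C \<inter> nbr (set \<Phi>) t x \<noteq> {} \<Longrightarrow> Q C"
  shows "view t (List.map_filter f (filter Q \<Phi>)) x = view t (List.map_filter f \<Phi>) x"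
proof -
  let ?A = "set (List.map_filter f (filter Q \<Phi>))" and ?B = "set (List.map_filter f \<Phi>)"
  have sub: "nbr ?B s x \<subseteq> nbr (set \<Phi>) s x" for s
  proof (induction s)
    case (Suc s)
    show ?case
    proof
      fix y assume "y \<in> nbr ?B (Suc s) x"
      then consider "y \<in> nbr ?B s x" | D z where "D \<in> ?B" "y \<in> vars D" "z \<in> vars D" "z \<in> nbr ?B s x"
        unfolding nbr_Suc_iff by blast
      then show "y \<in> nbr (set \<Phi>) (Suc s) x"
      proof cases
        case 2
        then obtain C where "C \<in> set \<Phi>" "f C = Some D"
          by (auto simp: set_map_filter)
        with f[OF this] 2 Suc show ?thesis
          unfolding nbr_Suc_iff by blast
      qed (use Suc in auto)
    qed
  qed simp
  have hit: "Q C" if "C \<in> set \<Phi>" "f C = Some D" "vars D \<inter> nbr ?B t x \<noteq> {}" for C D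
    using that f[OF that(1,2)] sub[of t] by (intro Q) auto
  have eq: "nbr ?A t x = nbr ?B t x"
  proof (rule nbr_cong[of _ _ t])
    show "?A \<subseteq> ?B" by (auto simp: set_map_filter)
    show "D \<in> ?A" if "D \<in> ?B" "vars D \<inter> nbr ?B t x \<noteq> {}" for D
      using that hit by (auto simp: set_map_filter)
  qed simp
  show ?thesis
    unfolding view_def eq by (rule filter_map_filter_filter) (rule hit)
qed

section \<open>Decimation as a clause-by-clause reduction\<close>

primrec redc :: "(nat \<Rightarrow> bool) \<Rightarrow> nat \<Rightarrow> clause \<Rightarrow> clause option" where
  "redc \<sigma> 0 C = Some C"
| "redc \<sigma> (Suc i) C = Option.bind (redc \<sigma> i C) (fix_clause i (\<sigma> i))"

lemma vars_fix_clause: "fix_clause x v C = Some D \<Longrightarrow> vars D \<subseteq> vars C"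
  by (auto simp: fix_clause_def Let_def vars_def split: if_splits csign.splits)

lemma vars_redc: "redc \<sigma> i C = Some D \<Longrightarrow> vars D \<subseteq> vars C"
proof (induction i arbitrary: D)
  case (Suc i)
  then obtain B where "redc \<sigma> i C = Some B" "fix_clause i (\<sigma> i) B = Some D"
    by (auto simp: bind_eq_Some_conv)
  with Suc.IH vars_fix_clause show ?case by blast
qed simp

lemma redc_cong:
  "(\<And>k. k < i \<Longrightarrow> k \<in> vars C \<Longrightarrow> \<sigma> k = \<tau> k) \<Longrightarrow> redc \<sigma> i C = redc \<tau> i C"
proof (induction i)
  case (Suc i)
  then have IH: "redc \<sigma> i C = redc \<tau> i C" by simp
  show ?case
  proof (cases "redc \<tau> i C")
    case (Some B)
    have "fix_clause i (\<sigma> i) B = fix_clause i (\<tau> i) B"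
    proof (cases "i \<in> vars B")
      case True
      then show ?thesis
        using vars_redc[OF Some] Suc.prems[of i] by auto
    qed (simp add: fix_clause_def)
    then show ?thesis using IH Some by simp
  qed (simp add: IH)
qed simp

primrec dec :: "(nat \<Rightarrow> inst \<Rightarrow> bool) \<Rightarrow> inst \<Rightarrow> nat \<Rightarrow> inst" where
  "dec g \<Phi> 0 = \<Phi>"
| "dec g \<Phi> (Suc i) = fix_var i (g i (dec g \<Phi> i)) (dec g \<Phi> i)"

definition out :: "(nat \<Rightarrow> inst \<Rightarrow> bool) \<Rightarrow> inst \<Rightarrow> nat \<Rightarrow> bool" where
  "out g \<Phi> i = g i (dec g \<Phi> i)"

abbreviation solved :: "(nat \<Rightarrow> inst \<Rightarrow> bool) \<Rightarrow> inst set" where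
  "solved g \<equiv> {\<Phi>. satisfies (out g \<Phi>) \<Phi>}"

lemma map_filter_bind:
  "List.map_filter h (List.map_filter f \<Phi>) = List.map_filter (\<lambda>C. Option.bind (f C) h) \<Phi>"
  by (induction \<Phi>) (auto simp: List.map_filter_simps split: option.splits)

lemma map_filter_cong:
  "(\<And>C. C \<in> set \<Phi> \<Longrightarrow> f C = h C) \<Longrightarrow> List.map_filter f \<Phi> = List.map_filter h \<Phi>"
  by (induction \<Phi>) (auto simp: List.map_filter_simps split: option.splits)

lemma map_filter_redc_0: "List.map_filter (redc \<sigma> 0) \<Phi> = \<Phi>"
  by (induction \<Phi>) (auto simp: List.map_filter_simps)

lemma map_filter_redc_Suc:
  "List.map_filter (redc \<sigma> (Suc i)) \<Phi> = fix_var i (\<sigma> i) (List.map_filter (redc \<sigma> i) \<Phi>)"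
  unfolding fix_var_def map_filter_bind by (rule map_filter_cong) simp

text \<open>Fixing variables treats each clause separately, so the history enters only through the
  output values, and for a given clause only through the values at its own variables
  (\<open>redc_cong\<close>).\<close>

lemma dec_eq_redc: "dec g \<Phi> i = List.map_filter (redc (out g \<Phi>) i) \<Phi>"
  by (induction i) (simp_all only: map_filter_redc_0 map_filter_redc_Suc dec.simps out_def)

definition local_rule :: "nat \<Rightarrow> (nat \<Rightarrow> inst \<Rightarrow> bool) \<Rightarrow> bool" where
  "local_rule r g \<longleftrightarrow> (\<forall>i \<Psi>. g i (view r \<Psi> i) = g i \<Psi>)"

text \<open>If nothing near \<open>i\<close> is deleted and the earlier variables in clauses near
  \<open>i\<close> keep their values, both runs reach \<open>i\<close> with the same view: drop the
  far clauses, exchange the two outputs, then put back the far clauses that satisfy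
  \<open>P\<close>.\<close>

lemma out_filter_differs:
  assumes "local_rule r g" "out g \<Phi> i \<noteq> out g (filter P \<Phi>) i"
  obtains C where "C \<in> set \<Phi>" "vars C \<inter> nbr (set \<Phi>) r i \<noteq> {}"
    "\<not> P C \<or> (\<exists>k<i. k \<in> vars C \<and> out g \<Phi> k \<noteq> out g (filter P \<Phi>) k)"
proof (rule ccontr)
  note thesisI = that
  assume "\<not> thesis"
  then have no: "P C" "\<And>k. k < i \<Longrightarrow> k \<in> vars C \<Longrightarrow> out g \<Phi> k = out g (filter P \<Phi>) k"
    if "C \<in> set \<Phi>" "vars C \<inter> nbr (set \<Phi>) r i \<noteq> {}" for C
    using that \<open>\<not> thesis\<close> thesisI by blast+
  let ?Q = "\<lambda>C. vars C \<inter> nbr (set \<Phi>) r i \<noteq> {}"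
  let ?\<sigma> = "out g \<Phi>" and ?\<tau> = "out g (filter P \<Phi>)"
  have "view r (dec g \<Phi> i) i = view r (List.map_filter (redc ?\<sigma> i) (filter ?Q \<Phi>)) i"
    unfolding dec_eq_redc by (rule view_map_filter[symmetric]) (auto dest: vars_redc)
  also have "List.map_filter (redc ?\<sigma> i) (filter ?Q \<Phi>) = List.map_filter (redc ?\<tau> i) (filter ?Q \<Phi>)"
    using no(2) by (intro map_filter_cong redc_cong) auto
  also have "filter ?Q \<Phi> = filter ?Q (filter P \<Phi>)"
    using no(1) by (auto intro: filter_cong)
  also have "view r (List.map_filter (redc ?\<tau> i) \<dots>) i = view r (List.map_filter (redc ?\<tau> i) (filter P \<Phi>)) i"
  proof (rule view_map_filter)
    have "nbr (set (filter P \<Phi>)) r i \<subseteq> nbr (set \<Phi>) r i"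
      by (rule nbr_mono_set) auto
    then show "?Q C" if "vars C \<inter> nbr (set (filter P \<Phi>)) r i \<noteq> {}" for C
      using that by blast
  qed (auto dest: vars_redc)
  also have "\<dots> = view r (dec g (filter P \<Phi>) i) i"
    unfolding dec_eq_redc ..
  finally have "?\<sigma> i = ?\<tau> i"
    using assms(1) unfolding local_rule_def out_def by metis
  with assms(2) show False by simp
qed

section \<open>Decreasing chains of influence\<close>

definition desc :: "inst \<Rightarrow> nat \<Rightarrow> nat \<Rightarrow> nat \<Rightarrow> bool" where
  "desc \<Phi> R a b \<longleftrightarrow> b < a \<and> b \<in> nbr (set \<Phi>) R a"

lemma out_filter_differs_chain:
  assumes "local_rule r g"
  shows "out g \<Phi> i \<noteq> out g (filter P \<Phi>) i \<Longrightarrow>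
    \<exists>y. (desc \<Phi> (Suc r))\<^sup>*\<^sup>* i y \<and> (\<exists>C\<in>set \<Phi>. vars C \<inter> nbr (set \<Phi>) r y \<noteq> {} \<and> \<not> P C)"
proof (induction i rule: less_induct)
  case (less i)
  obtain C where C: "C \<in> set \<Phi>" "vars C \<inter> nbr (set \<Phi>) r i \<noteq> {}"
    "\<not> P C \<or> (\<exists>k<i. k \<in> vars C \<and> out g \<Phi> k \<noteq> out g (filter P \<Phi>) k)"
    using out_filter_differs[OF assms less.prems] .
  show ?case
  proof (cases "P C")
    case True
    then obtain k where k: "k < i" "k \<in> vars C" "out g \<Phi> k \<noteq> out g (filter P \<Phi>) k"
      using C(3) by blast
    have "k \<in> nbr (set \<Phi>) (Suc r) i"
      using C k unfolding nbr_Suc_iff by blast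
    then have "desc \<Phi> (Suc r) i k"
      using k by (simp add: desc_def)
    with less.IH[OF k(1,3)] show ?thesis
      by (meson converse_rtranclp_into_rtranclp)
  qed (use C in blast)
qed

text \<open>The second condition says that no two non-consecutive points can be joined directly, as
  on a shortest decreasing path. It later keeps distant pieces of the spanning tree
  disjoint.\<close>

definition chain :: "inst \<Rightarrow> nat \<Rightarrow> nat \<Rightarrow> nat \<Rightarrow> bool" where
  "chain \<Phi> R L i \<longleftrightarrow> (\<exists>c. c 0 = i \<and> (\<forall>a<L. desc \<Phi> R (c a) (c (Suc a))) \<and>
    (\<forall>a b. a + 2 \<le> b \<longrightarrow> b \<le> L \<longrightarrow> c b \<notin> nbr (set \<Phi>) R (c a)))"

lemma desc_sequence_less:
  assumes "\<And>a. a < L \<Longrightarrow> desc \<Phi> R (c a) (c (Suc a))"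
  shows "a < b \<Longrightarrow> b \<le> L \<Longrightarrow> c b < c a"
proof (induction b)
  case (Suc b)
  have "c (Suc b) < c b"
    using assms[of b] Suc.prems by (simp add: desc_def)
  with Suc show ?case
    by (cases "a = b") auto
qed simp

lemma desc_relpowp_nbr: "(desc \<Phi> R ^^ l) a b \<Longrightarrow> b \<in> nbr (set \<Phi>) (l * R) a"
proof (induction l arbitrary: b)
  case (Suc l)
  then obtain y where "(desc \<Phi> R ^^ l) a y" "desc \<Phi> R y b"
    by (auto simp: OO_def)
  then have "b \<in> nbr (set \<Phi>) (l * R + R) a"
    using Suc.IH nbr_trans unfolding desc_def by blast
  then show ?case
    by (simp add: add.commute)
qed simp

text \<open>A discrepancy at \<open>i\<close> comes down a decreasing path from a deleted clause. A
  shortest such path with at most \<open>L\<close> steps would end inside the ball of radius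
  \<open>L * Suc r + r\<close>, where nothing is deleted; a longer one begins with a chain.\<close>

lemma out_view:
  assumes "local_rule r g" "\<not> chain \<Phi> (Suc r) L i" "\<rho> = L * Suc r + r"
  shows "out g (view \<rho> \<Phi> i) i = out g \<Phi> i"
proof (rule ccontr)
  assume differs: "out g (view \<rho> \<Phi> i) i \<noteq> out g \<Phi> i"
  let ?D = "desc \<Phi> (Suc r)"
  obtain y C where y: "?D\<^sup>*\<^sup>* i y" and C: "C \<in> set \<Phi>" "vars C \<inter> nbr (set \<Phi>) r y \<noteq> {}"
      "\<not> vars C \<inter> nbr (set \<Phi>) \<rho> i \<noteq> {}"
    using out_filter_differs_chain[OF assms(1), of \<Phi> i] differs unfolding view_def by blast
  define l where "l = (LEAST l. (?D ^^ l) i y)"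
  obtain l0 where "(?D ^^ l0) i y"
    using rtranclp_imp_relpowp[OF y] by blast
  then have l: "(?D ^^ l) i y"
    unfolding l_def by (rule LeastI)
  have least: "l \<le> l'" if "(?D ^^ l') i y" for l'
    unfolding l_def using that by (rule Least_le)
  have "L < l"
  proof (rule ccontr)
    assume "\<not> L < l"
    then have "l * Suc r \<le> L * Suc r"
      by (intro mult_right_mono) auto
    then have "l * Suc r + r \<le> \<rho>"
      using assms(3) by simp
    moreover obtain z where z: "z \<in> vars C" "z \<in> nbr (set \<Phi>) r y"
      using C(2) by blast
    ultimately have "z \<in> nbr (set \<Phi>) \<rho> i"
      using nbr_trans[OF desc_relpowp_nbr[OF l] z(2)] nbr_mono by blast
    with z C(3) show False by blast
  qed
  obtain c where c: "c 0 = i" "c l = y" "\<And>a. a < l \<Longrightarrow> ?D (c a) (c (Suc a))"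
    using l unfolding relpowp_fun_conv by blast
  have seg: "(?D ^^ (b - a)) (c a) (c b)" if "a \<le> b" "b \<le> l" for a b
    unfolding relpowp_fun_conv using that c(3) by (intro exI[of _ "\<lambda>j. c (a + j)"]) auto
  have "c b \<notin> nbr (set \<Phi>) (Suc r) (c a)" if ab: "a + 2 \<le> b" "b \<le> L" for a b
  proof
    assume m: "c b \<in> nbr (set \<Phi>) (Suc r) (c a)"
    have "c b < c a"
      using desc_sequence_less[of l \<Phi> "Suc r" c a b] c(3) ab \<open>L < l\<close> by simp
    have "?D (c a) (c b)"
      using m \<open>c b < c a\<close> by (simp add: desc_def)
    then have "(?D ^^ 1) (c a) (c b)"
      by (auto simp: OO_def)
    moreover have "(?D ^^ a) i (c a)" "(?D ^^ (l - b)) (c b) y"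
      using seg[of 0 a] seg[of b l] ab \<open>L < l\<close> c(1,2) by auto
    \<comment> \<open>The direct step from \<open>c a\<close> to \<open>c b\<close> bypasses at
      least one point, so the new path is shorter than the minimum \<open>l\<close>.\<close>
    ultimately have "(?D ^^ (a + 1 + (l - b))) i y"
      by (meson relpowp_trans)
    from least[OF this] ab \<open>L < l\<close> show False
      by simp
  qed
  with c \<open>L < l\<close> have "chain \<Phi> (Suc r) L i"
    unfolding chain_def by (intro exI[of _ c]) auto
  with assms(2) show False ..
qed

section \<open>Caterpillars\<close>

definition conn :: "('v \<Rightarrow> 'v \<Rightarrow> bool) \<Rightarrow> nat \<Rightarrow> 'v \<Rightarrow> 'v \<Rightarrow> bool" where
  "conn E k a b \<longleftrightarrow>
    (\<exists>xs. xs \<noteq> [] \<and> successively E xs \<and> hd xs = a \<and> last xs = b \<and> length xs \<le> Suc k)"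

lemma connI:
  "xs \<noteq> [] \<Longrightarrow> successively E xs \<Longrightarrow> length xs \<le> Suc k \<Longrightarrow> conn E k (hd xs) (last xs)"
  unfolding conn_def by blast

lemma conn_mono: "conn E j a b \<Longrightarrow> j \<le> k \<Longrightarrow> conn E k a b"
  unfolding conn_def by (metis Suc_le_mono le_trans)

lemma conn_refl: "conn E 0 a a"
  unfolding conn_def by (rule exI[of _ "[a]"]) auto

lemma conn_step: "E a b \<Longrightarrow> conn E 1 a b"
  unfolding conn_def by (rule exI[of _ "[a, b]"]) auto

lemma conn_trans:
  assumes "conn E j a b" "conn E k b c"
  shows "conn E (j + k) a c"
proof -
  obtain xs where xs: "xs \<noteq> []" "successively E xs" "hd xs = a" "last xs = b" "length xs \<le> Suc j"
    using assms(1) unfolding conn_def by blast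
  obtain ys where ys: "ys \<noteq> []" "successively E ys" "hd ys = b" "last ys = c" "length ys \<le> Suc k"
    using assms(2) unfolding conn_def by blast
  obtain zs where zs: "ys = b # zs"
    using ys(1,3) by (cases ys) auto
  have "successively E (xs @ zs)"
    using xs ys zs by (cases zs) (auto simp: successively_append_iff)
  moreover have "last (xs @ zs) = c"
    using xs(4) ys(4) zs by (cases zs) auto
  ultimately show ?thesis
    using xs ys zs unfolding conn_def by (intro exI[of _ "xs @ zs"]) auto
qed

lemma conn_sym:
  assumes "symp E" "conn E k a b"
  shows "conn E k b a"
proof -
  obtain xs where xs: "xs \<noteq> []" "successively E xs" "hd xs = a" "last xs = b" "length xs \<le> Suc k"
    using assms(2) unfolding conn_def by blast
  have flip: "(\<lambda>x y. E y x) = E"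
    using assms(1) by (auto simp: symp_def fun_eq_iff)
  have "successively E (rev xs)"
    using xs(2) unfolding successively_rev flip .
  then show ?thesis
    using xs unfolding conn_def by (intro exI[of _ "rev xs"]) (simp add: hd_rev last_rev)
qed

definition via :: "('v \<Rightarrow> 'v \<Rightarrow> bool) \<Rightarrow> nat \<Rightarrow> 'v \<Rightarrow> 'v \<Rightarrow> 'v \<Rightarrow> bool" where
  "via E k a z b \<longleftrightarrow> (\<exists>e f. conn E e a z \<and> conn E f z b \<and> e + f \<le> k)"

text \<open>Exchange the halves of the two walks at \<open>z\<close>: the lengths
  \<open>e + e'\<close> and \<open>f + f'\<close> add up to at most \<open>2 * k\<close>, so one of
  them is at most \<open>k\<close>.\<close>

lemma via_cross:
  assumes "symp E" "via E k a z b" "via E k a' z b'"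
  shows "conn E k a a' \<or> conn E k b b'"
proof -
  obtain e f where ef: "conn E e a z" "conn E f z b" "e + f \<le> k"
    using assms(2) unfolding via_def by blast
  obtain e' f' where ef': "conn E e' a' z" "conn E f' z b'" "e' + f' \<le> k"
    using assms(3) unfolding via_def by blast
  have "conn E (e + e') a a'" "conn E (f + f') b b'"
    using ef ef' conn_trans conn_sym[OF assms(1)] by metis+
  moreover have "e + e' \<le> k \<or> f + f' \<le> k"
    using ef(3) ef'(3) by arith
  ultimately show ?thesis
    using conn_mono by metis
qed

lemma via_path:
  assumes "successively E xs" "z \<in> set xs" "length xs \<le> Suc k"
  shows "via E k (hd xs) z (last xs)"
proof -
  obtain as bs where xs: "xs = as @ z # bs"
    using assms(2) split_list by metis
  have "successively E (as @ [z])" "successively E (z # bs)"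
    using assms(1) xs by (auto simp: successively_append_iff)
  then have "conn E (length as) (hd (as @ [z])) (last (as @ [z]))"
    "conn E (length bs) (hd (z # bs)) (last (z # bs))"
    by (intro connI; simp)+
  moreover have "hd (as @ [z]) = hd xs"
    using xs by (cases as) auto
  ultimately show ?thesis
    using xs assms(3) unfolding via_def by (intro exI[of _ "length as"] exI[of _ "length bs"]) auto
qed

definition geodesic :: "('v \<Rightarrow> 'v \<Rightarrow> bool) \<Rightarrow> 'v list \<Rightarrow> bool" where
  "geodesic E xs \<longleftrightarrow> xs \<noteq> [] \<and> successively E xs \<and>
    (\<forall>ys. ys \<noteq> [] \<longrightarrow> successively E ys \<longrightarrow> hd ys = hd xs \<longrightarrow> last ys = last xs \<longrightarrow>
      length xs \<le> length ys)"

lemma geodesicD: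
  assumes "geodesic E xs" "ys \<noteq> []" "successively E ys" "hd ys = hd xs" "last ys = last xs"
  shows "length xs \<le> length ys"
  using assms unfolding geodesic_def by (elim conjE) (drule spec[of _ ys], simp)

lemma conn_geodesic:
  assumes "conn E k a b"
  obtains xs where "geodesic E xs" "hd xs = a" "last xs = b" "length xs \<le> Suc k"
proof -
  let ?P = "\<lambda>xs. xs \<noteq> [] \<and> successively E xs \<and> hd xs = a \<and> last xs = b"
  obtain ys where ys: "?P ys" "length ys \<le> Suc k"
    using assms unfolding conn_def by blast
  obtain xs where xs: "?P xs" "\<And>ys. ?P ys \<Longrightarrow> length xs \<le> length ys"
    using ex_has_least_nat[of ?P ys length] ys(1) by blast
  from xs have "geodesic E xs"
    unfolding geodesic_def by blast
  moreover have "length xs \<le> Suc k"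
    using xs(2)[OF ys(1)] ys(2) by simp
  ultimately show ?thesis
    using xs(1) that by blast
qed

lemma geodesic_distinct:
  assumes "geodesic E xs"
  shows "distinct xs"
proof (rule ccontr)
  assume "\<not> distinct xs"
  then obtain as bs cs y where xs: "xs = as @ [y] @ bs @ [y] @ cs"
    using not_distinct_decomp by blast
  let ?ys = "as @ [y] @ cs"
  have "successively E (as @ [y])" "successively E ([y] @ cs)"
    using assms unfolding geodesic_def xs successively_append_iff by simp_all
  then have "successively E ?ys"
    unfolding successively_append_iff by simp
  moreover have "hd ?ys = hd xs"
    unfolding xs by (cases as) simp_all
  moreover have "last ?ys = last xs"
    unfolding xs by (cases cs) simp_all
  ultimately have "length xs \<le> length ?ys"
    by (intro geodesicD[OF assms]) simp_all
  then show False
    by (simp add: xs)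
qed

lemma geodesic_suffix_le:
  assumes "geodesic E (as @ w # bs)" "successively E (w # cs)" "last (w # cs) = last (w # bs)"
  shows "length bs \<le> length cs"
proof -
  have "successively E (as @ w # cs)"
    using assms(1,2) unfolding geodesic_def by (auto simp: successively_append_iff)
  moreover have "hd (as @ w # cs) = hd (as @ w # bs)"
    by (cases as) auto
  moreover have "last (as @ w # cs) = last (as @ w # bs)"
    using assms(3) by simp
  ultimately have "length (as @ w # bs) \<le> length (as @ w # cs)"
    by (intro geodesicD[OF assms(1)]) simp_all
  then show ?thesis
    by simp
qed

text \<open>A caterpillar is coded by a list of pairs, latest pair first: \<open>(p, l)\<close> means that a path
  of \<open>l\<close> new nodes is attached at position \<open>p\<close> of the current spine segment. Nodes are numbered by
  their order of creation. The first component of \<open>cat\<close> is the number of nodes, the second one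
  is the current segment, which after the attachment runs from the end of the previous segment to
  the last new node.\<close>

fun cat :: "(nat \<times> nat) list \<Rightarrow> nat \<times> nat list" where
  "cat [] = (1, [0])"
| "cat ((p, l) # cs) =
    (fst (cat cs) + l, rev (drop p (snd (cat cs))) @ [fst (cat cs)..<fst (cat cs) + l])"

fun parent :: "(nat \<times> nat) list \<Rightarrow> nat \<Rightarrow> nat" where
  "parent [] q = 0"
| "parent ((p, l) # cs) q =
    (if q < fst (cat cs) then parent cs q
     else if q = fst (cat cs) then snd (cat cs) ! p
     else q - 1)"

text \<open>The numbers of the chain points, latest first: every attached path ends in the next
  chain point, which is the node created last.\<close>

fun ends :: "(nat \<times> nat) list \<Rightarrow> nat list" where
  "ends [] = [0]"
| "ends (c # cs) = (fst (cat (c # cs)) - 1) # ends cs"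

text \<open>Only the edges to parents are demanded. Since parents have smaller numbers and nodes are
  distinct, these are \<open>fst (cat cs) - 1\<close> different edges.\<close>

definition embeds :: "('v \<Rightarrow> 'v \<Rightarrow> bool) \<Rightarrow> (nat \<times> nat) list \<Rightarrow> 'v list \<Rightarrow> bool" where
  "embeds E cs zs \<longleftrightarrow> length zs = fst (cat cs) \<and> distinct zs \<and>
    (\<forall>q. 0 < q \<longrightarrow> q < fst (cat cs) \<longrightarrow> parent cs q < q \<and> E (zs ! parent cs q) (zs ! q))"

lemma cat_pos: "0 < fst (cat cs)"
  by (induction cs rule: cat.induct) auto

lemma map_nth_upt_append: "length zs = n \<Longrightarrow> map ((!) (zs @ fs)) [n..<n + length fs] = fs"
  by (rule nth_equalityI) (auto simp: nth_append)

text \<open>Induction on the number of chain points. From the new point, a geodesic towards the last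
  one is followed until it first meets the current segment; only the part before that is new. The
  final conjunct of the statement says that nodes off the segment lie on short walks between earlier
  consecutive chain points, which is what excludes collisions with new nodes.\<close>

lemma caterpillar_exists_aux:
  assumes E: "symp E"
    and step: "\<And>a. a < L \<Longrightarrow> conn E k (c a) (c (Suc a))"
    and neq: "\<And>a. a < L \<Longrightarrow> c a \<noteq> c (Suc a)"
    and far: "\<And>a b. a + 2 \<le> b \<Longrightarrow> b \<le> L \<Longrightarrow> \<not> conn E k (c a) (c b)"
  shows "N \<le> L \<Longrightarrow> \<exists>cs zs. length cs = N \<and> set cs \<subseteq> {..k} \<times> {1..k} \<and> embeds E cs zs \<and>
    map ((!) zs) (ends cs) = rev (map c [0..<Suc N]) \<and> set (snd (cat cs)) \<subseteq> {..<length zs} \<and>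
    geodesic E (map ((!) zs) (snd (cat cs))) \<and> length (snd (cat cs)) \<le> Suc k \<and>
    hd (map ((!) zs) (snd (cat cs))) = c (N - 1) \<and> last (map ((!) zs) (snd (cat cs))) = c N \<and>
    set (ends cs) \<subseteq> {..<length zs} \<and>
    (\<forall>z\<in>set zs - set (map ((!) zs) (snd (cat cs))).
      \<exists>a. Suc a < N \<and> via E k (c a) z (c (Suc a)))"
proof (induction N)
  case 0
  show ?case
    by (intro exI[of _ "[]"] exI[of _ "[c 0]"]) (auto simp: embeds_def geodesic_def Suc_le_eq)
next
  case (Suc N)
  then obtain cs zs where
    cs: "length cs = N" "set cs \<subseteq> {..k} \<times> {1..k}" and
    emb: "embeds E cs zs" and
    ends: "map ((!) zs) (ends cs) = rev (map c [0..<Suc N])" and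
    bound: "set (snd (cat cs)) \<subseteq> {..<length zs}" and
    geo: "geodesic E (map ((!) zs) (snd (cat cs)))" and
    len: "length (snd (cat cs)) \<le> Suc k" and
    hd: "hd (map ((!) zs) (snd (cat cs))) = c (N - 1)" and
    last: "last (map ((!) zs) (snd (cat cs))) = c N" and
    ends_bound: "set (ends cs) \<subseteq> {..<length zs}" and
    old: "\<forall>z\<in>set zs - set (map ((!) zs) (snd (cat cs))). \<exists>a. Suc a < N \<and> via E k (c a) z (c (Suc a))"
    using Suc_leD by blast
  have N0: "N = 0 \<longrightarrow> cs = []"
    using cs(1) by auto
  define h where "h = snd (cat cs)"
  define M where "M = fst (cat cs)"
  define H where "H = map ((!) zs) h"
  have H_ne: "H \<noteq> []" and H_succ: "successively E H"
    using geo unfolding geodesic_def H_def h_def by auto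
  have lenM: "length zs = M" and dist_zs: "distinct zs"
    using emb by (auto simp: embeds_def M_def)
  have N: "N < L"
    using Suc.prems by simp
  obtain \<gamma> where \<gamma>: "geodesic E \<gamma>" "hd \<gamma> = c (Suc N)" "last \<gamma> = c N" "length \<gamma> \<le> Suc k"
    using conn_geodesic[OF conn_sym[OF E step[OF N]]] .
  have \<gamma>_ne: "\<gamma> \<noteq> []" and \<gamma>_succ: "successively E \<gamma>"
    using \<gamma>(1) unfolding geodesic_def by auto
  have cN_H: "c N \<in> set H"
    using last H_ne last_in_set[of H] by (simp add: H_def h_def)
  have cN_\<gamma>: "c N \<in> set \<gamma>"
    using \<gamma>(3) \<gamma>_ne last_in_set by metis
  \<comment> \<open>\<open>w\<close> is the first node of the geodesic on the current segment
    \<open>H\<close>, and \<open>fs\<close> is the part to be attached.\<close>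
  obtain fs w rest where \<gamma>_eq: "\<gamma> = fs @ w # rest" and wH: "w \<in> set H" and fs: "\<forall>y\<in>set fs. y \<notin> set H"
    using split_list_first_prop[of \<gamma> "\<lambda>y. y \<in> set H"] cN_H cN_\<gamma> by blast
  obtain p where p: "p < length H" "H ! p = w"
    using wH by (metis in_set_conv_nth)
  have viaH: "via E k (c (N - 1)) y (c N)" if "y \<in> set H" for y
    using via_path[OF H_succ that, of k] len hd last by (simp add: H_def h_def)
  have via\<gamma>: "via E k (c (Suc N)) y (c N)" if "y \<in> set \<gamma>" for y
    using via_path[OF \<gamma>_succ that, of k] \<gamma> by simp
  have via\<gamma>': "via E k (c N) y (c (Suc N))" if "y \<in> set \<gamma>" for y
    using via\<gamma>[OF that] conn_sym[OF E] unfolding via_def by (metis add.commute)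
  \<comment> \<open>Every node of \<open>H\<close> is within \<open>k\<close> of
    \<open>c (N - 1)\<close>, whereas \<open>c (Suc N)\<close> is not. For \<open>N = 0\<close> the
    segment is the single node \<open>c 0\<close>.\<close>
  have end_notin: "c (Suc N) \<notin> set H"
  proof
    assume a: "c (Suc N) \<in> set H"
    show False
    proof (cases N)
      case 0
      then have "H = [c 0]"
        using N0 last by (auto simp: H_def h_def)
      with a neq[OF N] 0 show False by auto
    next
      case (Suc N')
      obtain e f where "conn E e (c N') (c (Suc N))" "e + f \<le> k"
        using viaH[OF a] Suc unfolding via_def by auto
      then have "conn E k (c N') (c (Suc N))"
        by (meson add_leD1 conn_mono)
      with far[of N' "Suc N"] Suc Suc.prems show False by auto
    qed
  qed
  have fs_ne: "fs \<noteq> []"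
    using end_notin wH \<gamma>(2) \<gamma>_eq by (cases fs) auto
  define fr where "fr = rev fs"
  \<comment> \<open>A common node would lie on short walks from \<open>c a\<close> to
    \<open>c (Suc a)\<close> and from \<open>c N\<close> to \<open>c (Suc N)\<close>; by
    \<open>via_cross\<close> two non-consecutive chain points would be close.\<close>
  have fr_disj: "set fr \<inter> set zs = {}"
  proof (rule ccontr)
    assume "\<not> ?thesis"
    then obtain y where y: "y \<in> set fs" "y \<in> set zs"
      by (auto simp: fr_def)
    have "y \<in> set zs - set (map ((!) zs) (snd (cat cs)))"
      using y fs unfolding H_def h_def by blast
    then obtain a where a: "Suc a < N" "via E k (c a) y (c (Suc a))"
      using old by blast
    have "conn E k (c a) (c N) \<or> conn E k (c (Suc a)) (c (Suc N))"
      using via_cross[OF E a(2) via\<gamma>'] y \<gamma>_eq by auto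
    then show False
      using far[of a N] far[of "Suc a" "Suc N"] a(1) Suc.prems by auto
  qed
  have dist_fr: "distinct fr"
    using geodesic_distinct[OF \<gamma>(1)] \<gamma>_eq by (auto simp: fr_def)
  define cs' where "cs' = (p, length fr) # cs"
  define zs' where "zs' = zs @ fr"
  have fr_len: "length fr \<noteq> 0" "length fr \<le> k"
    using fs_ne \<gamma>(4) \<gamma>_eq by (auto simp: fr_def)
  have cat': "cat cs' = (M + length fr, rev (drop p h) @ [M..<M + length fr])"
    by (simp add: cs'_def M_def h_def)
  have oldnth: "zs' ! i = zs ! i" if "i < M" for i
    using that by (simp add: zs'_def nth_append lenM)
  have h_lt: "i < M" if "i \<in> set h" for i
    using bound that lenM by (auto simp: h_def)
  \<comment> \<open>The new segment goes from \<open>c N\<close> back along \<open>H\<close> to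
    \<open>w\<close> and then out to \<open>c (Suc N)\<close>. It is no longer than
    \<open>\<gamma>\<close>, because the part of the geodesic \<open>H\<close> from \<open>w\<close>
    to \<open>c N\<close> is shortest; hence it is a geodesic again.\<close>
  define H' where "H' = rev (drop p H) @ fr"
  have H'_eq: "map ((!) zs') (snd (cat cs')) = H'"
  proof -
    have "map ((!) zs') (rev (drop p h)) = rev (drop p H)"
      by (auto simp: H_def rev_map drop_map intro!: map_cong oldnth h_lt dest: in_set_dropD)
    then show ?thesis
      using map_nth_upt_append[OF lenM, of fr] by (simp add: cat' H'_def zs'_def)
  qed
  have H_split: "H = take p H @ w # drop (Suc p) H"
    using id_take_nth_drop[OF p(1)] p(2) by simp
  have drop_eq: "drop p H = w # drop (Suc p) H"
    using p Cons_nth_drop_Suc by fastforce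
  have fr_rev: "rev \<gamma> = rev rest @ w # fr"
    by (simp add: \<gamma>_eq fr_def)
  have flip: "(\<lambda>x y. E y x) = E"
    using E by (auto simp: symp_def fun_eq_iff)
  have H'_succ: "successively E H'"
  proof -
    have "successively E (take p H @ w # drop (Suc p) H)"
      using H_succ H_split by simp
    then have "successively E (w # drop (Suc p) H)"
      by (simp add: successively_append_iff)
    then have 1: "successively E (rev (drop p H))"
      unfolding successively_rev flip drop_eq .
    have "successively E (rev \<gamma>)"
      using \<gamma>_succ unfolding successively_rev flip .
    then have "successively E (w # fr)"
      unfolding fr_rev by (simp add: successively_append_iff)
    then show ?thesis
      using 1 drop_eq unfolding H'_def
      by (cases fr) (auto simp: successively_append_iff last_rev)
  qed
  have hd': "hd H' = c N"
  proof -
    have "last (drop p H) = last H"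
      using p by simp
    moreover have "rev (drop p H) \<noteq> []"
      using drop_eq by simp
    then have "hd H' = last (drop p H)"
      unfolding H'_def by (metis hd_append2 hd_rev)
    ultimately show ?thesis
      using last by (simp add: H_def h_def)
  qed
  have last': "last H' = c (Suc N)"
    using fs_ne \<gamma>(2) \<gamma>_eq by (simp add: H'_def fr_def last_rev)
  have len_le: "length H' \<le> length \<gamma>"
  proof -
    have "length (drop (Suc p) H) \<le> length rest"
    proof (rule geodesic_suffix_le)
      show "geodesic E (take p H @ w # drop (Suc p) H)"
        using geo H_split by (simp add: H_def h_def)
      show "successively E (w # rest)"
        using \<gamma>_succ \<gamma>_eq by (auto simp: successively_append_iff)
      have "last (take p H @ w # drop (Suc p) H) = c N"
        using H_split last by (metis H_def h_def)
      then show "last (w # rest) = last (w # drop (Suc p) H)"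
        using \<gamma>(3) \<gamma>_eq by auto
    qed
    then show ?thesis
      by (simp add: H'_def drop_eq \<gamma>_eq fr_def)
  qed
  have geo': "geodesic E H'"
    unfolding geodesic_def
  proof (intro conjI allI impI)
    show "H' \<noteq> []" using drop_eq by (simp add: H'_def)
    show "successively E H'" by fact
    fix ys
    assume ys: "ys \<noteq> []" "successively E ys" "hd ys = hd H'" "last ys = last H'"
    have "successively E (rev ys)"
      using ys(2) unfolding successively_rev flip .
    moreover have "hd (rev ys) = hd \<gamma>" "last (rev ys) = last \<gamma>"
      using ys hd' last' \<gamma> by (simp_all add: hd_rev last_rev)
    ultimately have "length \<gamma> \<le> length (rev ys)"
      using ys(1) by (intro geodesicD[OF \<gamma>(1)]) simp_all
    then show "length H' \<le> length ys"
      using len_le by simp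
  qed
  have par_E: "parent cs' q < q \<and> E (zs' ! parent cs' q) (zs' ! q)"
    if q: "0 < q" "q < fst (cat cs')" for q
  proof -
    consider "q < M" | "q = M" | "q > M" by linarith
    then show ?thesis
    proof cases
      case 1
      have *: "parent cs q < q" "E (zs ! parent cs q) (zs ! q)"
        using emb q 1 by (auto simp: embeds_def M_def)
      then show ?thesis
        using * 1 oldnth by (simp add: cs'_def M_def)
    next
      case 2
      have par: "parent cs' q = h ! p"
        using 2 by (simp add: cs'_def M_def h_def)
      have "h ! p < M"
        using h_lt p by (simp add: H_def)
      then have z: "zs' ! parent cs' q = w"
        using p par oldnth by (auto simp: H_def)
      have "zs' ! q = fr ! 0"
        using 2 by (simp add: zs'_def nth_append lenM)
      moreover have "E w (fr ! 0)"
        using H'_succ fr_len drop_eq unfolding H'_def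
        by (cases fr) (auto simp: successively_append_iff last_rev)
      ultimately show ?thesis
        using z par 2 \<open>h ! p < M\<close> by simp
    next
      case 3
      have par: "parent cs' q = q - 1"
        using 3 by (simp add: cs'_def M_def)
      define j where "j = q - 1 - M"
      have j: "q = Suc (M + j)" "Suc j < length fr"
        using 3 q by (auto simp: j_def cat')
      have "successively E fr"
        using H'_succ by (auto simp: H'_def successively_append_iff)
      then have "E (fr ! j) (fr ! Suc j)"
        using j by (auto simp: successively_conv_nth)
      moreover have "parent cs' (Suc (M + j)) = M + j"
        using par j by simp
      ultimately show ?thesis
        using j by (simp add: zs'_def nth_append lenM)
    qed
  qed
  have "embeds E cs' zs'"
    using par_E dist_zs dist_fr fr_disj unfolding embeds_def by (auto simp: zs'_def cat' lenM)
  moreover have "map ((!) zs') (ends cs') = rev (map c [0..<Suc (Suc N)])"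
  proof -
    have "zs' ! (M + length fr - 1) = c (Suc N)"
    proof -
      have "last zs' = last H'"
        using fr_len by (auto simp: zs'_def H'_def)
      then show ?thesis
        using last' fr_len by (simp add: last_conv_nth zs'_def lenM)
    qed
    moreover have "map ((!) zs') (ends cs) = map ((!) zs) (ends cs)"
      using ends_bound lenM by (auto intro: oldnth)
    ultimately show ?thesis
      using ends cat' by (simp add: cs'_def M_def)
  qed
  moreover have "set (snd (cat cs')) \<subseteq> {..<length zs'}"
    using h_lt by (auto simp: cat' zs'_def lenM dest!: in_set_dropD) fastforce
  moreover have "length (snd (cat cs')) \<le> Suc k"
    using len_le \<gamma>(4) H'_eq by (metis le_trans length_map)
  moreover have "set (ends cs') \<subseteq> {..<length zs'}"
    using ends_bound fr_len lenM by (auto simp: cs'_def zs'_def M_def)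
  moreover have "\<exists>a. Suc a < Suc N \<and> via E k (c a) z (c (Suc a))"
    if z: "z \<in> set zs' - set H'" for z
  proof -
    have zz: "z \<in> set zs" "z \<notin> set (drop p H)"
      using z by (auto simp: zs'_def H'_def)
    show ?thesis
    proof (cases "z \<in> set H")
      case True
      have "N \<noteq> 0"
      proof
        assume "N = 0"
        then have "length H = 1" using N0 by (simp add: H_def h_def)
        then show False using p zz(2) True by auto
      qed
      then show ?thesis
        using viaH[OF True] by (intro exI[of _ "N - 1"]) auto
    next
      case False
      then have "z \<in> set zs - set (map ((!) zs) (snd (cat cs)))"
        using zz(1) unfolding H_def h_def by blast
      then obtain a where "Suc a < N" "via E k (c a) z (c (Suc a))"
        using old by blast
      then show ?thesis
        by (intro exI[of _ a]) simp
    qed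
  qed
  moreover have "length cs' = Suc N" "set cs' \<subseteq> {..k} \<times> {1..k}"
    using cs fr_len p len by (auto simp: cs'_def H_def h_def Suc_le_eq)
  ultimately show ?case
    using geo' hd' last' H'_eq by (intro exI[of _ cs'] exI[of _ zs']) auto
qed

lemma caterpillar_exists:
  assumes "symp E"
    and "\<And>a. a < L \<Longrightarrow> conn E k (c a) (c (Suc a))"
    and "\<And>a. a < L \<Longrightarrow> c a \<noteq> c (Suc a)"
    and "\<And>a b. a + 2 \<le> b \<Longrightarrow> b \<le> L \<Longrightarrow> \<not> conn E k (c a) (c b)"
  shows "\<exists>cs zs. length cs = L \<and> set cs \<subseteq> {..k} \<times> {1..k} \<and> embeds E cs zs \<and>
    map ((!) zs) (ends cs) = rev (map c [0..<Suc L])"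
  apply (rule exE[OF caterpillar_exists_aux[of E L k c L]])
       apply (rule assms(1))
      apply (erule assms(2))
     apply (erule assms(3))
    apply (erule (1) assms(4))
   apply (rule order_refl)
  apply (elim exE conjE)
  apply (intro exI conjI; assumption)
  done

section \<open>Long chains are rare\<close>

lemma length_ends [simp]: "length (ends cs) = Suc (length cs)"
  by (induction cs) auto

lemma ends_less: "i \<in> set (ends cs) \<Longrightarrow> i < fst (cat cs)"
proof (induction cs)
  case (Cons c cs)
  then show ?case
    using cat_pos[of "c # cs"] by (cases c) (auto simp: trans_less_add1)
qed simp

lemma ends_sorted: "set cs \<subseteq> A \<times> {1..k} \<Longrightarrow> sorted_wrt (>) (ends cs)"
proof (induction cs)
  case (Cons c cs)
  then show ?case
    using ends_less[of _ cs] cat_pos[of cs] by (cases c) fastforce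
qed simp

lemma last_ends: "last (ends cs) = 0"
proof (induction cs)
  case (Cons c cs)
  have "ends cs \<noteq> []"
    by (cases cs) auto
  with Cons show ?case by simp
qed simp

lemma cat_lower: "set cs \<subseteq> A \<times> {1..k} \<Longrightarrow> Suc (length cs) \<le> fst (cat cs)"
  by (induction cs rule: cat.induct) auto

lemma cat_upper: "set cs \<subseteq> A \<times> {1..k} \<Longrightarrow> fst (cat cs) \<le> Suc (k * length cs)"
  by (induction cs rule: cat.induct) auto

section \<open>The bipartite graph of variables and clause positions\<close>

definition adj :: "inst \<Rightarrow> nat + nat \<Rightarrow> nat + nat \<Rightarrow> bool" where
  "adj \<Phi> a b \<longleftrightarrow> (case (a, b) of
     (Inl v, Inr j) \<Rightarrow> j < length \<Phi> \<and> v \<in> vars (\<Phi> ! j)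
   | (Inr j, Inl v) \<Rightarrow> j < length \<Phi> \<and> v \<in> vars (\<Phi> ! j)
   | _ \<Rightarrow> False)"

lemma adj_simps [simp]:
  "adj \<Phi> (Inl v) (Inr j) \<longleftrightarrow> j < length \<Phi> \<and> v \<in> vars (\<Phi> ! j)"
  "adj \<Phi> (Inr j) (Inl v) \<longleftrightarrow> j < length \<Phi> \<and> v \<in> vars (\<Phi> ! j)"
  "\<not> adj \<Phi> (Inl v) (Inl w)" "\<not> adj \<Phi> (Inr i) (Inr j)"
  by (auto simp: adj_def)

lemma symp_adj: "symp (adj \<Phi>)"
  unfolding symp_def by (auto simp: adj_def split: sum.splits)

text \<open>Walks alternate between variables and clauses, so radius \<open>R\<close> corresponds to
  length \<open>2 * R\<close>.\<close>

lemma conn_adj_imp_nbr: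
  assumes "conn (adj \<Phi>) (2 * R) (Inl x) (Inl y)"
  shows "y \<in> nbr (set \<Phi>) R x"
proof -
  \<comment> \<open>The induction must also cover walks that stop at a clause; then some variable of
    that clause lies in the ball reached so far.\<close>
  have *: "\<exists>t. case last xs of
      Inl y \<Rightarrow> 2 * t + 1 \<le> length xs \<and> y \<in> nbr (set \<Phi>) t x
    | Inr j \<Rightarrow> 2 * t + 2 \<le> length xs \<and> j < length \<Phi> \<and> (\<exists>z\<in>vars (\<Phi> ! j). z \<in> nbr (set \<Phi>) t x)"
    if "successively (adj \<Phi>) xs" "xs \<noteq> []" "hd xs = Inl x" for xs
    using that
  proof (induction xs rule: rev_induct)
    case (snoc b xs)
    show ?case
    proof (cases "xs = []")
      case True
      then show ?thesis using snoc.prems by (auto intro!: exI[of _ 0])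
    next
      case False
      then obtain t where t: "case last xs of
          Inl y \<Rightarrow> 2 * t + 1 \<le> length xs \<and> y \<in> nbr (set \<Phi>) t x
        | Inr j \<Rightarrow> 2 * t + 2 \<le> length xs \<and> j < length \<Phi> \<and> (\<exists>z\<in>vars (\<Phi> ! j). z \<in> nbr (set \<Phi>) t x)"
        using snoc by (auto simp: successively_append_iff)
      have ab: "adj \<Phi> (last xs) b"
        using snoc.prems False by (auto simp: successively_append_iff)
      show ?thesis
      proof (cases "last xs")
        case (Inl y)
        then obtain j where "b = Inr j" using ab by (cases b) auto
        then show ?thesis
          using t ab Inl by (intro exI[of _ t]) auto
      next
        case (Inr j)
        then obtain y where b: "b = Inl y" using ab by (cases b) auto
        have "y \<in> nbr (set \<Phi>) (Suc t) x"
          using t ab Inr b unfolding nbr_Suc_iff by (auto intro!: bexI[of _ "\<Phi> ! j"])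
        then show ?thesis
          using t Inr b by (intro exI[of _ "Suc t"]) auto
      qed
    qed
  qed simp
  obtain xs where xs: "xs \<noteq> []" "successively (adj \<Phi>) xs" "hd xs = Inl x" "last xs = Inl y"
    "length xs \<le> Suc (2 * R)"
    using assms unfolding conn_def by blast
  from *[OF xs(2,1,3)] xs obtain t where "2 * t + 1 \<le> length xs" "y \<in> nbr (set \<Phi>) t x"
    by auto
  then show ?thesis
    using nbr_mono[of t R] xs(5) by auto
qed

lemma nbr_imp_conn_adj: "y \<in> nbr (set \<Phi>) R x \<Longrightarrow> conn (adj \<Phi>) (2 * R) (Inl x) (Inl y)"
proof (induction R arbitrary: y)
  case 0
  then show ?case by (simp add: conn_refl)
next
  case (Suc R)
  show ?case
  proof (cases "y \<in> nbr (set \<Phi>) R x")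
    case True
    from conn_mono[OF Suc.IH[OF this]] show ?thesis by simp
  next
    case False
    then obtain C z where C: "C \<in> set \<Phi>" "y \<in> vars C" "z \<in> vars C" "z \<in> nbr (set \<Phi>) R x"
      using Suc.prems unfolding nbr_Suc_iff by blast
    then obtain j where "j < length \<Phi>" "\<Phi> ! j = C"
      by (metis in_set_conv_nth)
    with C have "conn (adj \<Phi>) 1 (Inl z) (Inr j)" "conn (adj \<Phi>) 1 (Inr j) (Inl y)"
      by (intro conn_step, simp)+
    from conn_trans[OF Suc.IH[OF C(4)] conn_trans[OF this]] show ?thesis
      by simp
  qed
qed

section \<open>Counting the placements of coded caterpillars\<close>

definition spots :: "nat \<Rightarrow> nat \<Rightarrow> (nat \<times> nat) list \<Rightarrow> (nat + nat) list set" where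
  "spots n m cs = {zs. length zs = fst (cat cs) \<and> set zs \<subseteq> Inl ` {..<n} \<union> Inr ` {..<m} \<and>
    (\<exists>js. map ((!) zs) (ends cs) = map Inl js \<and> sorted_wrt (<) js)}"

definition codes :: "nat \<Rightarrow> nat \<Rightarrow> (nat \<times> nat) list set" where
  "codes k L = {cs. set cs \<subseteq> {..k} \<times> {1..k} \<and> length cs = L}"

lemma chain_embeds:
  assumes "chain \<Phi> R L i" "i < n" "\<And>C. C \<in> set \<Phi> \<Longrightarrow> vars C \<subseteq> {..<n}"
  obtains cs zs where "cs \<in> codes (2 * R) L" "zs \<in> spots n (length \<Phi>) cs"
    "embeds (adj \<Phi>) cs zs" "zs ! 0 = Inl i"
proof -
  obtain c where c: "c 0 = i" "\<And>a. a < L \<Longrightarrow> desc \<Phi> R (c a) (c (Suc a))"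
    "\<And>a b. a + 2 \<le> b \<Longrightarrow> b \<le> L \<Longrightarrow> c b \<notin> nbr (set \<Phi>) R (c a)"
    using assms(1) unfolding chain_def by blast
  have "\<exists>cs zs. length cs = L \<and> set cs \<subseteq> {..2 * R} \<times> {1..2 * R} \<and> embeds (adj \<Phi>) cs zs \<and>
    map ((!) zs) (ends cs) = rev (map (Inl \<circ> c) [0..<Suc L])"
  proof -
    have step: "conn (adj \<Phi>) (2 * R) ((Inl \<circ> c) a) ((Inl \<circ> c) (Suc a))" if "a < L" for a
      using nbr_imp_conn_adj c(2)[OF that] by (simp add: desc_def)
    have neq: "(Inl \<circ> c) a \<noteq> (Inl \<circ> c) (Suc a)" if "a < L" for a
      using c(2)[OF that] by (auto simp: desc_def)
    have far: "\<not> conn (adj \<Phi>) (2 * R) ((Inl \<circ> c) a) ((Inl \<circ> c) b)" if "a + 2 \<le> b" "b \<le> L" for a b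
      using conn_adj_imp_nbr c(3)[OF that] by auto
    show ?thesis
      using caterpillar_exists[of "adj \<Phi>" L "2 * R" "Inl \<circ> c"] symp_adj step neq far by blast
  qed
  then obtain cs zs where cs: "length cs = L" "set cs \<subseteq> {..2 * R} \<times> {1..2 * R}"
    and emb: "embeds (adj \<Phi>) cs zs" and ends: "map ((!) zs) (ends cs) = rev (map (Inl \<circ> c) [0..<Suc L])"
    by blast
  have "last (map ((!) zs) (ends cs)) = zs ! last (ends cs)"
    by (rule last_map) (metis length_ends length_0_conv nat.simps(3))
  moreover have "last (rev (map (Inl \<circ> c) [0..<Suc L])) = Inl (c 0)"
    by (simp add: last_rev hd_map hd_upt del: upt_Suc)
  ultimately have z0: "zs ! 0 = Inl i"
    unfolding ends last_ends c(1) by metis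
  have "set zs \<subseteq> Inl ` {..<n} \<union> Inr ` {..<length \<Phi>}"
  proof
    fix z assume "z \<in> set zs"
    then obtain q where q: "q < fst (cat cs)" "z = zs ! q"
      using emb by (auto simp: embeds_def in_set_conv_nth)
    show "z \<in> Inl ` {..<n} \<union> Inr ` {..<length \<Phi>}"
    proof (cases "q = 0")
      case False
      then have e: "adj \<Phi> (zs ! parent cs q) z"
        using emb q by (auto simp: embeds_def)
      show ?thesis
      proof (cases z)
        case (Inl v)
        then obtain j where "j < length \<Phi>" "v \<in> vars (\<Phi> ! j)"
          using e by (cases "zs ! parent cs q") auto
        then show ?thesis
          using assms(3)[of "\<Phi> ! j"] Inl by auto
      qed (use e in \<open>cases "zs ! parent cs q", auto\<close>)
    qed (use z0 assms(2) q in auto)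
  qed
  moreover have "sorted_wrt (<) (rev (map c [0..<Suc L]))"
  proof -
    have "c b < c a" if "a < b" "b \<le> L" for a b
      using desc_sequence_less[of L \<Phi> R c a b] c(2) that by blast
    then show ?thesis
      by (auto simp: sorted_wrt_iff_nth_less rev_nth simp del: upt_Suc)
  qed
  ultimately have "zs \<in> spots n (length \<Phi>) cs"
    using emb ends unfolding spots_def embeds_def
    by (auto simp: rev_map simp del: upt_Suc intro!: exI[of _ "rev (map c [0..<Suc L])"])
  then show ?thesis
    using that cs emb z0 by (auto simp: codes_def)
qed

text \<open>Chains decrease and \<open>ends\<close> lists the latest point first, so the chain
  points appear in increasing order and are determined by their set. This leaves
  \<open>n choose Suc L\<close> possibilities instead of \<open>n ^ Suc L\<close>, which is the
  source of the factorial. Every other node is one of \<open>n + m\<close> variables or clause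
  positions.\<close>

lemma card_spots:
  assumes "cs \<in> codes k L"
  shows "finite (spots n m cs)"
    and "card (spots n m cs) * fact (Suc L) \<le> n ^ Suc L * (n + m) ^ (fst (cat cs) - Suc L)"
proof -
  let ?M = "fst (cat cs)"
  let ?U = "Inl ` {..<n} \<union> Inr ` {..<m} :: (nat + nat) set"
  let ?I = "set (ends cs)"
  let ?J = "{..<?M} - ?I"
  have cs: "set cs \<subseteq> {..k} \<times> {1..k}" "length cs = L"
    using assms by (auto simp: codes_def)
  have cardU: "card ?U = n + m"
    by (subst card_Un_disjoint) (auto simp: card_image)
  have "sorted_wrt (>) (ends cs)"
    by (rule ends_sorted[OF cs(1)])
  then have "distinct (ends cs)"
    by (auto simp: sorted_wrt_iff_nth_less distinct_conv_nth) (metis less_irrefl linorder_cases)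
  then have cardI: "card ?I = Suc L"
    using cs(2) by (simp add: distinct_card)
  have cardJ: "card ?J = ?M - Suc L"
    using cardI ends_less[of _ cs] by (subst card_Diff_subset) auto
  define f where "f = (\<lambda>zs :: (nat + nat) list. ({v. Inl v \<in> (!) zs ` ?I}, restrict ((!) zs) ?J))"
  let ?T = "{A. A \<subseteq> {..<n} \<and> card A = Suc L} \<times> (?J \<rightarrow>\<^sub>E ?U)"
  have js: "set js = {v. Inl v \<in> (!) zs ` ?I}" if "map ((!) zs) (ends cs) = map Inl js" for zs js
  proof -
    have "(!) zs ` ?I = Inl ` set js"
      using that by (metis set_map)
    then show ?thesis by auto
  qed
  have inj: "inj_on f (spots n m cs)"
  proof (rule inj_onI)
    fix zs zs'
    assume z: "zs \<in> spots n m cs" "zs' \<in> spots n m cs" "f zs = f zs'"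
    obtain js where js1: "map ((!) zs) (ends cs) = map Inl js" "sorted_wrt (<) js"
      using z(1) unfolding spots_def by blast
    obtain js' where js2: "map ((!) zs') (ends cs) = map Inl js'" "sorted_wrt (<) js'"
      using z(2) unfolding spots_def by blast
    have "set js = set js'"
      using js[OF js1(1)] js[OF js2(1)] z(3) by (simp add: f_def)
    then have "js = js'"
      using js1(2) js2(2) by (simp add: strict_sorted_equal)
    then have "map ((!) zs) (ends cs) = map ((!) zs') (ends cs)"
      using js1 js2 by simp
    then have I: "zs ! q = zs' ! q" if "q \<in> ?I" for q
      using that by simp
    have J: "zs ! q = zs' ! q" if "q \<in> ?J" for q
    proof -
      have "restrict ((!) zs) ?J q = restrict ((!) zs') ?J q"
        using z(3) by (simp add: f_def)
      then show ?thesis using that by simp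
    qed
    show "zs = zs'"
    proof (rule nth_equalityI)
      show "length zs = length zs'"
        using z by (simp add: spots_def)
      fix q assume "q < length zs"
      then have "q < ?M" using z by (simp add: spots_def)
      then show "zs ! q = zs' ! q"
        using I J by blast
    qed
  qed
  have sub: "f ` spots n m cs \<subseteq> ?T"
  proof
    fix t assume "t \<in> f ` spots n m cs"
    then obtain zs where zs: "zs \<in> spots n m cs" "t = f zs"
      by blast
    obtain js' where js1: "map ((!) zs) (ends cs) = map Inl js'" "sorted_wrt (<) js'"
      using zs unfolding spots_def by blast
    have len: "length js' = Suc L"
      using js1(1) cs(2) by (metis length_ends length_map)
    have "distinct js'"
      using js1(2) by (simp add: strict_sorted_iff)
    then have "card {v. Inl v \<in> (!) zs ` ?I} = Suc L"
      using js[OF js1(1)] len distinct_card by metis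
    moreover have mem: "zs ! q \<in> ?U" if "q < ?M" for q
    proof -
      have len: "length zs = ?M" and sub: "set zs \<subseteq> ?U"
        using zs(1) unfolding spots_def by blast+
      have "zs ! q \<in> set zs"
        using that len by simp
      with sub show ?thesis by blast
    qed
    have "{v. Inl v \<in> (!) zs ` ?I} \<subseteq> {..<n}"
    proof
      fix v assume "v \<in> {v. Inl v \<in> (!) zs ` ?I}"
      then obtain q where "q \<in> ?I" "Inl v = zs ! q" by auto
      then show "v \<in> {..<n}"
        using mem[of q] ends_less[of q cs] by auto
    qed
    moreover have "restrict ((!) zs) ?J \<in> ?J \<rightarrow>\<^sub>E ?U"
      using mem by (auto simp del: Un_iff)
    ultimately show "t \<in> ?T"
      using zs(2) by (simp add: f_def)
  qed
  have finT: "finite ?T"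
    by (intro finite_cartesian_product finite_PiE) auto
  show "finite (spots n m cs)"
    using finite_imageD[OF finite_subset[OF sub finT] inj] .
  have "card (spots n m cs) \<le> card ?T"
    using card_inj_on_le[OF inj sub finT] .
  also have "\<dots> = (n choose Suc L) * (n + m) ^ (?M - Suc L)"
    by (simp add: card_cartesian_product n_subsets card_PiE cardU cardJ)
  finally have "card (spots n m cs) * fact (Suc L) \<le> (n choose Suc L) * (n + m) ^ (?M - Suc L) * fact (Suc L)"
    by (rule mult_le_mono1)
  also have "\<dots> = (n choose Suc L) * fact (Suc L) * (n + m) ^ (?M - Suc L)"
    by (simp only: ac_simps)
  also have "(n choose Suc L) * fact (Suc L) \<le> n ^ Suc L"
    by (rule binomial_fact_pow)
  finally show "card (spots n m cs) * fact (Suc L) \<le> n ^ Suc L * (n + m) ^ (?M - Suc L)"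
    by (simp only: mult_le_mono1)
qed

section \<open>Probabilities of prescribed incidences\<close>

lemma binomial_ratio_le:
  assumes "s \<le> K" "K \<le> n" "0 < n"
  shows "real ((n - s) choose (K - s)) \<le> real (n choose K) * (real K / real n) ^ s"
  using assms(1)
proof (induction s)
  case (Suc s)
  then have s: "s < K" "s < n" using assms by auto
  have "(K - s) * ((n - s) choose (K - s)) = (n - s) * ((n - Suc s) choose (K - Suc s))"
    using times_binomial_minus1_eq[of "K - s" "n - s"] s by simp
  then have "real (K - s) * real ((n - s) choose (K - s)) = real (n - s) * real ((n - Suc s) choose (K - Suc s))"
    by (metis of_nat_mult)
  then have "real ((n - Suc s) choose (K - Suc s)) = real ((n - s) choose (K - s)) * (real (K - s) / real (n - s))"
    using s by (simp add: field_simps)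
  also have "\<dots> \<le> (real (n choose K) * (real K / real n) ^ s) * (real K / real n)"
  proof (intro mult_mono)
    have "real K * real s \<le> real n * real s"
      using assms by (intro mult_right_mono) auto
    then show "real (K - s) / real (n - s) \<le> real K / real n"
      using s assms by (simp add: field_simps of_nat_diff)
  qed (use Suc in auto)
  finally show ?case
    by (simp add: mult_ac)
qed simp

definition kset :: "nat \<Rightarrow> nat \<Rightarrow> nat set set" where
  "kset K n = {V. V \<subseteq> {..<n} \<and> card V = K}"

lemma kset_ne: "K \<le> n \<Longrightarrow> kset K n \<noteq> {}" "finite (kset K n)" "card (kset K n) = n choose K"
proof -
  have "kset K n \<subseteq> Pow {..<n}" unfolding kset_def by auto
  then show "finite (kset K n)" by (rule finite_subset) simp
  show "card (kset K n) = n choose K"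
    unfolding kset_def using n_subsets[of "{..<n}" K] by simp
  then show "K \<le> n \<Longrightarrow> kset K n \<noteq> {}"
    by (metis binomial_eq_0_iff card.empty not_le)
qed

text \<open>The formula model draws elements of type \<open>fset\<close>; counting is done with
  ordinary sets, and this bijection transfers between the two.\<close>

lemma vset_fsets:
  fixes K n :: nat
  defines "F \<equiv> {V :: nat fset. fset V \<subseteq> {..<n} \<and> fcard V = K}"
  shows "fset ` F = kset K n" "inj_on fset F" "finite F"
proof -
  show inj: "inj_on fset F"
    by (auto simp: inj_on_def fset_inject)
  show im: "fset ` F = kset K n"
  proof
    show "fset ` F \<subseteq> kset K n"
      by (auto simp: F_def kset_def fcard.rep_eq)
    show "kset K n \<subseteq> fset ` F"
    proof
      fix V assume V: "V \<in> kset K n"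
      then have "finite V" unfolding kset_def using finite_subset[of V "{..<n}"] by auto
      then have "V = fset (Abs_fset V)"
        by (simp add: Abs_fset_inverse)
      moreover have "Abs_fset V \<in> F"
        using V \<open>finite V\<close> by (auto simp: F_def kset_def fcard.rep_eq Abs_fset_inverse)
      ultimately show "V \<in> fset ` F" by blast
    qed
  qed
  show "finite F"
    using inj im kset_ne(2) finite_imageD by metis
qed

lemma map_pmf_vars_clause:
  assumes "K \<le> n"
  shows "map_pmf vars (clause_pmf K n) = pmf_of_set (kset K n)"
proof -
  let ?F = "{V :: nat fset. fset V \<subseteq> {..<n} \<and> fcard V = K}"
  have ne: "?F \<noteq> {}"
    using vset_fsets(1)[of n K] kset_ne(1)[OF assms] by blast
  have "map_pmf vars (clause_pmf K n) = map_pmf fset (pmf_of_set ?F)"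
    unfolding clause_pmf_def map_bind_pmf map_pmf_def bind_assoc_pmf bind_return_pmf
    by (simp add: vars_def image_image bind_return_pmf)
  also have "\<dots> = pmf_of_set (fset ` ?F)"
    using vset_fsets(2,3) ne by (intro map_pmf_of_set_inj)
  finally show ?thesis
    unfolding vset_fsets(1) .
qed

lemma finite_set_clause_pmf:
  assumes "K \<le> n"
  shows "finite (set_pmf (clause_pmf K n))"
proof -
  let ?F = "{V :: nat fset. fset V \<subseteq> {..<n} \<and> fcard V = K}"
  have "?F \<noteq> {}"
    using vset_fsets(1)[of n K] kset_ne(1)[OF assms] by blast
  then have "finite (set_pmf (pmf_of_set ?F))"
    using vset_fsets(3)[of n K] by (simp add: set_pmf_of_set)
  moreover have "finite (set_pmf (Pi_pmf (fset V) False (\<lambda>_. bernoulli_pmf (1 / 2))))" for V :: "nat fset"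
    by (rule finite_subset[OF set_Pi_pmf_subset']) (auto intro!: finite_PiE_dflt)
  ultimately show ?thesis
    unfolding clause_pmf_def by (auto intro!: finite_UN_I)
qed

lemma vars_clause_pmf:
  assumes "K \<le> n" "C \<in> set_pmf (clause_pmf K n)"
  shows "vars C \<subseteq> {..<n}" "card (vars C) = K" "finite (vars C)"
proof -
  have "vars C \<in> set_pmf (map_pmf vars (clause_pmf K n))"
    using assms(2) by simp
  then have "vars C \<in> kset K n"
    unfolding map_pmf_vars_clause[OF assms(1)] using kset_ne[of K n] assms(1) by (simp add: set_pmf_of_set)
  then show "vars C \<subseteq> {..<n}" "card (vars C) = K"
    by (auto simp: kset_def)
  then show "finite (vars C)"
    using finite_subset by blast
qed

lemma prob_clause_vars:
  assumes "K \<le> n" "0 < n" "finite S"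
  shows "Pr (clause_pmf K n) {C. S \<subseteq> vars C} \<le> (real K / real n) ^ card S"
proof -
  have "Pr (clause_pmf K n) {C. S \<subseteq> vars C} =
      Pr (map_pmf vars (clause_pmf K n)) {V. S \<subseteq> V}"
    by (simp add: vimage_def)
  also have "\<dots> = real (card (kset K n \<inter> {V. S \<subseteq> V})) / real (n choose K)"
    unfolding map_pmf_vars_clause[OF assms(1)]
    using kset_ne[of K n] assms(1) by (simp add: measure_pmf_of_set)
  also have "\<dots> \<le> (real K / real n) ^ card S"
  proof (cases "S \<subseteq> {..<n} \<and> card S \<le> K")
    case True
    let ?T = "{W. W \<subseteq> {..<n} - S \<and> card W = K - card S}"
    have "card (kset K n \<inter> {V. S \<subseteq> V}) \<le> card ?T"
    proof (rule card_inj_on_le[where f = "\<lambda>V. V - S"])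
      show "inj_on (\<lambda>V. V - S) (kset K n \<inter> {V. S \<subseteq> V})"
        by (auto simp: inj_on_def)
      show "(\<lambda>V. V - S) ` (kset K n \<inter> {V. S \<subseteq> V}) \<subseteq> ?T"
        using assms(3) by (auto simp: kset_def card_Diff_subset)
      show "finite ?T"
        by (rule finite_subset[of _ "Pow {..<n}"]) auto
    qed
    also have "card ?T = (n - card S) choose (K - card S)"
      using True assms(3) n_subsets[of "{..<n} - S" "K - card S"] by (simp add: card_Diff_subset)
    finally have "real (card (kset K n \<inter> {V. S \<subseteq> V})) \<le> real (n choose K) * (real K / real n) ^ card S"
      using binomial_ratio_le[of "card S" K n] True assms by (meson le_trans of_nat_mono order_trans)
    moreover have "0 < real (n choose K)"
      using assms(1) by simp
    ultimately show ?thesis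
      by (simp add: field_simps)
  next
    case False
    have "kset K n \<inter> {V. S \<subseteq> V} = {}"
    proof (rule ccontr)
      assume "\<not> ?thesis"
      then obtain V where V: "V \<subseteq> {..<n}" "card V = K" "S \<subseteq> V"
        by (auto simp: kset_def)
      then have "finite V" by (meson finite_lessThan finite_subset)
      with V False card_mono[of V S] show False by auto
    qed
    then show ?thesis by simp
  qed
  finally show ?thesis .
qed

abbreviation fam :: "nat \<Rightarrow> nat \<Rightarrow> nat set \<Rightarrow> (nat \<Rightarrow> clause) pmf" where
  "fam K n A \<equiv> Pi_pmf A undefined (\<lambda>_. clause_pmf K n)"

text \<open>Group the incidences by clause: distinct clauses are independent, and
  \<open>prob_clause_vars\<close> gives one factor \<open>K / n\<close> for each variable prescribed
  in a clause.\<close>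

lemma prob_edges:
  assumes "K \<le> n" "0 < n" "finite Ed" "Ed \<subseteq> UNIV \<times> {..<m}"
  shows "Pr (fam K n {..<m}) {ys. \<forall>(v, j)\<in>Ed. v \<in> vars (ys j)} \<le> (real K / real n) ^ card Ed"
proof -
  define S where "S j = {v. (v, j) \<in> Ed}" for j
  have finS: "finite (S j)" for j
    by (rule finite_subset[of _ "fst ` Ed"]) (force simp: S_def assms(3))+
  have Ed: "Ed = (\<Union>j<m. (\<lambda>v. (v, j)) ` S j)"
    using assms(4) by (auto simp: S_def)
  have "{ys. \<forall>(v, j)\<in>Ed. v \<in> vars (ys j)} = Pi {..<m} (\<lambda>j. {C. S j \<subseteq> vars C})"
    using assms(4) by (fastforce simp: S_def Pi_def)
  then have "Pr (fam K n {..<m}) {ys. \<forall>(v, j)\<in>Ed. v \<in> vars (ys j)} =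
      (\<Prod>j<m. Pr (clause_pmf K n) {C. S j \<subseteq> vars C})"
    by (simp add: measure_Pi_pmf_Pi)
  also have "\<dots> \<le> (\<Prod>j<m. (real K / real n) ^ card (S j))"
    using assms finS by (intro prod_mono) (auto intro: prob_clause_vars)
  also have "\<dots> = (real K / real n) ^ (\<Sum>j<m. card (S j))"
    by (simp add: power_sum)
  also have "(\<Sum>j<m. card (S j)) = card Ed"
    using finS by (subst Ed, subst card_UN_disjoint) (auto simp: card_image inj_on_def)
  finally show ?thesis .
qed

text \<open>Orders an edge as variable and clause position. The default \<open>(0, 0)\<close> does
  not arise for adjacent nodes.\<close>

definition edge :: "nat + nat \<Rightarrow> nat + nat \<Rightarrow> nat \<times> nat" where
  "edge a b = (case (a, b) of (Inl v, Inr j) \<Rightarrow> (v, j) | (Inr j, Inl v) \<Rightarrow> (v, j) | _ \<Rightarrow> (0, 0))"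

lemma prob_embeds:
  assumes "K \<le> n" "0 < n"
  shows "Pr (fam K n {..<m}) {ys. embeds (adj (map ys [0..<m])) cs zs}
    \<le> (real K / real n) ^ (fst (cat cs) - 1)"
proof (cases "\<exists>ys. embeds (adj (map ys [0..<m])) cs zs")
  case False
  then show ?thesis by simp
next
  case True
  \<comment> \<open>Distinctness of the nodes and the alternation of variables and clauses along
    edges do not depend on \<open>ys\<close>, so one witness establishes them.\<close>
  then obtain ys0 where ys0: "embeds (adj (map ys0 [0..<m])) cs zs" by blast
  let ?M = "fst (cat cs)"
  let ?e = "\<lambda>q. edge (zs ! parent cs q) (zs ! q)"
  define Ed where "Ed = ?e ` {1..<?M}"
  have par: "parent cs q < q" and a0: "adj (map ys0 [0..<m]) (zs ! parent cs q) (zs ! q)"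
    if "q \<in> {1..<?M}" for q
    using ys0 that by (auto simp: embeds_def)
  have dist: "distinct zs" "length zs = ?M"
    using ys0 by (auto simp: embeds_def)
  have ne: "{zs ! parent cs q, zs ! q} = {Inl (fst (?e q)), Inr (snd (?e q))} \<and> snd (?e q) < m"
    if "q \<in> {1..<?M}" for q
    using a0[OF that] by (cases "zs ! parent cs q"; cases "zs ! q") (auto simp: edge_def)
  have "inj_on ?e {1..<?M}"
  proof (rule inj_onI)
    fix p q assume pq: "p \<in> {1..<?M}" "q \<in> {1..<?M}" "?e p = ?e q"
    then have "{zs ! parent cs p, zs ! p} = {zs ! parent cs q, zs ! q}"
      using ne by metis
    moreover have "parent cs p < ?M" "parent cs q < ?M"
      using par[OF pq(1)] par[OF pq(2)] pq by auto
    ultimately have "{parent cs p, p} = {parent cs q, q}"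
      using dist pq nth_eq_iff_index_eq[OF dist(1)] by (auto simp: doubleton_eq_iff)
    then show "p = q"
      using par[OF pq(1)] par[OF pq(2)] by (auto simp: doubleton_eq_iff)
  qed
  then have card: "card Ed = ?M - 1"
    by (simp add: Ed_def card_image)
  have "Pr (fam K n {..<m}) {ys. embeds (adj (map ys [0..<m])) cs zs}
      \<le> Pr (fam K n {..<m}) {ys. \<forall>(v, j)\<in>Ed. v \<in> vars (ys j)}"
  proof (intro measure_pmf.finite_measure_mono subsetI)
    fix ys assume "ys \<in> {ys. embeds (adj (map ys [0..<m])) cs zs}"
    then have "adj (map ys [0..<m]) (zs ! parent cs q) (zs ! q)" if "q \<in> {1..<?M}" for q
      using that by (auto simp: embeds_def)
    then have "fst (?e q) \<in> vars (ys (snd (?e q)))" if "q \<in> {1..<?M}" for q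
      using that by (cases "zs ! parent cs q"; cases "zs ! q") (fastforce simp: edge_def)+
    then show "ys \<in> {ys. \<forall>(v, j)\<in>Ed. v \<in> vars (ys j)}"
      unfolding Ed_def by (auto simp: case_prod_unfold)
  qed simp
  also have "\<dots> \<le> (real K / real n) ^ card Ed"
  proof (rule prob_edges[OF assms])
    show "finite Ed" by (simp add: Ed_def)
    show "Ed \<subseteq> UNIV \<times> {..<m}"
    proof
      fix e assume "e \<in> Ed"
      then obtain q where "q \<in> {1..<?M}" "e = ?e q" by (auto simp: Ed_def)
      with ne[of q] show "e \<in> UNIV \<times> {..<m}" by (simp add: mem_Times_iff)
    qed
  qed
  finally show ?thesis
    by (simp add: card)
qed

lemma vars_fam:
  assumes "K \<le> n" "ys \<in> set_pmf (fam K n A)" "finite A" "j \<in> A"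
  shows "vars (ys j) \<subseteq> {..<n}" "card (vars (ys j)) = K" "finite (vars (ys j))"
proof -
  have "ys j \<in> set_pmf (clause_pmf K n)"
    using assms by (auto simp: set_Pi_pmf PiE_dflt_def)
  from vars_clause_pmf[OF assms(1) this] show "vars (ys j) \<subseteq> {..<n}" "card (vars (ys j)) = K" "finite (vars (ys j))"
    by auto
qed

text \<open>Per chain step, \<open>Suc (2 * R) * (2 * R)\<close> bounds the number of pairs
  available for a code, and at most \<open>2 * R\<close> new nodes contribute at most
  \<open>D * K\<close> each. The factorial comes from \<open>card_spots\<close> and makes the rate
  vanish as \<open>L\<close> grows.\<close>

definition chain_rate :: "real \<Rightarrow> nat \<Rightarrow> nat \<Rightarrow> nat \<Rightarrow> real" where
  "chain_rate D K R L = (real (Suc (2 * R) * (2 * R)) * (D * real K) ^ (2 * R)) ^ L / fact (Suc L)"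

lemma expected_chains:
  assumes n: "1 \<le> K" "K \<le> n" and D: "real (n + m) \<le> D * real n" "1 \<le> D"
  shows "(\<Sum>i<n. Pr (fam K n {..<m}) {ys. chain (map ys [0..<m]) R L i})
    \<le> real n * (chain_rate D K R L)"
proof -
  let ?P = "Pr (fam K n {..<m})"
  let ?k = "2 * R"
  let ?Z = "\<lambda>cs i. {zs \<in> spots n m cs. zs ! 0 = Inl i}"
  let ?\<Phi> = "\<lambda>ys. map ys [0..<m]"
  let ?emb = "\<lambda>cs zs. {ys. embeds (adj (?\<Phi> ys)) cs zs}"
  let ?q = "\<lambda>cs. (real K / real n) ^ (fst (cat cs) - 1)"
  have "0 < n" using n by simp
  have codes_eq: "codes ?k L = {cs. set cs \<subseteq> {..?k} \<times> {1..?k} \<and> length cs = L}"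
    by (simp add: codes_def)
  have fin_codes: "finite (codes ?k L)"
    unfolding codes_eq by (rule finite_lists_length_eq) simp
  have card_codes: "card (codes ?k L) = (Suc ?k * ?k) ^ L"
    unfolding codes_eq by (subst card_lists_length_eq) (auto simp: card_cartesian_product)
  have fin_spots: "finite (spots n m cs)" if "cs \<in> codes ?k L" for cs
    using card_spots(1)[OF that] .
  have le: "?P {ys. chain (?\<Phi> ys) R L i} \<le>
      (\<Sum>cs\<in>codes ?k L. \<Sum>zs\<in>(?Z cs i). ?q cs)" if i: "i < n" for i
  proof -
    let ?X = "(SIGMA cs:codes ?k L. (?Z cs i))"
    have fin: "finite ?X"
      using fin_codes fin_spots by (intro finite_SigmaI) auto
    have "?P {ys. chain (?\<Phi> ys) R L i} = ?P ({ys. chain (?\<Phi> ys) R L i} \<inter> set_pmf (fam K n {..<m}))"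
      by (simp add: measure_Int_set_pmf)
    also have "\<dots> \<le> ?P (\<Union>(cs, zs)\<in>?X. ?emb cs zs)"
    proof (intro measure_pmf.finite_measure_mono subsetI)
      fix ys assume ys: "ys \<in> {ys. chain (?\<Phi> ys) R L i} \<inter> set_pmf (fam K n {..<m})"
      then have "vars C \<subseteq> {..<n}" if "C \<in> set (?\<Phi> ys)" for C
        using that vars_fam(1)[OF n(2), of ys "{..<m}"] ys by fastforce
      then obtain cs zs where "cs \<in> codes ?k L" "zs \<in> spots n (length (?\<Phi> ys)) cs"
          "embeds (adj (?\<Phi> ys)) cs zs" "zs ! 0 = Inl i"
        using chain_embeds[of "?\<Phi> ys" R L i n] ys i by blast
      then show "ys \<in> (\<Union>(cs, zs)\<in>?X. ?emb cs zs)"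
        by auto
    qed simp
    also have "\<dots> \<le> (\<Sum>(cs, zs)\<in>?X. ?P (?emb cs zs))"
      using measure_pmf.finite_measure_subadditive_finite[OF fin, of "\<lambda>(cs, zs). ?emb cs zs"]
      by (simp add: case_prod_unfold)
    also have "\<dots> \<le> (\<Sum>(cs, zs)\<in>?X. ?q cs)"
      using prob_embeds[OF n(2) \<open>0 < n\<close>] by (intro sum_mono) auto
    also have "\<dots> = (\<Sum>cs\<in>codes ?k L. \<Sum>zs\<in>(?Z cs i). ?q cs)"
      using fin_codes fin_spots by (subst sum.Sigma) auto
    finally show ?thesis .
  qed
  have per_code: "(\<Sum>i<n. \<Sum>zs\<in>(?Z cs i). ?q cs) \<le>
      real n * ((D * real K) ^ (?k * L) / fact (Suc L))" if cs: "cs \<in> codes ?k L" for cs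
  proof -
    let ?M = "fst (cat cs)"
    have csM: "set cs \<subseteq> {..?k} \<times> {1..?k}" "length cs = L"
      using cs by (auto simp: codes_def)
    have M: "Suc L \<le> ?M" "?M - 1 \<le> ?k * L"
      using cat_lower[OF csM(1)] cat_upper[OF csM(1)] csM(2) by auto
    have "(\<Sum>i<n. \<Sum>zs\<in>(?Z cs i). ?q cs) =
        (\<Sum>i<n. real (card (?Z cs i))) * ?q cs"
      by (simp add: sum_distrib_right)
    \<comment> \<open>Placements with different starting variables are disjoint, so summing over
      \<open>i\<close> counts each element of \<open>spots\<close> at most once; the start is
      already among the ordered chain points.\<close>
    also have "(\<Sum>i<n. real (card (?Z cs i))) =
        real (card (\<Union>i<n. (?Z cs i)))"
      using fin_spots[OF cs] by (subst card_UN_disjoint) auto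
    also have "\<dots> \<le> real (card (spots n m cs))"
      using fin_spots[OF cs] by (intro of_nat_mono card_mono) auto
    also have "\<dots> \<le> real (n ^ Suc L * (n + m) ^ (?M - Suc L)) / fact (Suc L)"
    proof -
      have "real (card (spots n m cs)) * fact (Suc L) \<le> real (n ^ Suc L * (n + m) ^ (?M - Suc L))"
        using card_spots(2)[OF cs, of n m] by (metis of_nat_fact of_nat_le_iff of_nat_mult)
      then show ?thesis
        by (subst pos_le_divide_eq[OF fact_gt_zero])
    qed
    also have "\<dots> \<le> real n ^ Suc L * (D * real n) ^ (?M - Suc L) / fact (Suc L)"
      using D(1) by (intro divide_right_mono) (auto intro!: mult_left_mono power_mono)
    finally have "(\<Sum>i<n. \<Sum>zs\<in>(?Z cs i). ?q cs) \<le>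
        real n ^ Suc L * (D * real n) ^ (?M - Suc L) / fact (Suc L) * ?q cs"
      by (simp add: mult_right_mono)
    \<comment> \<open>The \<open>?M\<close> nodes bring \<open>?M\<close> powers of \<open>n\<close>
      and the \<open>?M - 1\<close> edges remove all but one.\<close>
    also have "\<dots> = real n * (D ^ (?M - Suc L) * real K ^ (?M - 1)) / fact (Suc L)"
    proof -
      have "real n ^ Suc L * real n ^ (?M - Suc L) = real n * real n ^ (?M - 1)"
        using M by (simp flip: power_add power_Suc)
      moreover have "x * (d * y) / F * (\<kappa> / a) = real n * (d * \<kappa>) / F"
        if "x * y = real n * a" "a \<noteq> 0" for x y d F \<kappa> a :: real
      proof -
        have "x * (d * y) / F * (\<kappa> / a) = (x * y) * (d * \<kappa>) / (F * a)"
          by simp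
        then show ?thesis
          using that by simp
      qed
      ultimately show ?thesis
        using \<open>0 < n\<close> unfolding power_mult_distrib power_divide by simp
    qed
    also have "\<dots> \<le> real n * ((D * real K) ^ (?k * L)) / fact (Suc L)"
    proof (intro divide_right_mono mult_left_mono)
      have "D ^ (?M - Suc L) * real K ^ (?M - 1) \<le> D ^ (?M - 1) * real K ^ (?M - 1)"
        using D(2) by (intro mult_right_mono power_increasing) auto
      also have "\<dots> = (D * real K) ^ (?M - 1)"
        by (simp add: power_mult_distrib)
      also have "\<dots> \<le> (D * real K) ^ (?k * L)"
      proof (rule power_increasing[OF M(2)])
        have "1 * 1 \<le> D * real K"
          using D(2) n by (intro mult_mono) auto
        then show "1 \<le> D * real K" by simp
      qed
      finally show "D ^ (?M - Suc L) * real K ^ (?M - 1) \<le> (D * real K) ^ (?k * L)" .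
    qed auto
    finally show ?thesis by simp
  qed
  have "(\<Sum>i<n. ?P {ys. chain (?\<Phi> ys) R L i}) \<le>
      (\<Sum>i<n. \<Sum>cs\<in>codes ?k L. \<Sum>zs\<in>(?Z cs i). ?q cs)"
    using le by (intro sum_mono) auto
  also have "\<dots> = (\<Sum>cs\<in>codes ?k L. \<Sum>i<n. \<Sum>zs\<in>(?Z cs i). ?q cs)"
    by (rule sum.swap)
  also have "\<dots> \<le> (\<Sum>cs\<in>codes ?k L. real n * ((D * real K) ^ (?k * L) / fact (Suc L)))"
    by (intro sum_mono per_code)
  also have "\<dots> = real ((Suc ?k * ?k) ^ L) * (real n * ((D * real K) ^ (?k * L) / fact (Suc L)))"
    by (simp only: sum_constant card_codes)
  also have "\<dots> = real n * ((real (Suc ?k * ?k) * (D * real K) ^ ?k) ^ L / fact (Suc L))"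
    unfolding of_nat_power power_mult power_mult_distrib[of "real (Suc ?k * ?k)"]
    by (simp only: times_divide_eq_right ac_simps)
  finally show ?thesis
    by (simp only: chain_rate_def)
qed

section \<open>Concentration\<close>

lemma expectation_pair_pmf_finite:
  fixes f :: "'a \<times> 'b \<Rightarrow> real"
  assumes "finite (set_pmf p)" "finite (set_pmf q)"
  shows "EV (pair_pmf p q) f =
    EV p (\<lambda>x. EV q (\<lambda>y. f (x, y)))"
proof -
  have "EV (pair_pmf p q) f =
      (\<Sum>z\<in>set_pmf p \<times> set_pmf q. pmf (pair_pmf p q) z *\<^sub>R f z)"
    using assms by (intro integral_measure_pmf) auto
  also have "\<dots> = (\<Sum>x\<in>set_pmf p. \<Sum>y\<in>set_pmf q. pmf p x * (pmf q y * f (x, y)))"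
    by (subst sum.cartesian_product) (auto simp: pmf_pair intro!: sum.cong)
  also have "\<dots> = (\<Sum>x\<in>set_pmf p. pmf p x *\<^sub>R EV q (\<lambda>y. f (x, y)))"
    using assms by (intro sum.cong refl)
      (simp add: integral_measure_pmf[of "set_pmf q"] sum_distrib_left)
  also have "\<dots> = EV p (\<lambda>x. EV q (\<lambda>y. f (x, y)))"
    using assms by (intro integral_measure_pmf[symmetric]) auto
  finally show ?thesis .
qed

lemma expectation_swap_finite:
  fixes f :: "'a \<Rightarrow> 'b \<Rightarrow> real"
  assumes "finite (set_pmf p)" "finite (set_pmf q)"
  shows "EV p (\<lambda>x. EV q (f x)) =
    EV q (\<lambda>y. EV p (\<lambda>x. f x y))"
proof -
  have "EV p (\<lambda>x. EV q (f x)) =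
      EV (pair_pmf p q) (\<lambda>(x, y). f x y)"
    using expectation_pair_pmf_finite[OF assms, of "\<lambda>(x, y). f x y"] by simp
  also have "pair_pmf p q = map_pmf (\<lambda>(x, y). (y, x)) (pair_pmf q p)"
    by (rule pair_commute_pmf)
  also have "EV \<dots> (\<lambda>(x, y). f x y) =
      EV (pair_pmf q p) (\<lambda>(y, x). f x y)"
    by (simp add: case_prod_unfold)
  also have "\<dots> = EV q (\<lambda>y. EV p (\<lambda>x. f x y))"
    using expectation_pair_pmf_finite[OF assms(2,1), of "\<lambda>(y, x). f x y"] by simp
  finally show ?thesis .
qed

lemma expectation_square_le:
  fixes h :: "'a \<Rightarrow> real"
  assumes "finite (set_pmf p)"
  shows "(EV p h)\<^sup>2 \<le> EV p (\<lambda>x. (h x)\<^sup>2)"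
proof -
  let ?E = "EV p"
  have int: "integrable (measure_pmf p) k" for k :: "'a \<Rightarrow> real"
    by (rule integrable_measure_pmf_finite[OF assms])
  have "0 \<le> ?E (\<lambda>x. (h x - ?E h)\<^sup>2)"
    by simp
  also have "\<dots> = ?E (\<lambda>x. (h x)\<^sup>2 - 2 * ?E h * h x + (?E h)\<^sup>2)"
    by (simp add: power2_diff algebra_simps)
  also have "\<dots> = ?E (\<lambda>x. (h x)\<^sup>2) - 2 * ?E h * ?E h + (?E h)\<^sup>2"
    using int by simp
  finally show ?thesis
    by (simp add: power2_eq_square)
qed

lemma finite_set_Pi_pmf:
  assumes "finite A" "finite (set_pmf p)"
  shows "finite (set_pmf (Pi_pmf A d (\<lambda>_. p)))"
  by (rule finite_subset[OF set_Pi_pmf_subset']) (use assms in \<open>auto intro!: finite_PiE_dflt\<close>)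

lemma expectation_Pi_insert:
  fixes f :: "('a \<Rightarrow> 'b) \<Rightarrow> real" and d :: "'b"
  assumes "finite A" "x \<notin> A" "finite (set_pmf p)"
  shows "EV (Pi_pmf (insert x A) d (\<lambda>_. p)) f =
    EV p (\<lambda>y. EV (Pi_pmf A d (\<lambda>_. p)) (\<lambda>h. f (h(x := y))))"
  using assms expectation_pair_pmf_finite[OF assms(3) finite_set_Pi_pmf[OF assms(1,3)],
      of d "\<lambda>(y, h). f (h(x := y))"]
  by (simp add: Pi_pmf_insert case_prod_unfold)

text \<open>Induction on the coordinates. The variance splits into the mean of the conditional
  variances given coordinate \<open>x\<close>, which the induction hypothesis handles, and the
  variance of the conditional mean \<open>g\<close>. Bounding the latter by Jensen's inequality
  gives up the usual factor 1/2.\<close>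

lemma Efron_Stein_Pi_pmf:
  fixes f :: "('a \<Rightarrow> 'b) \<Rightarrow> real" and d :: "'b"
  assumes "finite A" "finite (set_pmf p)"
  defines "E \<equiv> \<lambda>A. EV (Pi_pmf A d (\<lambda>_. p))"
  shows "E A (\<lambda>ys. (f ys - E A f)\<^sup>2) \<le>
    (\<Sum>x\<in>A. E A (\<lambda>ys. EV p (\<lambda>c. (f ys - f (ys(x := c)))\<^sup>2)))"
  using assms(1)
proof (induction A arbitrary: f rule: finite_induct)
  case empty
  then show ?case by (simp add: E_def)
next
  case (insert x A)
  let ?Ep = "EV p"
  have finp: "finite (set_pmf p)" and finA: "finite (set_pmf (Pi_pmf A d (\<lambda>_. p)))"
    using assms(2) finite_set_Pi_pmf[OF insert.hyps(1) assms(2)] by auto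
  have intp: "integrable (measure_pmf p) k" for k :: "_ \<Rightarrow> real"
    by (rule integrable_measure_pmf_finite[OF finp])
  have intA: "integrable (measure_pmf (Pi_pmf A d (\<lambda>_. p))) k" for k :: "_ \<Rightarrow> real"
    by (rule integrable_measure_pmf_finite[OF finA])
  have Eins: "E (insert x A) k = ?Ep (\<lambda>y. E A (\<lambda>h. k (h(x := y))))" for k
    unfolding E_def by (rule expectation_Pi_insert[OF insert.hyps finp])
  have swap: "E A (\<lambda>h. ?Ep (k h)) = ?Ep (\<lambda>y. E A (\<lambda>h. k h y))" for k
    unfolding E_def by (rule expectation_swap_finite[OF finA finp])
  define F where "F = (\<lambda>y h. f (h(x := y)))"
  define g where "g y = E A (F y)" for y
  define m where "m = E (insert x A) f"
  have m: "m = ?Ep g"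
    unfolding m_def Eins by (simp add: g_def[abs_def] F_def)
  have "E (insert x A) (\<lambda>ys. (f ys - m)\<^sup>2) = ?Ep (\<lambda>y. E A (\<lambda>h. (F y h - m)\<^sup>2))"
    by (simp add: Eins F_def)
  also have "\<dots> = ?Ep (\<lambda>y. E A (\<lambda>h. (F y h - g y)\<^sup>2) + (g y - m)\<^sup>2)"
  proof (rule arg_cong[of _ _ ?Ep], rule ext)
    fix y
    have "(F y h - m)\<^sup>2 = (F y h - g y)\<^sup>2 + (2 * (g y - m) * F y h + ((g y - m)\<^sup>2 - 2 * (g y - m) * g y))" for h
      by (simp add: power2_eq_square algebra_simps)
    then have "E A (\<lambda>h. (F y h - m)\<^sup>2) =
        E A (\<lambda>h. (F y h - g y)\<^sup>2) + (2 * (g y - m) * E A (F y) + ((g y - m)\<^sup>2 - 2 * (g y - m) * g y))"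
      unfolding E_def using intA by simp
    then show "E A (\<lambda>h. (F y h - m)\<^sup>2) = E A (\<lambda>h. (F y h - g y)\<^sup>2) + (g y - m)\<^sup>2"
      by (simp add: g_def)
  qed
  also have "\<dots> = ?Ep (\<lambda>y. E A (\<lambda>h. (F y h - g y)\<^sup>2)) + ?Ep (\<lambda>y. (g y - m)\<^sup>2)"
    using intp by simp
  also have "\<dots> \<le> (\<Sum>z\<in>A. E (insert x A) (\<lambda>ys. ?Ep (\<lambda>c. (f ys - f (ys(z := c)))\<^sup>2))) +
      E (insert x A) (\<lambda>ys. ?Ep (\<lambda>c. (f ys - f (ys(x := c)))\<^sup>2))"
  proof (rule add_mono)
    have "?Ep (\<lambda>y. E A (\<lambda>h. (F y h - g y)\<^sup>2)) \<le>
        ?Ep (\<lambda>y. \<Sum>z\<in>A. E A (\<lambda>h. ?Ep (\<lambda>c. (F y h - F y (h(z := c)))\<^sup>2)))"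
      unfolding g_def by (rule integral_mono[OF intp intp]) (rule insert.IH)
    also have "\<dots> = (\<Sum>z\<in>A. ?Ep (\<lambda>y. E A (\<lambda>h. ?Ep (\<lambda>c. (F y h - F y (h(z := c)))\<^sup>2))))"
      using intp by (intro Bochner_Integration.integral_sum) auto
    also have "\<dots> = (\<Sum>z\<in>A. E (insert x A) (\<lambda>ys. ?Ep (\<lambda>c. (f ys - f (ys(z := c)))\<^sup>2)))"
    proof (intro sum.cong refl)
      fix z assume "z \<in> A"
      then have "z \<noteq> x" using insert.hyps by auto
      then show "?Ep (\<lambda>y. E A (\<lambda>h. ?Ep (\<lambda>c. (F y h - F y (h(z := c)))\<^sup>2))) =
          E (insert x A) (\<lambda>ys. ?Ep (\<lambda>c. (f ys - f (ys(z := c)))\<^sup>2))"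
        by (simp add: Eins F_def fun_upd_twist)
    qed
    finally show "?Ep (\<lambda>y. E A (\<lambda>h. (F y h - g y)\<^sup>2)) \<le>
        (\<Sum>z\<in>A. E (insert x A) (\<lambda>ys. ?Ep (\<lambda>c. (f ys - f (ys(z := c)))\<^sup>2)))" .
    \<comment> \<open>\<open>g y - m\<close> is a mean of differences in coordinate
      \<open>x\<close>; the square is moved inside both expectations.\<close>
    have "(g y - m)\<^sup>2 \<le> ?Ep (\<lambda>c. E A (\<lambda>h. (F y h - F c h)\<^sup>2))" for y
    proof -
      have "g y - m = ?Ep (\<lambda>c. E A (\<lambda>h. F y h - F c h))"
        unfolding m using intp intA by (simp add: g_def[abs_def] E_def)
      then have "(g y - m)\<^sup>2 \<le> ?Ep (\<lambda>c. (E A (\<lambda>h. F y h - F c h))\<^sup>2)"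
        using expectation_square_le[OF finp] by simp
      also have "\<dots> \<le> ?Ep (\<lambda>c. E A (\<lambda>h. (F y h - F c h)\<^sup>2))"
        using intp expectation_square_le[OF finA] unfolding E_def by (intro integral_mono) auto
      finally show ?thesis .
    qed
    then have "?Ep (\<lambda>y. (g y - m)\<^sup>2) \<le> ?Ep (\<lambda>y. ?Ep (\<lambda>c. E A (\<lambda>h. (F y h - F c h)\<^sup>2)))"
      using intp by (intro integral_mono) auto
    also have "\<dots> = ?Ep (\<lambda>y. E A (\<lambda>h. ?Ep (\<lambda>c. (F y h - F c h)\<^sup>2)))"
      by (simp add: swap)
    also have "\<dots> = E (insert x A) (\<lambda>ys. ?Ep (\<lambda>c. (f ys - f (ys(x := c)))\<^sup>2))"
      by (simp add: Eins F_def)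
    finally show "?Ep (\<lambda>y. (g y - m)\<^sup>2) \<le> E (insert x A) (\<lambda>ys. ?Ep (\<lambda>c. (f ys - f (ys(x := c)))\<^sup>2))" .
  qed
  also have "\<dots> = (\<Sum>z\<in>insert x A. E (insert x A) (\<lambda>ys. ?Ep (\<lambda>c. (f ys - f (ys(z := c)))\<^sup>2)))"
    using insert.hyps by simp
  finally show ?case
    unfolding m_def .
qed

section \<open>Stability of the localized output under changing one clause\<close>

definition localized :: "nat \<Rightarrow> (nat \<Rightarrow> inst \<Rightarrow> bool) \<Rightarrow> inst \<Rightarrow> nat \<Rightarrow> bool" where
  "localized \<rho> g \<Phi> i = out g (view \<rho> \<Phi> i) i"

lemma view_remove:
  assumes "vars C \<inter> nbr (set (xs @ C # ys)) \<rho> i = {}"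
  shows "view \<rho> (xs @ C # ys) i = view \<rho> (xs @ ys) i"
proof -
  have "nbr (set (xs @ ys)) \<rho> i = nbr (set (xs @ C # ys)) \<rho> i"
    by (rule nbr_cong[of _ _ \<rho>]) (use assms in auto)
  with assms show ?thesis
    unfolding view_def by simp
qed

text \<open>If neither the old nor the new clause meets the ball around \<open>i\<close>, both views
  equal the view of the instance with that position removed.\<close>

lemma localized_update:
  assumes "j < length \<Phi>" "localized \<rho> g \<Phi> i \<noteq> localized \<rho> g (\<Phi>[j := C']) i"
  shows "vars (\<Phi> ! j) \<inter> nbr (set \<Phi>) \<rho> i \<noteq> {} \<or> vars C' \<inter> nbr (set (\<Phi>[j := C'])) \<rho> i \<noteq> {}"
proof (rule ccontr)
  assume no: "\<not> ?thesis"
  let ?xs = "take j \<Phi>" and ?ys = "drop (Suc j) \<Phi>"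
  have 1: "\<Phi> = ?xs @ \<Phi> ! j # ?ys"
    using assms(1) by (rule id_take_nth_drop)
  have 2: "\<Phi>[j := C'] = ?xs @ C' # ?ys"
    using assms(1) by (rule upd_conv_take_nth_drop)
  have "view \<rho> \<Phi> i = view \<rho> (?xs @ ?ys) i"
    using view_remove[of "\<Phi> ! j" ?xs ?ys \<rho> i] no 1 by metis
  moreover have "view \<rho> (\<Phi>[j := C']) i = view \<rho> (?xs @ ?ys) i"
    using view_remove[of C' ?xs ?ys \<rho> i] no 2 by metis
  ultimately show False
    using assms(2) by (simp add: localized_def)
qed

lemma card_nbr:
  assumes "finite S" "\<And>C. C \<in> S \<Longrightarrow> finite (vars C) \<and> card (vars C) \<le> K"
    and "\<And>v. card {C \<in> S. v \<in> vars C} \<le> s"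
  shows "finite (nbr S t x)" "card (nbr S t x) \<le> (1 + s * K) ^ t"
proof -
  have "finite (nbr S t x) \<and> card (nbr S t x) \<le> (1 + s * K) ^ t"
  proof (induction t)
    case (Suc t)
    let ?N = "nbr S t x"
    let ?U = "\<Union>z\<in>?N. \<Union>C\<in>{C \<in> S. z \<in> vars C}. vars C"
    have eq: "nbr S (Suc t) x = ?N \<union> ?U"
      by auto
    have finN: "finite ?N" using Suc by simp
    have finU: "finite ?U"
      using finN assms(1,2) by auto
    have "card ?U \<le> (\<Sum>z\<in>?N. card (\<Union>C\<in>{C \<in> S. z \<in> vars C}. vars C))"
      by (rule card_UN_le[OF finN])
    also have "\<dots> \<le> (\<Sum>z\<in>?N. s * K)"
    proof (rule sum_mono)
      fix z
      have "card (\<Union>C\<in>{C \<in> S. z \<in> vars C}. vars C) \<le> (\<Sum>C\<in>{C \<in> S. z \<in> vars C}. card (vars C))"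
        using assms(1) by (intro card_UN_le) auto
      also have "\<dots> \<le> card {C \<in> S. z \<in> vars C} * K"
        using assms(2) sum_bounded_above[of "{C \<in> S. z \<in> vars C}" "\<lambda>C. card (vars C)" K] by simp
      also have "\<dots> \<le> s * K"
        using assms(3) by (intro mult_right_mono) auto
      finally show "card (\<Union>C\<in>{C \<in> S. z \<in> vars C}. vars C) \<le> s * K" .
    qed
    finally have "card ?U \<le> card ?N * (s * K)"
      by simp
    then have "card (?N \<union> ?U) \<le> card ?N * (1 + s * K)"
      using card_Un_le[of ?N ?U] by (simp add: algebra_simps)
    also have "\<dots> \<le> (1 + s * K) ^ t * (1 + s * K)"
      using Suc by (intro mult_right_mono) auto
    also have "\<dots> = (1 + s * K) ^ Suc t"
      by (simp only: power_Suc2)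
    finally show ?case
      unfolding eq using finN finU by simp
  qed simp
  then show "finite (nbr S t x)" "card (nbr S t x) \<le> (1 + s * K) ^ t" by auto
qed

text \<open>By \<open>nbr_sym\<close>, the variables whose balls meet \<open>C\<close> are those in
  the balls around the variables of \<open>C\<close>.\<close>

lemma card_reach:
  assumes "finite S" "\<And>C. C \<in> S \<Longrightarrow> finite (vars C) \<and> card (vars C) \<le> K"
    and "\<And>v. card {C \<in> S. v \<in> vars C} \<le> s" and "C \<in> S"
  shows "finite {i. vars C \<inter> nbr S \<rho> i \<noteq> {}}"
    and "card {i. vars C \<inter> nbr S \<rho> i \<noteq> {}} \<le> K * (1 + s * K) ^ \<rho>"
proof -
  have eq: "{i. vars C \<inter> nbr S \<rho> i \<noteq> {}} = (\<Union>y\<in>vars C. nbr S \<rho> y)"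
    using nbr_sym by fast
  have fin: "finite (vars C)" and le: "card (vars C) \<le> K"
    using assms(2,4) by auto
  show "finite {i. vars C \<inter> nbr S \<rho> i \<noteq> {}}"
    unfolding eq using fin card_nbr(1)[OF assms(1-3)] by auto
  have "card (\<Union>y\<in>vars C. nbr S \<rho> y) \<le> (\<Sum>y\<in>vars C. card (nbr S \<rho> y))"
    by (rule card_UN_le[OF fin])
  also have "\<dots> \<le> card (vars C) * (1 + s * K) ^ \<rho>"
    using card_nbr(2)[OF assms(1-3), where t = \<rho>] sum_bounded_above[of "vars C" "\<lambda>y. card (nbr S \<rho> y)"] by simp
  also have "\<dots> \<le> K * (1 + s * K) ^ \<rho>"
    using le by (rule mult_right_mono) simp
  finally show "card {i. vars C \<inter> nbr S \<rho> i \<noteq> {}} \<le> K * (1 + s * K) ^ \<rho>"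
    unfolding eq .
qed

definition ham :: "nat \<Rightarrow> (nat \<Rightarrow> bool) \<Rightarrow> (nat \<Rightarrow> bool) \<Rightarrow> nat" where
  "ham n \<sigma> \<tau> = card {i. i < n \<and> \<sigma> i \<noteq> \<tau> i}"

lemma ham_le: "ham n \<sigma> \<tau> \<le> n"
  unfolding ham_def using card_mono[of "{..<n}" "{i. i < n \<and> \<sigma> i \<noteq> \<tau> i}"] by auto

lemma ham_sym: "ham n \<sigma> \<tau> = ham n \<tau> \<sigma>"
  unfolding ham_def by (rule arg_cong[of _ _ card]) auto

lemma ham_triangle: "ham n \<sigma> \<upsilon> \<le> ham n \<sigma> \<tau> + ham n \<tau> \<upsilon>"
proof -
  have "ham n \<sigma> \<upsilon> \<le> card ({i. i < n \<and> \<sigma> i \<noteq> \<tau> i} \<union> {i. i < n \<and> \<tau> i \<noteq> \<upsilon> i})"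
    unfolding ham_def by (intro card_mono) auto
  also have "\<dots> \<le> ham n \<sigma> \<tau> + ham n \<tau> \<upsilon>"
    unfolding ham_def by (rule card_Un_le)
  finally show ?thesis .
qed

lemma ham_diff: "\<bar>real (ham n \<sigma> \<tau>) - real (ham n \<sigma>' \<tau>')\<bar> \<le> real (ham n \<sigma> \<sigma>' + ham n \<tau> \<tau>')"
  using ham_triangle[of n \<sigma> \<tau> \<sigma>'] ham_triangle[of n \<sigma>' \<tau> \<tau>'] ham_triangle[of n \<sigma>' \<tau>' \<sigma>]
    ham_triangle[of n \<sigma> \<tau>' \<tau>] ham_sym[of n \<sigma> \<sigma>'] ham_sym[of n \<tau> \<tau>']
  by linarith

text \<open>Clause positions are counted in the whole array, so with \<open>N = 3 * m\<close> one
  condition controls the degrees in all three copies at once.\<close>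

definition lowdeg :: "nat \<Rightarrow> nat \<Rightarrow> (nat \<Rightarrow> clause) \<Rightarrow> bool" where
  "lowdeg N s ys \<longleftrightarrow> (\<forall>v. card {j. j < N \<and> v \<in> vars (ys j)} \<le> s)"

text \<open>Union bound over a variable and a set of \<open>Suc s\<close> clauses that all contain
  it.\<close>

lemma prob_not_lowdeg:
  assumes "K \<le> n" "0 < n"
  shows "Pr (fam K n {..<N}) {ys. \<not> lowdeg N s ys} \<le>
    real n * ((real N * real K / real n) ^ Suc s / fact (Suc s))"
proof -
  let ?P = "Pr (fam K n {..<N})"
  let ?J = "{J. J \<subseteq> {..<N} \<and> card J = Suc s}"
  let ?A = "\<lambda>(v, J). {ys. \<forall>(v, j)\<in>{v} \<times> J. v \<in> vars (ys j)}"
  have finJ: "finite ?J"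
    by (rule finite_subset[of _ "Pow {..<N}"]) auto
  have "?P {ys. \<not> lowdeg N s ys} = ?P ({ys. \<not> lowdeg N s ys} \<inter> set_pmf (fam K n {..<N}))"
    by (simp add: measure_Int_set_pmf)
  also have "\<dots> \<le> ?P (\<Union>p\<in>{..<n} \<times> ?J. ?A p)"
  proof (intro measure_pmf.finite_measure_mono subsetI)
    fix ys assume ys: "ys \<in> {ys. \<not> lowdeg N s ys} \<inter> set_pmf (fam K n {..<N})"
    then obtain v where v: "Suc s \<le> card {j. j < N \<and> v \<in> vars (ys j)}"
      by (auto simp: lowdeg_def not_le Suc_le_eq)
    then obtain J where J: "J \<subseteq> {j. j < N \<and> v \<in> vars (ys j)}" "card J = Suc s"
      by (meson obtain_subset_with_card_n)
    then obtain j where "j \<in> J" by fastforce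
    then have "j < N" "v \<in> vars (ys j)" using J by auto
    then have "v < n"
      using vars_fam(1)[OF assms(1), of ys "{..<N}" j] ys by auto
    with J show "ys \<in> (\<Union>p\<in>{..<n} \<times> ?J. ?A p)"
      by (auto intro!: bexI[of _ "(v, J)"])
  qed simp
  also have "\<dots> \<le> (\<Sum>p\<in>{..<n} \<times> ?J. ?P (?A p))"
    using finJ by (intro measure_pmf.finite_measure_subadditive_finite) auto
  also have "\<dots> \<le> (\<Sum>p\<in>{..<n} \<times> ?J. (real K / real n) ^ Suc s)"
  proof (rule sum_mono)
    fix p assume "p \<in> {..<n} \<times> ?J"
    then obtain v J where p: "p = (v, J)" "J \<subseteq> {..<N}" "card J = Suc s" by auto
    then have "finite J" using finite_subset by auto
    then show "?P (?A p) \<le> (real K / real n) ^ Suc s"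
      using prob_edges[OF assms, of "{v} \<times> J" N] p by auto
  qed
  also have "\<dots> = real n * (real (N choose Suc s) * (real K / real n) ^ Suc s)"
    using n_subsets[of "{..<N}" "Suc s"] by (simp add: card_cartesian_product del: power_Suc)
  also have "\<dots> \<le> real n * ((real N ^ Suc s / fact (Suc s)) * (real K / real n) ^ Suc s)"
  proof (intro mult_left_mono mult_right_mono)
    have "real ((N choose Suc s) * fact (Suc s)) \<le> real (N ^ Suc s)"
      using binomial_fact_pow[of N "Suc s"] by (simp only: of_nat_le_iff)
    then show "real (N choose Suc s) \<le> real N ^ Suc s / fact (Suc s)"
      by (subst pos_le_divide_eq[OF fact_gt_zero]) (simp only: of_nat_mult of_nat_power of_nat_fact)
  qed auto
  also have "\<dots> = real n * ((real N * real K / real n) ^ Suc s / fact (Suc s))"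
    by (simp only: power_mult_distrib power_divide times_divide_eq_left times_divide_eq_right
        divide_divide_eq_left mult.commute[of "fact _"])
  finally show ?thesis .
qed

text \<open>\<open>copy m t a\<close> is the \<open>a\<close>-th of several formulas with \<open>m\<close> clauses that share their first \<open>t\<close>
  clauses.\<close>

definition pos :: "nat \<Rightarrow> nat \<Rightarrow> nat \<Rightarrow> nat \<Rightarrow> nat" where
  "pos m t a j = (if j < t then j else a * m + j)"

definition copy :: "nat \<Rightarrow> nat \<Rightarrow> nat \<Rightarrow> (nat \<Rightarrow> clause) \<Rightarrow> inst" where
  "copy m t a ys = map (\<lambda>j. ys (pos m t a j)) [0..<m]"

abbreviation lcopy where
  "lcopy \<rho> g m t a ys \<equiv> localized \<rho> g (copy m t a ys)"

lemma inj_pos: "t \<le> m \<Longrightarrow> inj_on (pos m t a) {..<m}"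
  unfolding inj_on_def pos_def by (cases a) auto

lemma pos_less: "j < m \<Longrightarrow> a < 3 \<Longrightarrow> pos m t a j < 3 * m"
proof -
  assume a: "j < m" "a < 3"
  then have "a * m \<le> 2 * m" by (intro mult_right_mono) auto
  with a have "a * m + j < 3 * m" by linarith
  with a show ?thesis by (auto simp: pos_def)
qed

lemma copy_upd:
  assumes "t \<le> m"
  shows "copy m t a (ys(p := c)) = copy m t a ys \<or>
    (\<exists>j<m. copy m t a (ys(p := c)) = (copy m t a ys)[j := c])"
proof (cases "\<exists>j<m. pos m t a j = p")
  case True
  then obtain j where j: "j < m" "pos m t a j = p" by blast
  have "copy m t a (ys(p := c)) = (copy m t a ys)[j := c]"
    by (rule nth_equalityI)
      (use j inj_pos[OF assms, of a] in \<open>auto simp: copy_def nth_list_update inj_on_def\<close>)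
  with j show ?thesis by blast
next
  case False
  then have "copy m t a (ys(p := c)) = copy m t a ys"
    by (auto simp: copy_def)
  then show ?thesis ..
qed

lemma copy_Suc: "t < m \<Longrightarrow> copy m (Suc t) a ys = (copy m t a ys)[t := ys t]"
  by (rule nth_equalityI) (auto simp: copy_def pos_def nth_list_update less_Suc_eq)

text \<open>Twice the bound of \<open>card_reach\<close>: once for the clause removed and once for
  the clause inserted.\<close>

definition infl :: "nat \<Rightarrow> nat \<Rightarrow> nat \<Rightarrow> nat" where
  "infl K \<rho> s = 2 * (K * (1 + s * K) ^ \<rho>)"

lemma ham_localized_update:
  assumes "j < length \<Phi>"
    and cl: "\<And>C. C \<in> set \<Phi> \<union> set (\<Phi>[j := C']) \<Longrightarrow> finite (vars C) \<and> card (vars C) \<le> K"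
    and deg: "\<And>v. card {C \<in> set \<Phi>. v \<in> vars C} \<le> s" "\<And>v. card {C \<in> set (\<Phi>[j := C']). v \<in> vars C} \<le> s"
  shows "ham n (localized \<rho> g \<Phi>) (localized \<rho> g (\<Phi>[j := C'])) \<le> infl K \<rho> s"
proof -
  let ?A = "{i. vars (\<Phi> ! j) \<inter> nbr (set \<Phi>) \<rho> i \<noteq> {}}"
  let ?B = "{i. vars C' \<inter> nbr (set (\<Phi>[j := C'])) \<rho> i \<noteq> {}}"
  have C': "C' \<in> set (\<Phi>[j := C'])"
    using assms(1) by (rule set_update_memI)
  have A: "finite ?A" "card ?A \<le> K * (1 + s * K) ^ \<rho>"
    using card_reach[of "set \<Phi>" K s "\<Phi> ! j" \<rho>] cl deg(1) assms(1) by auto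
  have B: "finite ?B" "card ?B \<le> K * (1 + s * K) ^ \<rho>"
    using card_reach[of "set (\<Phi>[j := C'])" K s C' \<rho>] cl deg(2) C' by auto
  have "ham n (localized \<rho> g \<Phi>) (localized \<rho> g (\<Phi>[j := C'])) \<le> card (?A \<union> ?B)"
    unfolding ham_def
  proof (rule card_mono)
    show "{i. i < n \<and> localized \<rho> g \<Phi> i \<noteq> localized \<rho> g (\<Phi>[j := C']) i} \<subseteq> ?A \<union> ?B"
      using localized_update[OF assms(1)] by blast
  qed (use A B in auto)
  also have "\<dots> \<le> infl K \<rho> s"
    using card_Un_le[of ?A ?B] A B by (simp add: infl_def)
  finally show ?thesis .
qed

lemma deg_copy:
  assumes "lowdeg (3 * m) s ys" "a < 3"
  shows "card {C \<in> set (copy m t a ys). v \<in> vars C} \<le> s"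
proof -
  have "{C \<in> set (copy m t a ys). v \<in> vars C} \<subseteq> ys ` {j. j < 3 * m \<and> v \<in> vars (ys j)}"
    using pos_less[OF _ assms(2), of _ m t] by (auto simp: copy_def)
  then have "card {C \<in> set (copy m t a ys). v \<in> vars C} \<le> card (ys ` {j. j < 3 * m \<and> v \<in> vars (ys j)})"
    by (intro card_mono) auto
  also have "\<dots> \<le> card {j. j < 3 * m \<and> v \<in> vars (ys j)}"
    by (rule card_image_le) auto
  also have "\<dots> \<le> s"
    using assms(1) by (simp add: lowdeg_def)
  finally show ?thesis .
qed

lemma lowdeg_upd: "lowdeg N s ys \<Longrightarrow> lowdeg N (Suc s) (ys(p := c))"
  unfolding lowdeg_def
proof
  fix v assume a: "\<forall>v. card {j. j < N \<and> v \<in> vars (ys j)} \<le> s"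
  have "card {j. j < N \<and> v \<in> vars ((ys(p := c)) j)} \<le> card (insert p {j. j < N \<and> v \<in> vars (ys j)})"
    by (rule card_mono) auto
  also have "\<dots> \<le> Suc (card {j. j < N \<and> v \<in> vars (ys j)})"
    by (rule card_insert_le_m1) auto
  finally show "card {j. j < N \<and> v \<in> vars ((ys(p := c)) j)} \<le> Suc s"
    using a by (meson Suc_le_mono le_trans)
qed

lemma lowdeg_mono: "lowdeg N s ys \<Longrightarrow> s \<le> s' \<Longrightarrow> lowdeg N s' ys"
  unfolding lowdeg_def using le_trans by blast

definition small_vars :: "nat \<Rightarrow> nat \<Rightarrow> (nat \<Rightarrow> clause) \<Rightarrow> bool" where
  "small_vars K N ys \<longleftrightarrow> (\<forall>j<N. finite (vars (ys j)) \<and> card (vars (ys j)) \<le> K)"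

lemma small_vars_copy:
  assumes "small_vars K (3 * m) ys" "a < 3" "C \<in> set (copy m t a ys)"
  shows "finite (vars C) \<and> card (vars C) \<le> K"
  using assms pos_less[OF _ assms(2), of _ m t] by (auto simp: small_vars_def copy_def)

text \<open>A position of the array is read at most once by each copy. The fresh clause may raise
  degrees by one, hence \<open>Suc s\<close>; in \<open>ham_copy_Suc\<close> the inserted clause
  already belongs to the array and \<open>s\<close> suffices.\<close>

lemma ham_copy_upd:
  assumes "lowdeg (3 * m) s ys" "small_vars K (3 * m) ys" "finite (vars c)" "card (vars c) \<le> K"
    and "t \<le> m" "a < 3"
  shows "ham n (lcopy \<rho> g m t a ys) (lcopy \<rho> g m t a (ys(p := c))) \<le> infl K \<rho> (Suc s)"
proof -
  have low: "lowdeg (3 * m) (Suc s) ys" "lowdeg (3 * m) (Suc s) (ys(p := c))"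
    using lowdeg_upd assms(1) lowdeg_mono[of _ s ys "Suc s"] by auto
  have small: "small_vars K (3 * m) (ys(p := c))"
    using assms(2-4) by (auto simp: small_vars_def)
  consider "copy m t a (ys(p := c)) = copy m t a ys"
    | j where "j < m" "copy m t a (ys(p := c)) = (copy m t a ys)[j := c]"
    using copy_upd[OF assms(5)] by blast
  then show ?thesis
  proof cases
    case 1
    then show ?thesis by (simp add: ham_def)
  next
    case 2
    show ?thesis
      unfolding 2(2)
    proof (rule ham_localized_update)
      show "j < length (copy m t a ys)" using 2 by (simp add: copy_def)
      show "finite (vars C) \<and> card (vars C) \<le> K"
        if "C \<in> set (copy m t a ys) \<union> set ((copy m t a ys)[j := c])" for C
        using that small_vars_copy[OF assms(2,6), of C t] small_vars_copy[OF small assms(6), of C t]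
        unfolding 2(2) by blast
      show "card {C \<in> set (copy m t a ys). v \<in> vars C} \<le> Suc s" for v
        by (rule deg_copy[OF low(1) assms(6)])
      show "card {C \<in> set ((copy m t a ys)[j := c]). v \<in> vars C} \<le> Suc s" for v
        using deg_copy[OF low(2) assms(6), of t v] 2(2) by simp
    qed
  qed
qed

lemma ham_copy_Suc:
  assumes "lowdeg (3 * m) s ys" "small_vars K (3 * m) ys" "t < m" "a < 3"
  shows "ham n (lcopy \<rho> g m t a ys) (lcopy \<rho> g m (Suc t) a ys) \<le> infl K \<rho> s"
  unfolding copy_Suc[OF assms(3)]
proof (rule ham_localized_update)
  show "t < length (copy m t a ys)" using assms(3) by (simp add: copy_def)
  show "finite (vars C) \<and> card (vars C) \<le> K"
    if "C \<in> set (copy m t a ys) \<union> set ((copy m t a ys)[t := ys t])" for C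
    using that small_vars_copy[OF assms(2,4), of C t] small_vars_copy[OF assms(2,4), of C "Suc t"]
    unfolding copy_Suc[OF assms(3)] by blast
  show "card {C \<in> set (copy m t a ys). v \<in> vars C} \<le> s" for v
    by (rule deg_copy[OF assms(1,4)])
  show "card {C \<in> set ((copy m t a ys)[t := ys t]). v \<in> vars C} \<le> s" for v
    using deg_copy[OF assms(1,4), of "Suc t" v] copy_Suc[OF assms(3), of a ys] by simp
qed

section \<open>Fluctuations and mean of the distance between two copies\<close>

definition dst :: "nat \<Rightarrow> nat \<Rightarrow> (nat \<Rightarrow> inst \<Rightarrow> bool) \<Rightarrow> nat \<Rightarrow> nat \<Rightarrow> nat \<Rightarrow> nat \<Rightarrow> (nat \<Rightarrow> clause) \<Rightarrow> real" where
  "dst n \<rho> g m t a b ys =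
    real (ham n (lcopy \<rho> g m t a ys) (lcopy \<rho> g m t b ys))"

context
  fixes K n m \<rho> s :: nat and g :: "nat \<Rightarrow> inst \<Rightarrow> bool" and \<delta> :: real
  assumes Kn: "K \<le> n" "0 < n"
    and low: "Pr (fam K n {..<3 * m}) {ys. \<not> lowdeg (3 * m) s ys} \<le> \<delta>"
begin

abbreviation "EE \<equiv> EV (fam K n {..<3 * m})"

lemma finite_fam: "finite (set_pmf (fam K n A))" if "finite A"
  using finite_set_Pi_pmf[OF that finite_set_clause_pmf[OF Kn(1)]] .

lemma int_fam: "integrable (measure_pmf (fam K n {..<3 * m})) (k :: _ \<Rightarrow> real)"
  by (rule integrable_measure_pmf_finite[OF finite_fam]) simp

lemma small_vars_fam: "ys \<in> set_pmf (fam K n {..<3 * m}) \<Longrightarrow> small_vars K (3 * m) ys"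
  unfolding small_vars_def using vars_fam[OF Kn(1), of ys "{..<3 * m}"] by auto

lemma expectation_lowdeg_le:
  assumes "0 \<le> x" "0 \<le> y"
    and "\<And>ys. ys \<in> set_pmf (fam K n {..<3 * m}) \<Longrightarrow> f ys \<le> x + y * indicator {ys. \<not> lowdeg (3 * m) s ys} ys"
  shows "EE f \<le> x + y * \<delta>"
proof -
  have "EE f \<le> EE (\<lambda>ys. x + y * indicator {ys. \<not> lowdeg (3 * m) s ys} ys)"
    using assms(3) int_fam by (intro integral_mono_AE) (auto simp: AE_measure_pmf_iff)
  also have "\<dots> = x + y * Pr (fam K n {..<3 * m}) {ys. \<not> lowdeg (3 * m) s ys}"
    using int_fam by simp
  also have "\<dots> \<le> x + y * \<delta>"
    using low assms(2) by (intro add_left_mono mult_left_mono)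
  finally show ?thesis .
qed

text \<open>Resampling a clause moves each of the two localized outputs by at most
  \<open>infl K \<rho> (Suc s)\<close> if degrees are low; otherwise the trivial bound
  \<open>n\<close> on the change is weighted by the small probability
  \<open>\<delta>\<close>.\<close>

lemma variance_dst:
  assumes "t \<le> m" "a < 3" "b < 3"
  shows "EE (\<lambda>ys. (dst n \<rho> g m t a b ys - EE (dst n \<rho> g m t a b))\<^sup>2) \<le>
    real (3 * m) * ((2 * real (infl K \<rho> (Suc s)))\<^sup>2 + (real n)\<^sup>2 * \<delta>)"
proof -
  let ?f = "dst n \<rho> g m t a b"
  let ?Ep = "EV (clause_pmf K n)"
  let ?B = "2 * real (infl K \<rho> (Suc s))"
  have finp: "finite (set_pmf (clause_pmf K n))"
    by (rule finite_set_clause_pmf[OF Kn(1)])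
  have "EE (\<lambda>ys. (?f ys - EE ?f)\<^sup>2) \<le> (\<Sum>x\<in>{..<3 * m}. EE (\<lambda>ys. ?Ep (\<lambda>c. (?f ys - ?f (ys(x := c)))\<^sup>2)))"
    by (rule Efron_Stein_Pi_pmf[OF _ finp]) simp
  also have "\<dots> \<le> (\<Sum>x\<in>{..<3 * m}. ?B\<^sup>2 + (real n)\<^sup>2 * \<delta>)"
  proof (rule sum_mono)
    fix x assume "x \<in> {..<3 * m}"
    show "EE (\<lambda>ys. ?Ep (\<lambda>c. (?f ys - ?f (ys(x := c)))\<^sup>2)) \<le> ?B\<^sup>2 + (real n)\<^sup>2 * \<delta>"
    proof (rule expectation_lowdeg_le)
      fix ys assume ys: "ys \<in> set_pmf (fam K n {..<3 * m})"
      have "(?f ys - ?f (ys(x := c)))\<^sup>2 \<le> ?B\<^sup>2 + (real n)\<^sup>2 * indicator {ys. \<not> lowdeg (3 * m) s ys} ys"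
        if c: "c \<in> set_pmf (clause_pmf K n)" for c
      proof (cases "lowdeg (3 * m) s ys")
        case True
        have "ham n (lcopy \<rho> g m t e ys) (lcopy \<rho> g m t e (ys(x := c))) \<le>
            infl K \<rho> (Suc s)" if "e < 3" for e
          using ham_copy_upd[OF True small_vars_fam[OF ys] _ _ assms(1) that] vars_clause_pmf[OF Kn(1) c]
          by simp
        from this[OF assms(2)] this[OF assms(3)] have "\<bar>?f ys - ?f (ys(x := c))\<bar> \<le> ?B"
          unfolding dst_def
          using ham_diff[of n "lcopy \<rho> g m t a ys" "lcopy \<rho> g m t b ys"
              "lcopy \<rho> g m t a (ys(x := c))" "lcopy \<rho> g m t b (ys(x := c))"]
          by linarith
        then have "\<bar>?f ys - ?f (ys(x := c))\<bar>\<^sup>2 \<le> ?B\<^sup>2"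
          by (intro power_mono) auto
        then show ?thesis using True by simp
      next
        case False
        have "\<bar>?f ys - ?f (ys(x := c))\<bar> \<le> real n"
          unfolding dst_def using ham_le[of n] by (smt (verit) of_nat_0_le_iff of_nat_mono)
        then have "\<bar>?f ys - ?f (ys(x := c))\<bar>\<^sup>2 \<le> (real n)\<^sup>2"
          by (intro power_mono) auto
        then have "(?f ys - ?f (ys(x := c)))\<^sup>2 \<le> (real n)\<^sup>2"
          by simp
        then show ?thesis
          using False by (auto intro: add_increasing)
      qed
      then have "?Ep (\<lambda>c. (?f ys - ?f (ys(x := c)))\<^sup>2) \<le>
          ?Ep (\<lambda>c. ?B\<^sup>2 + (real n)\<^sup>2 * indicator {ys. \<not> lowdeg (3 * m) s ys} ys)"
        by (intro integral_mono_AE integrable_measure_pmf_finite[OF finp]) (auto simp: AE_measure_pmf_iff)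
      then show "?Ep (\<lambda>c. (?f ys - ?f (ys(x := c)))\<^sup>2) \<le>
          ?B\<^sup>2 + (real n)\<^sup>2 * indicator {ys. \<not> lowdeg (3 * m) s ys} ys"
        by simp
    qed auto
  qed
  also have "\<dots> = real (3 * m) * (?B\<^sup>2 + (real n)\<^sup>2 * \<delta>)"
    by simp
  finally show ?thesis .
qed

lemma prob_dst_deviates:
  assumes "t \<le> m" "a < 3" "b < 3" "0 < \<epsilon>"
  shows "Pr (fam K n {..<3 * m}) {ys. \<epsilon> \<le> \<bar>dst n \<rho> g m t a b ys - EE (dst n \<rho> g m t a b)\<bar>} \<le>
    real (3 * m) * ((2 * real (infl K \<rho> (Suc s)))\<^sup>2 + (real n)\<^sup>2 * \<delta>) / \<epsilon>\<^sup>2"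
proof -
  let ?f = "dst n \<rho> g m t a b"
  have "Pr (fam K n {..<3 * m}) {ys. \<epsilon> \<le> \<bar>?f ys - EE ?f\<bar>} =
      EE (indicator {ys. \<epsilon> \<le> \<bar>?f ys - EE ?f\<bar>})"
    by simp
  also have "\<dots> \<le> EE (\<lambda>ys. (?f ys - EE ?f)\<^sup>2 / \<epsilon>\<^sup>2)"
  proof (rule integral_mono[OF int_fam int_fam])
    fix ys
    have "\<epsilon>\<^sup>2 \<le> (?f ys - EE ?f)\<^sup>2" if "\<epsilon> \<le> \<bar>?f ys - EE ?f\<bar>"
      using that assms(4) power_mono[of \<epsilon> "\<bar>?f ys - EE ?f\<bar>" 2] by simp
    then show "indicator {ys. \<epsilon> \<le> \<bar>?f ys - EE ?f\<bar>} ys \<le> (?f ys - EE ?f)\<^sup>2 / \<epsilon>\<^sup>2"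
      using assms(4) by (auto simp: indicator_def)
  qed
  also have "\<dots> = EE (\<lambda>ys. (?f ys - EE ?f)\<^sup>2) / \<epsilon>\<^sup>2"
    by simp
  also have "\<dots> \<le> real (3 * m) * ((2 * real (infl K \<rho> (Suc s)))\<^sup>2 + (real n)\<^sup>2 * \<delta>) / \<epsilon>\<^sup>2"
    by (intro divide_right_mono variance_dst assms) auto
  finally show ?thesis .
qed

text \<open>Sharing one more clause lowers the mean only slightly, so the mean cannot jump over the
  window of distances that is aimed at.\<close>

lemma mean_dst_Suc:
  assumes "t < m"
  shows "EE (dst n \<rho> g m t 0 1) \<le> EE (dst n \<rho> g m (Suc t) 0 1) + (real (infl K \<rho> s) + real n * \<delta>)"
proof -
  have "EE (\<lambda>ys. dst n \<rho> g m t 0 1 ys - dst n \<rho> g m (Suc t) 0 1 ys) \<le> real (infl K \<rho> s) + real n * \<delta>"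
  proof (rule expectation_lowdeg_le)
    fix ys assume ys: "ys \<in> set_pmf (fam K n {..<3 * m})"
    \<comment> \<open>\<open>pos\<close> is the identity for \<open>a = 0\<close>, so only the
      second copy changes.\<close>
    have 0: "copy m (Suc t) 0 ys = copy m t 0 ys"
      by (auto simp: copy_def pos_def)
    show "dst n \<rho> g m t 0 1 ys - dst n \<rho> g m (Suc t) 0 1 ys \<le>
        real (infl K \<rho> s) + real n * indicator {ys. \<not> lowdeg (3 * m) s ys} ys"
    proof (cases "lowdeg (3 * m) s ys")
      case True
      show ?thesis
        unfolding dst_def 0
        using ham_triangle[of n "lcopy \<rho> g m t 0 ys" "lcopy \<rho> g m t 1 ys"
            "lcopy \<rho> g m (Suc t) 1 ys"]
          ham_sym[of n "lcopy \<rho> g m t 1 ys" "lcopy \<rho> g m (Suc t) 1 ys"]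
          ham_copy_Suc[OF True small_vars_fam[OF ys] assms, of 1 n \<rho> g] True
        by simp
    next
      case False
      have "dst n \<rho> g m t 0 1 ys \<le> real n" "0 \<le> dst n \<rho> g m (Suc t) 0 1 ys"
        unfolding dst_def using ham_le by auto
      with False show ?thesis by simp
    qed
  qed auto
  then show ?thesis
    using int_fam by simp
qed

end

section \<open>First moment of triples of solutions\<close>

lemma prob_bind_finite:
  assumes "finite (set_pmf p)"
  shows "Pr (bind_pmf p f) X = EV p (\<lambda>x. Pr (f x) X)"
proof -
  have "ennreal (Pr (bind_pmf p f) X) = (\<integral>\<^sup>+x. ennreal (Pr (f x) X) \<partial>measure_pmf p)"
    by (simp flip: measure_pmf.emeasure_eq_measure)
  also have "\<dots> = ennreal (EV p (\<lambda>x. Pr (f x) X))"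
    by (rule nn_integral_eq_integral) (auto intro: integrable_measure_pmf_finite[OF assms])
  finally show ?thesis
    by (simp add: integral_nonneg_AE)
qed

lemma binomial_le_ratio:
  assumes "a \<le> n" "K \<le> n" "0 < n"
  shows "real (a choose K) \<le> real (n choose K) * (real a / real n) ^ K"
proof (cases "K \<le> a")
  case True
  have eq: "real (b choose K) * fact K = (\<Prod>i = 0..<K. real b - real i)" for b
    using gbinomial_mult_fact'[of "real b" K] by (simp add: binomial_gbinomial)
  have "(\<Prod>i = 0..<K. real a - real i) \<le> (\<Prod>i = 0..<K. (real n - real i) * (real a / real n))"
  proof (rule prod_mono)
    fix i assume "i \<in> {0..<K}"
    then have i: "real i \<le> real a" using True by simp
    have "real a * real i \<le> real n * real i"
      using assms by (intro mult_right_mono) auto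
    then show "0 \<le> real a - real i \<and> real a - real i \<le> (real n - real i) * (real a / real n)"
      using i assms(3) by (simp add: field_simps)
  qed
  also have "\<dots> = (\<Prod>i = 0..<K. real n - real i) * (real a / real n) ^ K"
    by (simp only: prod.distrib prod_constant) simp
  finally have "real (a choose K) * fact K \<le> (real (n choose K) * (real a / real n) ^ K) * fact K"
    unfolding eq[symmetric] by (simp add: mult_ac)
  then show ?thesis
    by (rule mult_right_le_imp_le) simp
qed (simp add: binomial_eq_0)

lemma prob_kset_subset:
  assumes "K \<le> n" "0 < n" "A \<subseteq> {..<n}"
  shows "Pr (pmf_of_set (kset K n)) {V. V \<subseteq> A} \<le> (real (card A) / real n) ^ K"
proof -
  have finA: "finite A"
    using assms(3) finite_subset by blast
  have "kset K n \<inter> {V. V \<subseteq> A} = {V. V \<subseteq> A \<and> card V = K}"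
    using assms(3) by (auto simp: kset_def)
  then have "Pr (pmf_of_set (kset K n)) {V. V \<subseteq> A} = real (card A choose K) / real (n choose K)"
    using kset_ne[of K n] assms(1) finA n_subsets[OF finA, of K] by (simp add: measure_pmf_of_set)
  also have "\<dots> \<le> (real (card A) / real n) ^ K"
  proof -
    have "card A \<le> n"
      using card_mono[OF _ assms(3)] by simp
    moreover have "0 < real (n choose K)"
      using assms(1) by simp
    ultimately show ?thesis
      using binomial_le_ratio[of "card A" n K] assms by (simp add: field_simps)
  qed
  finally show ?thesis .
qed

definition signs :: "nat set \<Rightarrow> (nat \<Rightarrow> bool) pmf" where
  "signs V = Pi_pmf V False (\<lambda>_. bernoulli_pmf (1 / 2))"

text \<open>For a clause with variables \<open>V\<close> and signs \<open>s\<close>: all literals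
  true or all literals false under \<open>\<sigma>\<close>, which is a violation in the
  not-all-equal sense.\<close>

definition monochr :: "(nat \<Rightarrow> bool) \<Rightarrow> nat set \<Rightarrow> (nat \<Rightarrow> bool) \<Rightarrow> bool" where
  "monochr \<sigma> V s \<longleftrightarrow> (\<forall>x\<in>V. s x = \<sigma> x) \<or> (\<forall>x\<in>V. s x \<noteq> \<sigma> x)"

lemma sat_clause_iff:
  "sat_clause \<sigma> (Clause ((\<lambda>x. (x, s x)) |`| V) Unsigned) \<longleftrightarrow> \<not> monochr \<sigma> (fset V) s"
  by (auto simp: sat_clause_def lit_val_def monochr_def)

lemma finite_set_signs: "finite V \<Longrightarrow> finite (set_pmf (signs V))"
  unfolding signs_def by (rule finite_set_Pi_pmf) auto

lemma prob_signs_eq: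
  assumes "finite V"
  shows "Pr (signs V) {s. \<forall>x\<in>V. s x = \<sigma> x} = (1 / 2) ^ card V"
proof -
  have "{s. \<forall>x\<in>V. s x = \<sigma> x} = Pi V (\<lambda>x. {\<sigma> x})"
    by (auto simp: Pi_def)
  then have "Pr (signs V) {s. \<forall>x\<in>V. s x = \<sigma> x} =
      (\<Prod>x\<in>V. Pr (bernoulli_pmf (1 / 2)) {\<sigma> x})"
    unfolding signs_def using assms by (simp add: measure_Pi_pmf_Pi)
  also have "\<dots> = (\<Prod>x\<in>V. 1 / 2)"
    by (intro prod.cong refl) (auto simp: measure_pmf_single pmf_bernoulli_half)
  finally show ?thesis by simp
qed

lemma prob_monochr:
  assumes "finite V" "V \<noteq> {}"
  shows "Pr (signs V) {s. monochr \<sigma> V s} = 2 * (1 / 2) ^ card V"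
proof -
  have "{s. monochr \<sigma> V s} = {s. \<forall>x\<in>V. s x = \<sigma> x} \<union> {s. \<forall>x\<in>V. s x = (\<not> \<sigma> x)}"
    by (auto simp: monochr_def)
  moreover have "{s. \<forall>x\<in>V. s x = \<sigma> x} \<inter> {s. \<forall>x\<in>V. s x = (\<not> \<sigma> x)} = {}"
    using assms(2) by auto
  ultimately show ?thesis
    using prob_signs_eq[OF assms(1), of \<sigma>] prob_signs_eq[OF assms(1), of "\<lambda>x. \<not> \<sigma> x"]
    by (simp add: measure_pmf.finite_measure_Union)
qed

text \<open>Signs that equal or oppose both assignments throughout \<open>V\<close> force the two
  assignments to agree everywhere or nowhere on \<open>V\<close>.\<close>

lemma prob_monochr_two:
  assumes "finite V" "V \<noteq> {}"
  shows "Pr (signs V) {s. monochr \<sigma> V s \<and> monochr \<tau> V s} \<le>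
    2 * (1 / 2) ^ card V * indicator {V. V \<subseteq> {x. \<sigma> x = \<tau> x} \<or> V \<subseteq> {x. \<sigma> x \<noteq> \<tau> x}} V"
proof (cases "V \<subseteq> {x. \<sigma> x = \<tau> x} \<or> V \<subseteq> {x. \<sigma> x \<noteq> \<tau> x}")
  case True
  have "Pr (signs V) {s. monochr \<sigma> V s \<and> monochr \<tau> V s} \<le>
      Pr (signs V) {s. monochr \<sigma> V s}"
    by (intro measure_pmf.finite_measure_mono) auto
  then show ?thesis
    using True prob_monochr[OF assms] by simp
next
  case False
  then have "{s. monochr \<sigma> V s \<and> monochr \<tau> V s} = {}"
    by (auto simp: monochr_def)
  then have "Pr (signs V) {s. monochr \<sigma> V s \<and> monochr \<tau> V s} = 0"
    by (simp only: measure_empty)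
  then show ?thesis
    using False by simp
qed

text \<open>The predicate \<open>P\<close> takes the whole map from assignments to truth values, so
  that the same statement serves one assignment and three simultaneous ones.\<close>

lemma prob_clause_signs:
  assumes "K \<le> n"
  shows "Pr (clause_pmf K n) {C. P (\<lambda>\<sigma>. sat_clause \<sigma> C)} =
    EV (pmf_of_set (kset K n))
      (\<lambda>V. Pr (signs V) {s. P (\<lambda>\<sigma>. \<not> monochr \<sigma> V s)})"
proof -
  let ?F = "{V :: nat fset. fset V \<subseteq> {..<n} \<and> fcard V = K}"
  have ne: "?F \<noteq> {}"
    using vset_fsets(1)[of n K] kset_ne(1)[OF assms] by blast
  have fin: "finite (set_pmf (pmf_of_set ?F))"
    using vset_fsets(3)[of n K] ne by (simp add: set_pmf_of_set)
  have eq: "pmf_of_set (kset K n) = map_pmf fset (pmf_of_set ?F)"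
    unfolding vset_fsets(1)[of n K, symmetric]
    using vset_fsets(2,3) ne by (intro map_pmf_of_set_inj[symmetric])
  have "clause_pmf K n = bind_pmf (pmf_of_set ?F)
      (\<lambda>V. map_pmf (\<lambda>s. Clause ((\<lambda>x. (x, s x)) |`| V) Unsigned) (signs (fset V)))"
    unfolding clause_pmf_def signs_def map_pmf_def ..
  then have "Pr (clause_pmf K n) {C. P (\<lambda>\<sigma>. sat_clause \<sigma> C)} =
      EV (pmf_of_set ?F) (\<lambda>V. Pr
        (map_pmf (\<lambda>s. Clause ((\<lambda>x. (x, s x)) |`| V) Unsigned) (signs (fset V))) {C. P (\<lambda>\<sigma>. sat_clause \<sigma> C)})"
    by (simp only: prob_bind_finite[OF fin])
  also have "\<dots> = EV (pmf_of_set ?F) (\<lambda>V. Pr (signs (fset V))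
      {s. P (\<lambda>\<sigma>. \<not> monochr \<sigma> (fset V) s)})"
    by (simp add: vimage_def sat_clause_iff)
  finally show ?thesis
    unfolding eq by simp
qed

lemma set_pmf_kset: "K \<le> n \<Longrightarrow> set_pmf (pmf_of_set (kset K n)) = kset K n"
  using kset_ne[of K n] by (simp add: set_pmf_of_set)

lemma kset_member:
  assumes "1 \<le> K" "V \<in> kset K n"
  shows "finite V" "V \<noteq> {}" "card V = K" "V \<subseteq> {..<n}"
  using assms finite_subset[of V "{..<n}"] by (auto simp: kset_def)

lemma prob_sat_clause:
  assumes "1 \<le> K" "K \<le> n"
  shows "Pr (clause_pmf K n) {C. sat_clause \<sigma> C} = 1 - 2 * (1 / 2) ^ K"
proof -
  let ?E = "EV (pmf_of_set (kset K n))"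
  have "Pr (clause_pmf K n) {C. sat_clause \<sigma> C} =
      ?E (\<lambda>V. Pr (signs V) {s. \<not> monochr \<sigma> V s})"
    by (rule prob_clause_signs[OF assms(2), of "\<lambda>f. f \<sigma>"])
  also have "\<dots> = ?E (\<lambda>V. 1 - 2 * (1 / 2) ^ K)"
  proof (rule integral_cong_AE)
    show "AE V in measure_pmf (pmf_of_set (kset K n)).
        Pr (signs V) {s. \<not> monochr \<sigma> V s} = 1 - 2 * (1 / 2) ^ K"
      unfolding AE_measure_pmf_iff set_pmf_kset[OF assms(2)]
    proof
      fix V assume "V \<in> kset K n"
      note V = kset_member[OF assms(1) this]
      have "{s. \<not> monochr \<sigma> V s} = space (measure_pmf (signs V)) - {s. monochr \<sigma> V s}"
        by auto
      then show "Pr (signs V) {s. \<not> monochr \<sigma> V s} = 1 - 2 * (1 / 2) ^ K"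
        using prob_monochr[OF V(1,2), of \<sigma>] V(3) by (simp only: measure_pmf.prob_compl sets_measure_pmf UNIV_I)
    qed
  qed auto
  finally show ?thesis by simp
qed

lemma all_less_3: "(\<forall>a<3. P (a :: nat)) \<longleftrightarrow> P 0 \<and> P 1 \<and> P 2"
  by (auto simp: numeral_3_eq_3 numeral_2_eq_2 less_Suc_eq)

text \<open>Inclusion--exclusion: the pair terms are small because two of the assignments must agree
  everywhere or nowhere on a clause that both of them violate.\<close>

lemma prob_sat_clause_three:
  fixes \<sigma> :: "nat \<Rightarrow> nat \<Rightarrow> bool"
  assumes K: "1 \<le> K" "K \<le> n" and lo: "0 \<le> lo" "0 \<le> hi"
    and pairs: "\<And>a b. a < b \<Longrightarrow> b < 3 \<Longrightarrow> lo * real n \<le> real (ham n (\<sigma> a) (\<sigma> b)) \<and> real (ham n (\<sigma> a) (\<sigma> b)) \<le> hi * real n"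
  shows "Pr (clause_pmf K n) {C. \<forall>a<3. sat_clause (\<sigma> a) C} \<le>
    1 - 6 * (1 / 2) ^ K * (1 - ((1 - lo) ^ K + hi ^ K))"
proof -
  let ?E = "EV (pmf_of_set (kset K n))"
  let ?x = "2 * (1 / 2) ^ K :: real"
  define I where "I a b V = (indicator {V. V \<subseteq> {x. \<sigma> a x = \<sigma> b x} \<or> V \<subseteq> {x. \<sigma> a x \<noteq> \<sigma> b x}} V :: real)" for a b V
  have n: "0 < n" using K by simp
  have fin: "finite (set_pmf (pmf_of_set (kset K n)))"
    using set_pmf_kset[OF K(2)] kset_ne(2) by simp
  have int: "integrable (measure_pmf (pmf_of_set (kset K n))) (f :: _ \<Rightarrow> real)" for f
    by (rule integrable_measure_pmf_finite[OF fin])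
  have EI: "?E (I a b) \<le> (1 - lo) ^ K + hi ^ K" if ab: "a < b" "b < 3" for a b
  proof -
    let ?D = "{i. i < n \<and> \<sigma> a i \<noteq> \<sigma> b i}"
    let ?S = "{..<n} - ?D"
    have cD: "real (card ?D) = real (ham n (\<sigma> a) (\<sigma> b))"
      by (simp add: ham_def)
    have cS: "real (card ?S) = real n - real (ham n (\<sigma> a) (\<sigma> b))"
      using ham_le[of n "\<sigma> a" "\<sigma> b"] unfolding ham_def by (subst card_Diff_subset) (auto simp: of_nat_diff)
    have "?E (I a b) \<le> ?E (\<lambda>V. indicator {V. V \<subseteq> ?S} V + indicator {V. V \<subseteq> ?D} V)"
    proof (rule integral_mono_AE[OF int int])
      show "AE V in measure_pmf (pmf_of_set (kset K n)).
          I a b V \<le> indicator {V. V \<subseteq> ?S} V + indicator {V. V \<subseteq> ?D} V"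
        unfolding AE_measure_pmf_iff set_pmf_kset[OF K(2)]
        by (auto simp: I_def indicator_def kset_def)
    qed
    also have "\<dots> = Pr (pmf_of_set (kset K n)) {V. V \<subseteq> ?S} +
        Pr (pmf_of_set (kset K n)) {V. V \<subseteq> ?D}"
      using int by simp
    also have "\<dots> \<le> (real (card ?S) / real n) ^ K + (real (card ?D) / real n) ^ K"
      by (intro add_mono prob_kset_subset K n) auto
    also have "\<dots> \<le> (1 - lo) ^ K + hi ^ K"
    proof (intro add_mono power_mono)
      show "real (card ?S) / real n \<le> 1 - lo"
        unfolding cS using pairs[OF ab] n by (simp add: field_simps)
      show "real (card ?D) / real n \<le> hi"
        unfolding cD using pairs[OF ab] n by (simp add: field_simps)
    qed auto
    finally show ?thesis .
  qed
  have "Pr (clause_pmf K n) {C. \<forall>a<3. sat_clause (\<sigma> a) C} =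
      ?E (\<lambda>V. Pr (signs V) {s. \<forall>a<3. \<not> monochr (\<sigma> a) V s})"
    by (rule prob_clause_signs[OF K(2), of "\<lambda>f. \<forall>a<3. f (\<sigma> a)"])
  also have "\<dots> \<le> ?E (\<lambda>V. 1 - 3 * ?x + ?x * (I 0 1 V + I 0 2 V + I 1 2 V))"
  proof (rule integral_mono_AE[OF int int])
    show "AE V in measure_pmf (pmf_of_set (kset K n)).
        Pr (signs V) {s. \<forall>a<3. \<not> monochr (\<sigma> a) V s} \<le>
        1 - 3 * ?x + ?x * (I 0 1 V + I 0 2 V + I 1 2 V)"
      unfolding AE_measure_pmf_iff set_pmf_kset[OF K(2)]
    proof
      fix V assume "V \<in> kset K n"
      note V = kset_member[OF K(1) this]
      let ?P = "Pr (signs V)"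
      let ?Es = "EV (signs V)"
      let ?M = "\<lambda>a. {s. monochr (\<sigma> a) V s}"
      have fs: "integrable (measure_pmf (signs V)) (f :: _ \<Rightarrow> real)" for f
        by (rule integrable_measure_pmf_finite[OF finite_set_signs[OF V(1)]])
      have "?P {s. \<forall>a<3. \<not> monochr (\<sigma> a) V s} = ?Es (indicator {s. \<forall>a<3. \<not> monochr (\<sigma> a) V s})"
        by simp
      \<comment> \<open>Pointwise Bonferroni inequality: stopping after the pair terms gives an
        upper bound.\<close>
      also have "\<dots> \<le> ?Es (\<lambda>s. 1 - indicator (?M 0) s - indicator (?M 1) s - indicator (?M 2) s +
          indicator (?M 0 \<inter> ?M 1) s + indicator (?M 0 \<inter> ?M 2) s + indicator (?M 1 \<inter> ?M 2) s)"
        by (intro integral_mono fs) (auto simp: indicator_def all_less_3)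
      also have "\<dots> = 1 - ?P (?M 0) - ?P (?M 1) - ?P (?M 2) + ?P (?M 0 \<inter> ?M 1) + ?P (?M 0 \<inter> ?M 2) + ?P (?M 1 \<inter> ?M 2)"
        using fs by simp
      also have "\<dots> \<le> 1 - ?x - ?x - ?x + ?x * I 0 1 V + ?x * I 0 2 V + ?x * I 1 2 V"
        using prob_monochr[OF V(1,2)] prob_monochr_two[OF V(1,2), of "\<sigma> 0" "\<sigma> 1"]
          prob_monochr_two[OF V(1,2), of "\<sigma> 0" "\<sigma> 2"] prob_monochr_two[OF V(1,2), of "\<sigma> 1" "\<sigma> 2"] V(3)
        unfolding I_def by (simp add: Collect_conj_eq)
      finally show "?P {s. \<forall>a<3. \<not> monochr (\<sigma> a) V s} \<le> 1 - 3 * ?x + ?x * (I 0 1 V + I 0 2 V + I 1 2 V)"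
        by (simp add: algebra_simps)
    qed
  qed
  also have "\<dots> = 1 - 3 * ?x + ?x * (?E (I 0 1) + ?E (I 0 2) + ?E (I 1 2))"
    using int by simp
  also have "\<dots> \<le> 1 - 3 * ?x + ?x * (3 * ((1 - lo) ^ K + hi ^ K))"
    using EI[of 0 1] EI[of 0 2] EI[of 1 2] by (intro add_left_mono mult_left_mono) auto
  also have "\<dots> = 1 - 6 * (1 / 2) ^ K * (1 - ((1 - lo) ^ K + hi ^ K))"
    by (simp add: algebra_simps)
  finally show ?thesis .
qed

text \<open>Group the \<open>3 * m\<close> independent clauses by index. At a shared index one
  clause must satisfy all three assignments, at any other index three clauses must satisfy one each;
  \<open>q\<close> bounds both probabilities. The guard \<open>0 < t\<close> is there because lower
  bounds on the distances are available only when clauses are shared.\<close>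

lemma prob_copies_satisfied:
  fixes \<sigma> :: "nat \<Rightarrow> nat \<Rightarrow> bool"
  assumes K: "1 \<le> K" "K \<le> n" and t: "t \<le> m"
    and q: "(1 - 2 * (1 / 2) ^ K) ^ 3 \<le> q"
      "0 < t \<Longrightarrow> Pr (clause_pmf K n) {C. \<forall>a<3. sat_clause (\<sigma> a) C} \<le> q"
  shows "Pr (fam K n {..<3 * m}) {ys. \<forall>a<3. satisfies (\<sigma> a) (copy m t a ys)} \<le> q ^ m"
proof -
  let ?p = "Pr (clause_pmf K n)"
  define B where "B p = {C. \<forall>a<3. \<forall>j<m. pos m t a j = p \<longrightarrow> sat_clause (\<sigma> a) C}" for p
  have x: "0 \<le> 1 - 2 * (1 / 2 :: real) ^ K"
    using K power_decreasing[of 1 K "1 / 2 :: real"] by simp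
  have "{ys. \<forall>a<3. satisfies (\<sigma> a) (copy m t a ys)} \<subseteq> Pi {..<3 * m} B"
    by (auto simp: satisfies_def copy_def B_def Pi_def)
  then have "Pr (fam K n {..<3 * m}) {ys. \<forall>a<3. satisfies (\<sigma> a) (copy m t a ys)} \<le>
      Pr (fam K n {..<3 * m}) (Pi {..<3 * m} B)"
    by (intro measure_pmf.finite_measure_mono) auto
  also have "\<dots> = (\<Prod>p<3 * m. ?p (B p))"
    by (simp add: measure_Pi_pmf_Pi)
  also have "\<dots> = (\<Prod>a<3. \<Prod>p\<in>{a * m..<a * m + m}. ?p (B p))"
    by (simp add: prod.nat_group)
  also have "\<dots> = (\<Prod>a<3. \<Prod>j<m. ?p (B (a * m + j)))"
  proof (rule prod.cong[OF refl])
    fix a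
    show "(\<Prod>p\<in>{a * m..<a * m + m}. ?p (B p)) = (\<Prod>j<m. ?p (B (a * m + j)))"
      using prod.shift_bounds_nat_ivl[of "\<lambda>p. ?p (B p)" 0 "a * m" m] by (simp add: atLeast0LessThan add.commute)
  qed
  also have "\<dots> = (\<Prod>j<m. \<Prod>a<3. ?p (B (a * m + j)))"
    by (rule prod.swap)
  also have "\<dots> \<le> (\<Prod>j<m. q)"
  proof (rule prod_mono, intro conjI)
    fix j assume "j \<in> {..<m}"
    then have j: "j < m" by simp
    show "0 \<le> (\<Prod>a<3. ?p (B (a * m + j)))"
      by (intro prod_nonneg) auto
    show "(\<Prod>a<3. ?p (B (a * m + j))) \<le> q"
    proof (cases "j < t")
      case True
      have "B j \<subseteq> {C. \<forall>a<3. sat_clause (\<sigma> a) C}"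
        using True j by (force simp: B_def pos_def)
      then have "?p (B j) \<le> ?p {C. \<forall>a<3. sat_clause (\<sigma> a) C}"
        by (intro measure_pmf.finite_measure_mono) auto
      also have "\<dots> \<le> q"
        using q(2) True by simp
      finally have 0: "?p (B j) \<le> q" .
      \<comment> \<open>At a shared index the whole gain comes from position \<open>j\<close>; the
        other two factors are bounded by 1.\<close>
      have "(\<Prod>a<3. ?p (B (a * m + j))) = ?p (B j) * (?p (B (m + j)) * ?p (B (m + m + j)))"
        by (simp add: numeral_3_eq_3 lessThan_Suc mult_ac)
      also have "\<dots> \<le> ?p (B j) * (1 * 1)"
        by (intro mult_left_mono mult_mono measure_pmf.prob_le_1) auto
      finally show ?thesis using 0 by simp
    next
      case False
      have "?p (B (a * m + j)) \<le> 1 - 2 * (1 / 2) ^ K" if "a < 3" for a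
      proof -
        have "B (a * m + j) \<subseteq> {C. sat_clause (\<sigma> a) C}"
          using False j that by (auto simp: B_def pos_def)
        then have "?p (B (a * m + j)) \<le> ?p {C. sat_clause (\<sigma> a) C}"
          by (intro measure_pmf.finite_measure_mono) auto
        then show ?thesis
          using prob_sat_clause[OF K] by simp
      qed
      then have "(\<Prod>a<3. ?p (B (a * m + j))) \<le> (\<Prod>a<3::nat. 1 - 2 * (1 / 2) ^ K)"
        by (intro prod_mono) auto
      also have "\<dots> \<le> q"
        using q(1) by simp
      finally show ?thesis .
    qed
  qed
  also have "\<dots> = q ^ m" by simp
  finally show ?thesis .
qed

section \<open>Counting triples of close assignments\<close>

lemma card_small_sets:
  fixes \<beta> y :: real
  assumes "0 < y" "y \<le> 1" "0 \<le> \<beta>"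
  shows "real (card {D. D \<subseteq> {..<n} \<and> real (card D) \<le> \<beta> * real n}) \<le> exp (real n * (y - \<beta> * ln y))"
proof -
  let ?S = "{D. D \<subseteq> {..<n} \<and> real (card D) \<le> \<beta> * real n}"
  have "real (card ?S) = (\<Sum>D\<in>?S. 1)" by simp
  \<comment> \<open>Exponential weighting: since \<open>y \<le> 1\<close> and
    \<open>card D \<le> \<beta> * n\<close>, the power \<open>y powr (card D - \<beta> * n)\<close>
    is at least 1.\<close>
  also have "\<dots> \<le> (\<Sum>D\<in>?S. y ^ card D * exp (- \<beta> * real n * ln y))"
  proof (rule sum_mono)
    fix D assume "D \<in> ?S"
    then have "(real (card D) - \<beta> * real n) * ln y \<ge> 0"
      using assms by (intro mult_nonpos_nonpos) auto
    then have "1 \<le> exp ((real (card D) - \<beta> * real n) * ln y)"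
      by simp
    also have "\<dots> = exp (real (card D) * ln y) * exp (- \<beta> * real n * ln y)"
      by (simp add: algebra_simps flip: exp_add)
    also have "exp (real (card D) * ln y) = y ^ card D"
      using assms by (simp add: exp_of_nat_mult)
    finally show "1 \<le> y ^ card D * exp (- \<beta> * real n * ln y)" .
  qed
  also have "\<dots> \<le> (\<Sum>D\<in>Pow {..<n}. y ^ card D * exp (- \<beta> * real n * ln y))"
    using assms by (intro sum_mono2) auto
  also have "\<dots> = (\<Sum>D\<in>Pow {..<n}. y ^ card D) * exp (- \<beta> * real n * ln y)"
    by (simp add: sum_distrib_right)
  also have "(\<Sum>D\<in>Pow {..<n}. y ^ card D) = (y + 1) ^ n"
    using prod_add[of "{..<n}" "\<lambda>_. y" "\<lambda>_. 1"] by (simp)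
  also have "\<dots> \<le> exp y ^ n"
    using assms exp_ge_add_one_self[of y] by (intro power_mono) (auto simp: add.commute)
  also have "exp y ^ n * exp (- \<beta> * real n * ln y) = exp (real n * (y - \<beta> * ln y))"
    by (simp add: algebra_simps flip: exp_of_nat_mult exp_add)
  finally show ?thesis by simp
qed

lemma sat_clause_cong: "(\<And>x. x \<in> vars C \<Longrightarrow> \<sigma> x = \<tau> x) \<Longrightarrow> sat_clause \<sigma> C \<longleftrightarrow> sat_clause \<tau> C"
proof -
  assume a: "\<And>x. x \<in> vars C \<Longrightarrow> \<sigma> x = \<tau> x"
  have "lit_val \<sigma> l \<longleftrightarrow> lit_val \<tau> l" if "l |\<in>| lits C" for l
    using a[of "fst l"] that by (auto simp: lit_val_def vars_def)
  then show ?thesis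
    unfolding sat_clause_def by (cases "csign C") auto
qed

lemma satisfies_cong:
  assumes "\<And>C. C \<in> set \<Phi> \<Longrightarrow> vars C \<subseteq> {..<n}" "\<And>i. i < n \<Longrightarrow> \<sigma> i = \<tau> i"
  shows "satisfies \<sigma> \<Phi> \<longleftrightarrow> satisfies \<tau> \<Phi>"
proof -
  have "sat_clause \<sigma> C \<longleftrightarrow> sat_clause \<tau> C" if "C \<in> set \<Phi>" for C
    using assms(1)[OF that] assms(2) by (intro sat_clause_cong) auto
  then show ?thesis
    unfolding satisfies_def by blast
qed

lemma ham_cong: "(\<And>i. i < n \<Longrightarrow> \<sigma> i = \<sigma>' i \<and> \<tau> i = \<tau>' i) \<Longrightarrow> ham n \<sigma> \<tau> = ham n \<sigma>' \<tau>'"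
  unfolding ham_def by (rule arg_cong[of _ _ card]) auto

text \<open>For \<open>t = 0\<close> the formulas are independent and the outputs may even coincide,
  so a lower bound is imposed only when clauses are shared.\<close>

definition spread :: "nat \<Rightarrow> nat \<Rightarrow> (nat \<Rightarrow> nat \<Rightarrow> bool) \<Rightarrow> bool" where
  "spread n t \<sigma> \<longleftrightarrow> (\<forall>a b. a < b \<longrightarrow> b < 3 \<longrightarrow> real (ham n (\<sigma> a) (\<sigma> b)) \<le> real n / 50 \<and>
    (0 < t \<longrightarrow> real n / 100 \<le> real (ham n (\<sigma> a) (\<sigma> b))))"

lemma ln_32_le: "ln 32 \<le> (3473 / 1000 :: real)"
proof -
  have "ln (32 :: real) = 5 * ln 2"
    using ln_realpow[of 2 5] by simp
  then show ?thesis
    using ln2_le_25_over_36 by simp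
qed

text \<open>Union bound over triples. One assignment is free and the other two differ from it in few
  places, giving at most \<open>2 ^ n * exp (202 / 1000 * n)\<close> triples. Each clause costs
  almost three times the violation probability \<open>x\<close> of a single assignment.\<close>

lemma prob_spread_triples:
  assumes K: "1000 \<le> K" "K \<le> n" and t: "t \<le> m"
    and d: "2 powr (real K - 2) * ln 2 < d" "d * real n - 1 \<le> real m"
  shows "Pr (fam K n {..<3 * m})
    {ys. \<exists>\<sigma>. spread n t \<sigma> \<and> (\<forall>a<3. satisfies (\<sigma> a) (copy m t a ys))} \<le> exp (3 - 3 / 100 * real n)"
proof -
  let ?P = "Pr (fam K n {..<3 * m})"
  let ?S = "{D. D \<subseteq> {..<n} \<and> real (card D) \<le> 1 / 50 * real n}"
  define x where "x = 2 * (1 / 2 :: real) ^ K"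
  define q where "q = 1 - 27 / 10 * x"
  \<comment> \<open>A triple is coded by its first assignment and by the two sets on which the
    others differ from it, each of size at most \<open>n / 50\<close>.\<close>
  define trip where "trip T = (\<lambda>a i. case T of (A, D, D') \<Rightarrow>
    if a = 0 then i \<in> A else if a = Suc 0 then (i \<in> A) \<noteq> (i \<in> D) else (i \<in> A) \<noteq> (i \<in> D'))"
    for T :: "nat set \<times> nat set \<times> nat set"
  let ?X = "{T \<in> Pow {..<n} \<times> ?S \<times> ?S. spread n t (trip T)}"
  let ?ev = "\<lambda>\<sigma>. {ys. \<forall>a<3. satisfies (\<sigma> a) (copy m t a ys)}"
  have K1: "1 \<le> K" and n: "0 < n" using K by auto
  have pow_small: "(1 / 2 :: real) ^ K \<le> 1 / 32"
  proof -
    have "(1 / 2 :: real) ^ K \<le> (1 / 2) ^ 5"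
      using K by (intro power_decreasing) auto
    also have "\<dots> = 1 / 32" by (simp add: power_divide)
    finally show ?thesis .
  qed
  have x: "0 < x" "x \<le> 1 / 16"
    using pow_small by (auto simp: x_def)
  have q0: "0 \<le> q"
    using x by (simp add: q_def)
  have finS: "finite ?S"
    by (rule finite_subset[of _ "Pow {..<n}"]) auto
  have finX: "finite ?X"
    by (rule finite_subset[of _ "Pow {..<n} \<times> ?S \<times> ?S"]) (use finS in auto)
  \<comment> \<open>At an unshared index the loss \<open>x * x * (3 - x)\<close> is at most
    \<open>3 * x / 16\<close>, which is below the permitted \<open>3 * x / 10\<close>.\<close>
  have q3: "(1 - 2 * (1 / 2) ^ K) ^ 3 \<le> q"
  proof -
    have "(1 - x) ^ 3 = 1 - 3 * x + x * x * (3 - x)"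
      by (simp add: power3_eq_cube algebra_simps)
    also have "x * x * (3 - x) \<le> x * (1 / 16) * 3"
      using x by (intro mult_mono) auto
    finally have "(1 - x) ^ 3 \<le> q"
      using x unfolding q_def by linarith
    then show ?thesis
      by (simp add: x_def)
  qed
  \<comment> \<open>The source of the bound 1000 on \<open>K\<close>: minimal distance
    \<open>n / 100\<close> makes full agreement on a clause unlikely, since
    \<open>(99 / 100) ^ 1000 \<le> exp (- 10)\<close>. With overlap at most 1/10 the factor 3
    becomes 27/10.\<close>
  have rest: "(1 - 1 / 100) ^ K + (1 / 50) ^ K \<le> (1 / 10 :: real)"
  proof -
    have "(1 - 1 / 100 :: real) ^ K \<le> (1 - 1 / 100) ^ 1000"
      using K by (intro power_decreasing) auto
    also have "\<dots> \<le> exp (- 1 / 100) ^ 1000"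
      using exp_ge_add_one_self[of "- 1 / 100 :: real"] by (intro power_mono) auto
    also have "\<dots> = exp (- 10)"
      by (simp flip: exp_of_nat_mult)
    also have "\<dots> = 1 / exp 10"
      by (simp add: exp_minus field_simps)
    also have "\<dots> \<le> 1 / 11"
      using exp_ge_add_one_self[of "10 :: real"] by (intro divide_left_mono) auto
    finally have 1: "(1 - 1 / 100 :: real) ^ K \<le> 1 / 11" .
    have "(1 / 50 :: real) ^ K \<le> (1 / 50) ^ 2"
      using K by (intro power_decreasing) auto
    also have "\<dots> = 1 / 2500" by (simp add: power2_eq_square)
    finally have 2: "(1 / 50 :: real) ^ K \<le> 1 / 2500" .
    show ?thesis
      using 1 2 by linarith
  qed
  have each: "?P (?ev \<sigma>) \<le> q ^ m" if sp: "spread n t \<sigma>" for \<sigma>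
  proof (rule prob_copies_satisfied[OF K1 K(2) t q3])
    assume "0 < t"
    have "Pr (clause_pmf K n) {C. \<forall>a<3. sat_clause (\<sigma> a) C} \<le>
        1 - 6 * (1 / 2) ^ K * (1 - ((1 - 1 / 100) ^ K + (1 / 50) ^ K))"
    proof (rule prob_sat_clause_three[OF K1 K(2)])
      fix a b :: nat assume "a < b" "b < 3"
      then show "1 / 100 * real n \<le> real (ham n (\<sigma> a) (\<sigma> b)) \<and> real (ham n (\<sigma> a) (\<sigma> b)) \<le> 1 / 50 * real n"
        using sp \<open>0 < t\<close> unfolding spread_def by force
    qed auto
    also have "\<dots> \<le> 1 - 6 * (1 / 2) ^ K * (1 - 1 / 10)"
      using rest by (intro diff_left_mono mult_left_mono) auto
    also have "\<dots> = q"
      by (simp add: q_def x_def)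
    finally show "Pr (clause_pmf K n) {C. \<forall>a<3. sat_clause (\<sigma> a) C} \<le> q" .
  qed
  have "?P {ys. \<exists>\<sigma>. spread n t \<sigma> \<and> (\<forall>a<3. satisfies (\<sigma> a) (copy m t a ys))} =
      ?P ({ys. \<exists>\<sigma>. spread n t \<sigma> \<and> (\<forall>a<3. satisfies (\<sigma> a) (copy m t a ys))} \<inter> set_pmf (fam K n {..<3 * m}))"
    by (simp add: measure_Int_set_pmf)
  also have "\<dots> \<le> ?P (\<Union>T\<in>?X. ?ev (trip T))"
  proof (intro measure_pmf.finite_measure_mono subsetI)
    fix ys
    assume "ys \<in> {ys. \<exists>\<sigma>. spread n t \<sigma> \<and> (\<forall>a<3. satisfies (\<sigma> a) (copy m t a ys))} \<inter> set_pmf (fam K n {..<3 * m})"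
    then obtain \<sigma> where ys: "ys \<in> set_pmf (fam K n {..<3 * m})"
      and \<sigma>: "spread n t \<sigma>" "\<And>a. a < 3 \<Longrightarrow> satisfies (\<sigma> a) (copy m t a ys)"
      by auto
    define T where "T = ({i. i < n \<and> \<sigma> 0 i}, {i. i < n \<and> \<sigma> 0 i \<noteq> \<sigma> 1 i}, {i. i < n \<and> \<sigma> 0 i \<noteq> \<sigma> 2 i})"
    have eq: "trip T a i = \<sigma> a i" if "a < 3" "i < n" for a i
    proof -
      have "a = 0 \<or> a = 1 \<or> a = 2" using that by auto
      then show ?thesis using that by (auto simp: trip_def T_def)
    qed
    have "spread n t (trip T)"
      unfolding spread_def
    proof (intro allI impI)
      fix a b :: nat assume ab: "a < b" "b < 3"
      then have "ham n (trip T a) (trip T b) = ham n (\<sigma> a) (\<sigma> b)"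
        using eq by (intro ham_cong) auto
      then show "real (ham n (trip T a) (trip T b)) \<le> real n / 50 \<and>
          (0 < t \<longrightarrow> real n / 100 \<le> real (ham n (trip T a) (trip T b)))"
        using \<sigma>(1) ab unfolding spread_def by simp
    qed
    moreover have "T \<in> Pow {..<n} \<times> ?S \<times> ?S"
    proof -
      have "real (ham n (\<sigma> 0) (\<sigma> 1)) \<le> real n / 50" "real (ham n (\<sigma> 0) (\<sigma> 2)) \<le> real n / 50"
        using \<sigma>(1) unfolding spread_def by auto
      then show ?thesis
        by (auto simp: T_def ham_def)
    qed
    moreover have "satisfies (trip T a) (copy m t a ys)" if "a < 3" for a
    proof -
      have "vars C \<subseteq> {..<n}" if C: "C \<in> set (copy m t a ys)" for C
      proof -
        obtain j where "j < m" "C = ys (pos m t a j)"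
          using C by (auto simp: copy_def)
        then show ?thesis
          using vars_fam(1)[OF K(2) ys finite_lessThan, of "pos m t a j"] pos_less[of j m a t] \<open>a < 3\<close>
          by simp
      qed
      from satisfies_cong[OF this eq[OF that]] show ?thesis
        using \<sigma>(2)[OF that] by simp
    qed
    ultimately show "ys \<in> (\<Union>T\<in>?X. ?ev (trip T))"
      by auto
  qed simp
  also have "\<dots> \<le> (\<Sum>T\<in>?X. ?P (?ev (trip T)))"
    using finX by (intro measure_pmf.finite_measure_subadditive_finite) auto
  also have "\<dots> \<le> (\<Sum>T\<in>?X. q ^ m)"
    using each by (intro sum_mono) auto
  also have "\<dots> = real (card ?X) * q ^ m"
    by simp
  also have "\<dots> \<le> (2 ^ n * (real (card ?S) * real (card ?S))) * q ^ m"
  proof (rule mult_right_mono)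
    have "card ?X \<le> card (Pow {..<n} \<times> ?S \<times> ?S)"
      using finS by (intro card_mono) auto
    also have "\<dots> = 2 ^ n * (card ?S * card ?S)"
      by (simp add: card_cartesian_product card_Pow)
    finally have "real (card ?X) \<le> real (2 ^ n * (card ?S * card ?S))"
      by (simp only: of_nat_le_iff)
    then show "real (card ?X) \<le> 2 ^ n * (real (card ?S) * real (card ?S))"
      by simp
  qed (use q0 in simp)
  also have "\<dots> \<le> (exp (real n * ln 2) * (exp (real n * (101 / 1000)) * exp (real n * (101 / 1000)))) *
      exp (3 - real n * (135 / 100 * ln 2))"
  proof (intro mult_mono)
    show "2 ^ n \<le> exp (real n * ln 2)"
      by (simp add: exp_of_nat_mult)
    \<comment> \<open>The optimal weight would be \<open>y = 1 / 50\<close>; the nearby power of two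
      1/32 reduces the logarithm to \<open>5 * ln 2\<close>.\<close>
    have "real (card ?S) \<le> exp (real n * (1 / 32 - 1 / 50 * ln (1 / 32)))"
      by (rule card_small_sets) auto
    also have "\<dots> \<le> exp (real n * (101 / 1000))"
    proof -
      have "1 / 32 - 1 / 50 * ln (1 / 32) \<le> (101 / 1000 :: real)"
        using ln_32_le by (simp add: ln_div)
      then have "real n * (1 / 32 - 1 / 50 * ln (1 / 32)) \<le> real n * (101 / 1000)"
        by (rule mult_left_mono) simp
      then show ?thesis
        by (simp only: exp_le_cancel_iff)
    qed
    finally show S: "real (card ?S) \<le> exp (real n * (101 / 1000))" .
    then show "real (card ?S) \<le> exp (real n * (101 / 1000))" .
    \<comment> \<open>The density hypothesis enters here, as \<open>x\<close> times
      \<open>2 ^ (K - 2)\<close> is 1/2. Rounding the number of clauses down costs at most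
      \<open>27 / 10 * x\<close>, which the summand 3 in the exponent absorbs.\<close>
    have "ln 2 / 2 \<le> x * d"
    proof -
      have "2 powr (real K - 2) = 2 ^ K / 4"
        by (simp add: powr_diff powr_realpow)
      then have "ln 2 / 2 = x * (2 powr (real K - 2) * ln 2)"
        by (simp add: x_def power_one_over field_simps)
      also have "\<dots> \<le> x * d"
        using d(1) x by (intro mult_left_mono) auto
      finally show ?thesis .
    qed
    then have "real n * (ln 2 / 2) \<le> real n * (x * d)"
      by (intro mult_left_mono) auto
    moreover have "x * (d * real n - 1) \<le> x * real m"
      using d(2) x by (intro mult_left_mono) auto
    ultimately have "real n * (ln 2 / 2) - x \<le> x * real m"
      by (simp add: algebra_simps)
    then have le: "real m * (- (27 / 10 * x)) \<le> 3 - real n * (135 / 100 * ln 2)"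
      using x by (simp add: algebra_simps)
    have "q ^ m \<le> exp (- (27 / 10 * x)) ^ m"
      using exp_ge_add_one_self[of "- (27 / 10 * x)"] q0 by (intro power_mono) (auto simp: q_def)
    also have "\<dots> = exp (real m * (- (27 / 10 * x)))"
      by (simp only: exp_of_nat_mult)
    also have "\<dots> \<le> exp (3 - real n * (135 / 100 * ln 2))"
      using le by simp
    finally show "q ^ m \<le> exp (3 - real n * (135 / 100 * ln 2))" .
  qed (use q0 in auto)
  also have "\<dots> = exp (3 - real n * (35 / 100 * ln 2 - 202 / 1000))"
    by (simp add: algebra_simps flip: exp_add)
  also have "\<dots> \<le> exp (3 - 3 / 100 * real n)"
  proof -
    have "3 / 100 \<le> 35 / 100 * ln 2 - (202 / 1000 :: real)"
      using ln2_ge_two_thirds by simp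
    then have "real n * (3 / 100) \<le> real n * (35 / 100 * ln 2 - 202 / 1000)"
      by (intro mult_left_mono) auto
    then show ?thesis by simp
  qed
  finally show ?thesis .
qed

section \<open>Reduction to a deterministic sequential local rule\<close>

lemma filter_positions:
  "\<exists>\<phi> :: nat \<Rightarrow> nat. inj \<phi> \<and>
    \<phi> ` {..<length (filter P xs)} = {j. j < length xs \<and> P (xs ! j)} \<and>
    (\<forall>i<length (filter P xs). filter P xs ! i = xs ! \<phi> i)"
proof -
  define ps where "ps = filter (\<lambda>j. P (xs ! j)) [0..<length xs]"
  have eq: "filter P xs = map ((!) xs) ps"
    using filter_map[of P "(!) xs" "[0..<length xs]"] by (simp add: ps_def map_nth o_def)
  then have len: "length (filter P xs) = length ps"
    by simp
  have set_ps: "set ps = {j. j < length xs \<and> P (xs ! j)}"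
    by (auto simp: ps_def)
  have dist: "distinct ps"
    by (simp add: ps_def)
  \<comment> \<open>Indices past the filtered list are sent beyond \<open>xs\<close>. Injectivity on
    all of \<open>nat\<close> is what permits reindexing the infinite seed.\<close>
  define \<phi> where "\<phi> i = (if i < length ps then ps ! i else length xs + i)" for i
  have lt: "ps ! i < length xs" if "i < length ps" for i
    using nth_mem[OF that] set_ps by auto
  have "inj \<phi>"
    using dist lt by (auto simp: inj_on_def \<phi>_def nth_eq_iff_index_eq dest!: lt)
  moreover have "\<phi> ` {..<length ps} = set ps"
    by (auto simp: \<phi>_def in_set_conv_nth)
  moreover have "filter P xs ! i = xs ! \<phi> i" if "i < length (filter P xs)" for i
    using that by (simp add: eq \<phi>_def)
  ultimately show ?thesis
    using len set_ps by (intro exI[of _ \<phi>]) simp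
qed

context
  fixes r :: nat and \<Psi> :: inst and x :: nat and \<phi> :: "nat \<Rightarrow> nat" and u :: messages
  assumes inj: "inj \<phi>"
    and im: "\<phi> ` {..<length (view r \<Psi> x)} = {j. j < length \<Psi> \<and> vars (\<Psi> ! j) \<inter> nbr (set \<Psi>) r x \<noteq> {}}"
    and nth: "\<And>i. i < length (view r \<Psi> x) \<Longrightarrow> view r \<Psi> x ! i = \<Psi> ! \<phi> i"
begin

lemma view_position:
  assumes "j < length \<Psi>" "y \<in> vars (\<Psi> ! j)" "y \<in> nbr (set \<Psi>) r x"
  obtains i where "i < length (view r \<Psi> x)" "\<phi> i = j"
proof -
  have "vars (\<Psi> ! j) \<inter> nbr (set \<Psi>) r x \<noteq> {}"
    using assms(2,3) by blast
  then have "j \<in> \<phi> ` {..<length (view r \<Psi> x)}"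
    unfolding im using assms(1) by simp
  then show ?thesis
    using that by auto
qed

lemma lits_vars: "(y, b) |\<in>| lits C \<Longrightarrow> y \<in> vars C"
  unfolding vars_def by force

lemma image_pol:
  assumes "j < length (view r \<Psi> x)" "y \<in> vars (\<Psi> ! \<phi> j)" "y \<in> nbr (set \<Psi>) r x"
  shows "same_pol \<Psi> y (\<phi> j) = \<phi> ` same_pol (view r \<Psi> x) y j"
    and "opp_pol \<Psi> y (\<phi> j) = \<phi> ` opp_pol (view r \<Psi> x) y j"
proof -
  have lt: "\<phi> i < length \<Psi>" if "i < length (view r \<Psi> x)" for i
    using im that by blast
  have eq: "\<phi> i = \<phi> i' \<longleftrightarrow> i = i'" for i i'
    using inj by (auto simp: inj_on_def)
  have *: "{i. i < length \<Psi> \<and> i \<noteq> \<phi> j \<and> (\<exists>b. (y, b) |\<in>| lits (\<Psi> ! i) \<and> P b)} =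
      \<phi> ` {i. i < length (view r \<Psi> x) \<and> i \<noteq> j \<and> (\<exists>b. (y, b) |\<in>| lits (view r \<Psi> x ! i) \<and> P b)}" for P
  proof (intro set_eqI iffI)
    fix i assume "i \<in> {i. i < length \<Psi> \<and> i \<noteq> \<phi> j \<and> (\<exists>b. (y, b) |\<in>| lits (\<Psi> ! i) \<and> P b)}"
    then obtain b where i: "i < length \<Psi>" "i \<noteq> \<phi> j" "(y, b) |\<in>| lits (\<Psi> ! i)" "P b" by blast
    then obtain i' where "i' < length (view r \<Psi> x)" "\<phi> i' = i"
      using view_position[OF _ _ assms(3)] lits_vars by metis
    with i show "i \<in> \<phi> ` {i. i < length (view r \<Psi> x) \<and> i \<noteq> j \<and> (\<exists>b. (y, b) |\<in>| lits (view r \<Psi> x ! i) \<and> P b)}"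
      using nth by force
  qed (use lt eq nth in auto)
  show "same_pol \<Psi> y (\<phi> j) = \<phi> ` same_pol (view r \<Psi> x) y j"
    unfolding same_pol_def nth[OF assms(1)] by (rule *)
  show "opp_pol \<Psi> y (\<phi> j) = \<phi> ` opp_pol (view r \<Psi> x) y j"
    unfolding opp_pol_def nth[OF assms(1)] by (rule *)
qed

lemma image_occ:
  assumes "y \<in> nbr (set \<Psi>) r x"
  shows "occ \<Psi> y b = \<phi> ` occ (view r \<Psi> x) y b"
proof (intro set_eqI iffI)
  fix i assume "i \<in> occ \<Psi> y b"
  then have i: "i < length \<Psi>" "(y, b) |\<in>| lits (\<Psi> ! i)" by (auto simp: occ_def)
  then obtain i' where "i' < length (view r \<Psi> x)" "\<phi> i' = i"
    using view_position[OF _ _ assms] lits_vars by metis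
  with i show "i \<in> \<phi> ` occ (view r \<Psi> x) y b"
    using nth by (force simp: occ_def)
next
  fix i assume "i \<in> \<phi> ` occ (view r \<Psi> x) y b"
  then show "i \<in> occ \<Psi> y b"
    using im nth by (auto simp: occ_def)
qed

text \<open>Each round uses up one unit of radius: after \<open>s\<close> rounds messages agree for
  clauses meeting the ball of radius \<open>r - s\<close>. The view has its own positions, so the
  initial messages are carried along \<open>\<phi>\<close>.\<close>

lemma sp_run_view:
  assumes "s \<le> r" "j < length (view r \<Psi> x)" "vars (\<Psi> ! \<phi> j) \<inter> nbr (set \<Psi>) (r - s) x \<noteq> {}"
    "y \<in> vars (\<Psi> ! \<phi> j)"
  shows "sp_run s (view r \<Psi> x) (\<lambda>k y j. u k y (\<phi> j)) k y j = sp_run s \<Psi> u k y (\<phi> j)"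
  using assms
proof (induction s arbitrary: j y k)
  case 0
  then show ?case
    by (cases k) (simp_all add: sp_run_def sp_init_def)
next
  case (Suc s)
  let ?\<Psi>' = "view r \<Psi> x"
  let ?Q = "sp_run s \<Psi> u" and ?Q' = "sp_run s ?\<Psi>' (\<lambda>k y j. u k y (\<phi> j))"
  have step: "sp_run (Suc s) \<Theta> v = sp_step \<Theta> (sp_run s \<Theta> v)" for \<Theta> v
    by (simp add: sp_run_def)
  have r: "r - s = Suc (r - Suc s)"
    using Suc.prems(1) by simp
  have j: "\<phi> j < length \<Psi>"
    using im Suc.prems(2) by blast
  \<comment> \<open>All variables of this clause lie in the next larger ball, so every clause
    containing \<open>y\<close> belongs to the view and is covered by the induction
    hypothesis.\<close>
  have y: "y \<in> nbr (set \<Psi>) (r - s) x"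
    unfolding r nbr_Suc_iff using Suc.prems(3,4) j by (metis IntE all_not_in_conv nth_mem)
  then have y': "y \<in> nbr (set \<Psi>) r x"
    using nbr_mono[of "r - s" r] by auto
  have same_clause: "?Q' k z j = ?Q k z (\<phi> j)" if "z \<in> vars (\<Psi> ! \<phi> j)" for z k
  proof (rule Suc.IH)
    show "vars (\<Psi> ! \<phi> j) \<inter> nbr (set \<Psi>) (r - s) x \<noteq> {}"
      using y Suc.prems(4) by blast
  qed (use Suc.prems that in auto)
  have other: "?Q' k y D = ?Q k y (\<phi> D)" if "D < length ?\<Psi>'" "y \<in> vars (\<Psi> ! \<phi> D)" for D k
    using that y Suc.prems(1) by (intro Suc.IH) auto
  have pol: "D < length ?\<Psi>' \<and> y \<in> vars (\<Psi> ! \<phi> D)" if "D \<in> same_pol ?\<Psi>' y j \<union> opp_pol ?\<Psi>' y j" for D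
    using that nth lits_vars by (auto simp: same_pol_def opp_pol_def)
  have inj': "inj_on \<phi> A" for A
    using inj inj_on_subset by blast
  have un: "same_pol \<Psi> y (\<phi> j) \<union> opp_pol \<Psi> y (\<phi> j) = \<phi> ` (same_pol ?\<Psi>' y j \<union> opp_pol ?\<Psi>' y j)"
    unfolding image_pol[OF Suc.prems(2,4) y'] by auto
  have st: "R_star ?\<Psi>' ?Q' y j = R_star \<Psi> ?Q y (\<phi> j)"
    unfolding R_star_def un prod.reindex[OF inj'] o_def
    by (rule prod.cong[OF refl]) (use pol other in simp)
  have prods: "(\<Prod>D\<in>opp_pol \<Psi> y (\<phi> j). 1 - ?Q k y D) = (\<Prod>D\<in>opp_pol ?\<Psi>' y j. 1 - ?Q' k y D)"
    "(\<Prod>D\<in>same_pol \<Psi> y (\<phi> j). 1 - ?Q k y D) = (\<Prod>D\<in>same_pol ?\<Psi>' y j. 1 - ?Q' k y D)" for k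
    unfolding image_pol[OF Suc.prems(2,4) y'] prod.reindex[OF inj'] o_def
    by (rule prod.cong[OF refl], use pol other in simp)+
  have S: "R_S ?\<Psi>' ?Q' y j = R_S \<Psi> ?Q y (\<phi> j)" and U: "R_U ?\<Psi>' ?Q' y j = R_U \<Psi> ?Q y (\<phi> j)"
    unfolding R_S_def R_U_def st prods by simp_all
  have cl: "?\<Psi>' ! j = \<Psi> ! \<phi> j"
    by (rule nth[OF Suc.prems(2)])
  have msg: "(\<Prod>z\<in>vars (\<Psi> ! \<phi> j) - {y}. ?Q' k z j) = (\<Prod>z\<in>vars (\<Psi> ! \<phi> j) - {y}. ?Q k z (\<phi> j))" for k
    by (rule prod.cong[OF refl]) (use same_clause in simp)
  show ?case
    unfolding step by (cases k) (simp_all add: sp_step_def Let_def cl S U st msg)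
qed

lemma sp_choice_view: "sp_choice r (view r \<Psi> x) (\<lambda>k y j. u k y (\<phi> j)) x = sp_choice r \<Psi> u x"
proof -
  let ?\<Psi>' = "view r \<Psi> x"
  let ?Q = "sp_run r \<Psi> u" and ?Q' = "sp_run r ?\<Psi>' (\<lambda>k y j. u k y (\<phi> j))"
  have x: "x \<in> nbr (set \<Psi>) r x"
    using nbr_mono[of 0 r] by auto
  have inj': "inj_on \<phi> A" for A
    using inj inj_on_subset by blast
  have Q: "?Q' k x D = ?Q k x (\<phi> D)" if "D \<in> occ ?\<Psi>' x b" for D k b
    using that nth lits_vars by (intro sp_run_view) (auto simp: occ_def)
  have st: "W_star ?\<Psi>' ?Q' x = W_star \<Psi> ?Q x"
    unfolding W_star_def image_occ[OF x] image_Un[symmetric] prod.reindex[OF inj'] o_def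
    by (rule prod.cong[OF refl]) (use Q in auto)
  have prods: "(\<Prod>D\<in>occ \<Psi> x b. 1 - ?Q k x D) = (\<Prod>D\<in>occ ?\<Psi>' x b. 1 - ?Q' k x D)" for k b
    unfolding image_occ[OF x] prod.reindex[OF inj'] o_def
    by (rule prod.cong[OF refl]) (use Q in simp)
  have "W ?\<Psi>' ?Q' x v = W \<Psi> ?Q x v" for v
    unfolding W_def st prods ..
  then show ?thesis
    unfolding sp_choice_def sp_marginal_def st by simp
qed

end

section \<open>From random seeds to thresholds\<close>

abbreviation unif01 :: "real measure" where
  "unif01 \<equiv> uniform_measure lborel {0..1}"

lemma prob_space_unif01: "prob_space unif01"
  by (rule prob_space_uniform_measure) auto

lemma prob_space_seed: "prob_space seed_space"
  unfolding seed_space_def by (intro prob_space_PiM prob_space_unif01)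

lemma space_seed [simp]: "space seed_space = UNIV"
  by (simp add: seed_space_def space_PiM)

definition choice_prob :: "nat \<Rightarrow> nat \<Rightarrow> inst \<Rightarrow> real" where
  "choice_prob r i \<Psi> = measure seed_space {\<omega>. sp_choice r \<Psi> (seed_at \<omega> i) i}"

lemma sets_choice: "{\<omega>. sp_choice r \<Psi> (seed_at \<omega> i) x} \<in> sets seed_space"
  using measurable_sp_choice[of r \<Psi> i x] by (simp add: pred_def)

text \<open>\<open>sp_choice_view\<close> matches the choice on the view with reindexed seeds to the
  choice on the whole instance. Reindexing independent, identically distributed seeds along an
  injection preserves their law, so the probabilities agree.\<close>

lemma choice_prob_view: "choice_prob r i (view r \<Psi> i) = choice_prob r i \<Psi>"
proof -
  obtain \<phi> :: "nat \<Rightarrow> nat" where \<phi>: "inj \<phi>"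
    "\<phi> ` {..<length (view r \<Psi> i)} = {j. j < length \<Psi> \<and> vars (\<Psi> ! j) \<inter> nbr (set \<Psi>) r i \<noteq> {}}"
    "\<And>j. j < length (view r \<Psi> i) \<Longrightarrow> view r \<Psi> i ! j = \<Psi> ! \<phi> j"
    using filter_positions[of "\<lambda>C. vars C \<inter> nbr (set \<Psi>) r i \<noteq> {}" \<Psi>]
    unfolding view_def by blast
  define f where "f = (\<lambda>(i :: nat, k :: kind, y :: nat, j). (i, k, y, \<phi> j))"
  define T :: "seed \<Rightarrow> seed" where "T = (\<lambda>\<omega> e. \<omega> (f e))"
  have "inj f"
    using \<phi>(1) by (auto simp: f_def inj_on_def)
  have distr: "distr seed_space seed_space T = seed_space"
    using distr_PiM_reindex[of UNIV "\<lambda>_. unif01" f UNIV] \<open>inj f\<close> prob_space_unif01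
    by (simp add: seed_space_def T_def restrict_UNIV)
  have T: "T \<in> seed_space \<rightarrow>\<^sub>M seed_space"
    unfolding seed_space_def T_def by (rule measurable_PiM_single') (auto intro: measurable_component_singleton)
  have "choice_prob r i (view r \<Psi> i) =
      measure (distr seed_space seed_space T) {\<omega>. sp_choice r (view r \<Psi> i) (seed_at \<omega> i) i}"
    unfolding distr choice_prob_def ..
  also have "\<dots> = measure seed_space {\<omega>. sp_choice r (view r \<Psi> i) (seed_at (T \<omega>) i) i}"
    by (subst measure_distr[OF T sets_choice]) (simp add: vimage_def)
  also have "(\<lambda>\<omega>. sp_choice r (view r \<Psi> i) (seed_at (T \<omega>) i) i) = (\<lambda>\<omega>. sp_choice r \<Psi> (seed_at \<omega> i) i)"
  proof
    fix \<omega>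
    have "seed_at (T \<omega>) i = (\<lambda>k y j. seed_at \<omega> i k y (\<phi> j))"
      by (simp add: seed_at_def T_def f_def)
    then show "sp_choice r (view r \<Psi> i) (seed_at (T \<omega>) i) i = sp_choice r \<Psi> (seed_at \<omega> i) i"
      using sp_choice_view[OF \<phi>] by simp
  qed
  finally show ?thesis
    by (simp add: choice_prob_def)
qed

definition bern :: "bool \<Rightarrow> real \<Rightarrow> real" where
  "bern v q = (if v then q else 1 - q)"

text \<open>The instances are prescribed rather than produced by the run, so choice \<open>k\<close>
  reads only seed coordinates with first component \<open>k\<close>; these blocks are disjoint and
  hence independent.\<close>

lemma prob_choices:
  "measure seed_space {\<omega>. \<forall>k<n. sp_choice r (\<Psi> k) (seed_at \<omega> k) k = s k} =
    (\<Prod>k<n. bern (s k) (choice_prob r k (\<Psi> k)))"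
proof (cases "n = 0")
  case True
  then show ?thesis
    using prob_space.prob_space[OF prob_space_seed] by simp
next
  case False
  interpret prob_space seed_space by (rule prob_space_seed)
  let ?M = "\<lambda>_ :: nat \<times> kind \<times> nat \<times> nat. unif01"
  let ?K = "\<lambda>k :: nat. {k} \<times> (UNIV :: (kind \<times> nat \<times> nat) set)"
  let ?c = "\<lambda>k \<omega>. sp_choice r (\<Psi> k) (seed_at \<omega> k) k"
  have comp: "(\<lambda>\<omega>. \<omega> e) \<in> seed_space \<rightarrow>\<^sub>M unif01" for e
    unfolding seed_space_def by (rule measurable_component_singleton) simp
  have "indep_vars ?M (\<lambda>e \<omega>. \<omega> e) UNIV"
  proof (subst indep_vars_iff_distr_eq_PiM')
    have "distr seed_space unif01 (\<lambda>\<omega>. \<omega> e) = unif01" for e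
      unfolding seed_space_def by (rule distr_PiM_component) (auto intro: prob_space_unif01)
    then show "distr seed_space (Pi\<^sub>M UNIV ?M) (\<lambda>\<omega>. \<lambda>e\<in>UNIV. \<omega> e) =
        Pi\<^sub>M UNIV (\<lambda>e. distr seed_space (?M e) (\<lambda>\<omega>. \<omega> e))"
      by (simp add: seed_space_def restrict_def distr_id)
  qed (use comp in auto)
  then have ind: "indep_vars (\<lambda>k. PiM (?K k) ?M) (\<lambda>k \<omega>. restrict (\<lambda>e. \<omega> e) (?K k)) {..<n}"
    by (rule indep_vars_restrict) (auto simp: disjoint_family_on_def)
  \<comment> \<open>Refills a seed restricted to block \<open>k\<close> by 0 elsewhere, at
    coordinates that choice \<open>k\<close> never reads.\<close>
  let ?ext = "\<lambda>k \<omega> e. if e \<in> ?K k then \<omega> e else (0 :: real)"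
  have "indep_vars (\<lambda>_. count_space UNIV) (\<lambda>k \<omega>. ?c k (?ext k (restrict (\<lambda>e. \<omega> e) (?K k)))) {..<n}"
  proof (rule indep_vars_compose2[OF ind])
    fix k
    have "?ext k \<in> PiM (?K k) ?M \<rightarrow>\<^sub>M seed_space"
      unfolding seed_space_def
    proof (rule measurable_PiM_single')
      fix e :: "nat \<times> kind \<times> nat \<times> nat"
      show "(\<lambda>\<omega>. ?ext k \<omega> e) \<in> PiM (?K k) ?M \<rightarrow>\<^sub>M unif01"
        by (cases "e \<in> ?K k") (auto intro: measurable_component_singleton)
    qed auto
    from measurable_compose[OF this measurable_sp_choice[of r "\<Psi> k" k k]]
    show "(\<lambda>\<omega>. ?c k (?ext k \<omega>)) \<in> PiM (?K k) ?M \<rightarrow>\<^sub>M count_space UNIV"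
      by simp
  qed
  moreover have "?c k (?ext k (restrict (\<lambda>e. \<omega> e) (?K k))) = ?c k \<omega>" for k \<omega>
  proof -
    have "seed_at (?ext k (restrict (\<lambda>e. \<omega> e) (?K k))) k = seed_at \<omega> k"
      by (auto simp: seed_at_def)
    then show ?thesis by simp
  qed
  ultimately have ind2: "indep_vars (\<lambda>_. count_space UNIV) ?c {..<n}"
    by simp
  have ne: "{..<n} \<noteq> {}"
    using False by auto
  then have "{\<omega>. \<forall>k<n. ?c k \<omega> = s k} = (\<Inter>k\<in>{..<n}. ?c k -` {s k} \<inter> space seed_space)"
    using False by auto
  then have "measure seed_space {\<omega>. \<forall>k<n. ?c k \<omega> = s k} =
      (\<Prod>k<n. measure seed_space (?c k -` {s k} \<inter> space seed_space))"
    using indep_varsD[OF ind2 ne finite_lessThan order_refl, of "\<lambda>k. {s k}"] by simp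
  also have "\<dots> = (\<Prod>k<n. bern (s k) (choice_prob r k (\<Psi> k)))"
  proof (rule prod.cong[OF refl])
    fix k
    show "measure seed_space (?c k -` {s k} \<inter> space seed_space) = bern (s k) (choice_prob r k (\<Psi> k))"
    proof (cases "s k")
      case True
      then show ?thesis by (simp add: bern_def choice_prob_def vimage_def)
    next
      case False
      then have "?c k -` {s k} \<inter> space seed_space = space seed_space - {\<omega>. ?c k \<omega>}"
        by auto
      then show ?thesis
        using False prob_compl[OF sets_choice] by (simp add: bern_def choice_prob_def)
    qed
  qed
  finally show ?thesis .
qed

lemma choice_prob_bounds: "0 \<le> choice_prob r i \<Psi>" "choice_prob r i \<Psi> \<le> 1"
  unfolding choice_prob_def using prob_space.prob_le_1[OF prob_space_seed] by auto

text \<open>For a threshold uniform on the unit interval, \<open>(t < q x) = s x\<close> has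
  probability \<open>bern (s x) (q x)\<close>. The left side is thus the mean of the right side over
  \<open>t\<close>, and some threshold does at least as well as the mean.\<close>

lemma threshold_exists_one:
  fixes q w :: "'a \<Rightarrow> real"
  assumes "finite X" "\<And>x. x \<in> X \<Longrightarrow> 0 \<le> q x \<and> q x \<le> 1"
  shows "\<exists>t. (\<Sum>x\<in>X. w x * bern (s x) (q x)) \<le> (\<Sum>x\<in>X. w x * of_bool ((t < q x) = s x))"
proof (rule ccontr)
  assume "\<not> ?thesis"
  then have less: "(\<Sum>x\<in>X. w x * of_bool ((t < q x) = s x)) < (\<Sum>x\<in>X. w x * bern (s x) (q x))" for t
    by (simp add: not_le)
  interpret U: prob_space unif01 by (rule prob_space_unif01)
  have m: "measure unif01 {..<q x} = q x" if "x \<in> X" for x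
  proof -
    have "{0..1} \<inter> {..<q x} = {0..<q x}"
      using assms(2)[OF that] by auto
    then show ?thesis
      using assms(2)[OF that] by (simp add: measure_uniform_measure)
  qed
  have sets: "{t. (t < q x) = s x} \<in> sets unif01" for x
    by (cases "s x") (auto simp: not_less)
  have E: "(\<integral>t. of_bool ((t < q x) = s x) \<partial>unif01) = bern (s x) (q x)" if "x \<in> X" for x
  proof -
    have "(\<integral>t. of_bool ((t < q x) = s x) \<partial>unif01) = measure unif01 {t. (t < q x) = s x}"
    proof -
      have "(\<lambda>t. of_bool ((t < q x) = s x)) = (indicator {t. (t < q x) = s x} :: real \<Rightarrow> real)"
        by (auto simp: indicator_def)
      then show ?thesis by simp
    qed
    also have "\<dots> = bern (s x) (q x)"
    proof (cases "s x")
      case True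
      then have "{t. (t < q x) = s x} = {..<q x}" by auto
      then show ?thesis using m[OF that] True by (simp add: bern_def)
    next
      case False
      then have "{t. (t < q x) = s x} = space unif01 - {..<q x}" by auto
      moreover have "{..<q x} \<in> sets unif01" by simp
      ultimately show ?thesis
        using U.prob_compl[of "{..<q x}"] m[OF that] False by (simp add: bern_def)
    qed
    finally show ?thesis .
  qed
  have int: "integrable unif01 (\<lambda>t. of_bool ((t < q x) = s x) :: real)" for x
    using sets[of x] by (intro U.integrable_const_bound[of _ 1]) auto
  let ?c = "\<Sum>x\<in>X. w x * bern (s x) (q x)"
  have "(\<integral>t. (\<Sum>x\<in>X. w x * of_bool ((t < q x) = s x)) \<partial>unif01) = ?c"
    using int E by simp
  moreover have "(\<integral>t. (\<Sum>x\<in>X. w x * of_bool ((t < q x) = s x)) \<partial>unif01) < (\<integral>t. ?c \<partial>unif01)"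
    using less int by (intro U.integral_less_AE_space) (auto simp: U.emeasure_space_1)
  ultimately show False
    by (simp add: U.prob_space)
qed

lemma thresholds_exist:
  fixes q :: "nat \<Rightarrow> 'a \<Rightarrow> real" and w :: "'a \<Rightarrow> real"
  assumes "finite X" "\<And>k x. x \<in> X \<Longrightarrow> 0 \<le> q k x \<and> q k x \<le> 1"
  shows "\<exists>u. (\<Sum>x\<in>X. w x * (\<Prod>k<n. bern (s k x) (q k x))) \<le>
    (\<Sum>x\<in>X. w x * (\<Prod>k<n. of_bool ((u k < q k x) = s k x)))"
proof (induction n arbitrary: w)
  case 0
  then show ?case by simp
next
  case (Suc n)
  \<comment> \<open>The factor of step \<open>n\<close> is put into the weights while the first
    \<open>n\<close> thresholds are chosen; then the chosen factors serve as weights for the last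
    threshold.\<close>
  obtain u where u: "(\<Sum>x\<in>X. (w x * bern (s n x) (q n x)) * (\<Prod>k<n. bern (s k x) (q k x))) \<le>
      (\<Sum>x\<in>X. (w x * bern (s n x) (q n x)) * (\<Prod>k<n. of_bool ((u k < q k x) = s k x)))"
    using Suc.IH[of "\<lambda>x. w x * bern (s n x) (q n x)"] by blast
  obtain t where t: "(\<Sum>x\<in>X. (w x * (\<Prod>k<n. of_bool ((u k < q k x) = s k x))) * bern (s n x) (q n x)) \<le>
      (\<Sum>x\<in>X. (w x * (\<Prod>k<n. of_bool ((u k < q k x) = s k x))) * of_bool ((t < q n x) = s n x))"
    using threshold_exists_one[of X "q n" "\<lambda>x. w x * (\<Prod>k<n. of_bool ((u k < q k x) = s k x))" "s n"] assms
    by blast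
  have "(\<Prod>k<n. of_bool (((u(n := t)) k < q k x) = s k x)) = (\<Prod>k<n. of_bool ((u k < q k x) = s k x) :: real)" for x
    by (rule prod.cong) auto
  then show ?case
    using u t by (intro exI[of _ "u(n := t)"]) (simp add: mult_ac)
qed

lemma decimated_eq_dec: "decimated r \<omega> \<Phi> i = dec (\<lambda>i \<Psi>. sp_choice r \<Psi> (seed_at \<omega> i) i) \<Phi> i"
  by (induction i) simp_all

lemma sp_output_eq_out: "sp_output r \<omega> \<Phi> = out (\<lambda>i \<Psi>. sp_choice r \<Psi> (seed_at \<omega> i) i) \<Phi>"
  by (auto simp: sp_output_def out_def decimated_eq_dec)

text \<open>Replaces the adaptive run by instances decimated according to a guessed output
  \<open>s\<close>. Different guesses describe disjoint events, and for a fixed guess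
  \<open>prob_choices\<close> applies.\<close>

lemma out_prefix_iff:
  "(\<forall>k<n. out g \<Phi> k = s k) \<longleftrightarrow> (\<forall>k<n. g k (List.map_filter (redc s k) \<Phi>) = s k)"
proof -
  have eq: "dec g \<Phi> k = List.map_filter (redc s k) \<Phi>" if "\<forall>j<k. out g \<Phi> j = s j" for k
    unfolding dec_eq_redc using that by (intro map_filter_cong redc_cong) auto
  show ?thesis
  proof (rule iffI; intro allI impI)
    fix k assume "\<forall>k<n. out g \<Phi> k = s k" "k < n"
    then show "g k (List.map_filter (redc s k) \<Phi>) = s k"
      using eq[of k] by (auto simp: out_def)
  next
    fix k assume a: "\<forall>k<n. g k (List.map_filter (redc s k) \<Phi>) = s k" "k < n"
    then show "out g \<Phi> k = s k"
    proof (induction k rule: less_induct)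
      case (less k)
      then have "dec g \<Phi> k = List.map_filter (redc s k) \<Phi>"
        by (intro eq) auto
      with less.prems show ?case by (simp add: out_def)
    qed
  qed
qed

text \<open>The success probability is at most a sum, over formulas and their satisfying assignments
  \<open>s\<close>, of the probability of output \<open>s\<close>, a product of \<open>bern\<close>
  factors. Thresholds that do not decrease this sum turn each product into the indicator that the
  deterministic run outputs \<open>s\<close>.\<close>

lemma sp_solves_le_local_rule:
  assumes "K \<le> n"
  obtains g where "local_rule r g"
    "measure (sp_space K d n) (sp_solves r) \<le>
      Pr (formula_pmf K d n) (solved g)"
proof -
  interpret S: prob_space seed_space by (rule prob_space_seed)
  let ?F = "formula_pmf K d n"
  let ?so = "\<lambda>\<Phi>. {\<omega>. satisfies (sp_output r \<omega> \<Phi>) \<Phi>}"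
  let ?m = "nat \<lfloor>d * real n\<rfloor>"
  \<comment> \<open>Values outside the \<open>n\<close> variables are set to false so that each
    formula has finitely many candidates.\<close>
  define good where "good \<Phi> = {s. (\<forall>k\<ge>n. \<not> s k) \<and> satisfies s \<Phi>}" for \<Phi>
  define \<Psi> where "\<Psi> k x = List.map_filter (redc (snd x) k) (fst x)" for k :: nat and x :: "inst \<times> (nat \<Rightarrow> bool)"
  have set_F: "set_pmf ?F = {xs \<in> lists (set_pmf (clause_pmf K n)). length xs = ?m}"
    by (simp add: formula_pmf_def set_replicate_pmf)
  have "{xs \<in> lists (set_pmf (clause_pmf K n)). length xs = ?m} =
      {xs. set xs \<subseteq> set_pmf (clause_pmf K n) \<and> length xs = ?m}"
    by auto
  then have finF: "finite (set_pmf ?F)"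
    unfolding set_F using finite_lists_length_eq[OF finite_set_clause_pmf[OF assms]] by simp
  have intF: "EV ?F f = (\<Sum>\<Phi>\<in>set_pmf ?F. pmf ?F \<Phi> * f \<Phi>)" for f :: "inst \<Rightarrow> real"
    by (subst integral_measure_pmf[OF finF]) auto
  have varsF: "vars C \<subseteq> {..<n}" if "\<Phi> \<in> set_pmf ?F" "C \<in> set \<Phi>" for \<Phi> C
    using that vars_clause_pmf(1)[OF assms] unfolding set_F by auto
  have "good \<Phi> \<subseteq> (\<lambda>A i. i \<in> A) ` Pow {..<n}" for \<Phi>
  proof
    fix s assume "s \<in> good \<Phi>"
    then have "{i. s i} \<in> Pow {..<n}" by (auto simp: good_def not_less[symmetric])
    moreover have "s = (\<lambda>A i. i \<in> A) {i. s i}" by simp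
    ultimately show "s \<in> (\<lambda>A i. i \<in> A) ` Pow {..<n}" by blast
  qed
  then have fin_good: "finite (good \<Phi>)" for \<Phi>
    by (rule finite_subset) simp
  let ?X = "SIGMA \<Phi>:set_pmf ?F. good \<Phi>"
  have finX: "finite ?X"
    using finF fin_good by (intro finite_SigmaI) auto
  obtain u where u: "(\<Sum>x\<in>?X. pmf ?F (fst x) * (\<Prod>k<n. bern (snd x k) (choice_prob r k (\<Psi> k x)))) \<le>
      (\<Sum>x\<in>?X. pmf ?F (fst x) * (\<Prod>k<n. of_bool ((u k < choice_prob r k (\<Psi> k x)) = snd x k)))"
    using thresholds_exist[OF finX, where q = "\<lambda>k x. choice_prob r k (\<Psi> k x)" and
        w = "\<lambda>x. pmf ?F (fst x)" and n = n and s = "\<lambda>k x. snd x k"]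
      choice_prob_bounds by blast
  define g where "g k \<Theta> = (u k < choice_prob r k \<Theta>)" for k \<Theta>
  have solve: "measure seed_space (?so \<Phi>) \<le>
      (\<Sum>s\<in>good \<Phi>. \<Prod>k<n. bern (s k) (choice_prob r k (\<Psi> k (\<Phi>, s))))" if "\<Phi> \<in> set_pmf ?F" for \<Phi>
  proof -
    let ?A = "\<lambda>s. {\<omega>. \<forall>k<n. sp_choice r (\<Psi> k (\<Phi>, s)) (seed_at \<omega> k) k = s k}"
    have pred: "{\<omega>. sp_choice r \<Theta> (seed_at \<omega> k) k = b} \<in> sets seed_space" for \<Theta> k b
    proof (cases b)
      case True
      then show ?thesis using sets_choice by simp
    next
      case False
      then have "{\<omega>. sp_choice r \<Theta> (seed_at \<omega> k) k = b} = space seed_space - {\<omega>. sp_choice r \<Theta> (seed_at \<omega> k) k}"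
        by auto
      then show ?thesis using sets_choice by (metis sets.compl_sets)
    qed
    have sets: "?A s \<in> sets seed_space" for s
    proof -
      have "?A s = space seed_space \<inter> (\<Inter>k\<in>{..<n}. {\<omega>. sp_choice r (\<Psi> k (\<Phi>, s)) (seed_at \<omega> k) k = s k})"
        by auto
      also have "\<dots> \<in> sets seed_space"
        using pred sets.top[of seed_space] by (cases "n = 0") (auto intro!: sets.finite_INT)
      finally show ?thesis .
    qed
    have "(?so \<Phi>) \<subseteq> (\<Union>s\<in>good \<Phi>. ?A s)"
    proof
      fix \<omega> assume \<omega>: "\<omega> \<in> (?so \<Phi>)"
      define s where "s k = (k < n \<and> sp_output r \<omega> \<Phi> k)" for k
      have "satisfies s \<Phi> = satisfies (sp_output r \<omega> \<Phi>) \<Phi>"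
        using varsF[OF that] by (intro satisfies_cong) (auto simp: s_def)
      then have "s \<in> good \<Phi>"
        using \<omega> by (simp add: good_def s_def)
      moreover have "\<forall>k<n. out (\<lambda>i \<Psi>. sp_choice r \<Psi> (seed_at \<omega> i) i) \<Phi> k = s k"
        by (simp add: s_def sp_output_eq_out)
      then have "\<omega> \<in> ?A s"
        unfolding out_prefix_iff by (simp add: \<Psi>_def)
      ultimately show "\<omega> \<in> (\<Union>s\<in>good \<Phi>. ?A s)" by blast
    qed
    then have "measure seed_space (?so \<Phi>) \<le> measure seed_space (\<Union>s\<in>good \<Phi>. ?A s)"
      using sets fin_good by (intro S.finite_measure_mono) auto
    also have "\<dots> \<le> (\<Sum>s\<in>good \<Phi>. measure seed_space (?A s))"
      using sets fin_good by (intro S.finite_measure_subadditive_finite) auto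
    also have "\<dots> = (\<Sum>s\<in>good \<Phi>. \<Prod>k<n. bern (s k) (choice_prob r k (\<Psi> k (\<Phi>, s))))"
      by (simp add: prob_choices)
    finally show ?thesis .
  qed
  have "local_rule r g"
    by (simp add: local_rule_def g_def choice_prob_view)
  moreover have "measure (sp_space K d n) (sp_solves r) \<le>
      Pr ?F (solved g)"
  proof -
    have "emeasure (sp_space K d n) (sp_solves r) =
        (\<integral>\<^sup>+\<Phi>. emeasure seed_space (Pair \<Phi> -` sp_solves r) \<partial>measure_pmf ?F)"
      unfolding sp_space_def
      by (rule S.emeasure_pair_measure_alt) (use sp_solves_measurable in \<open>simp add: sp_space_def\<close>)
    also have "\<dots> = (\<integral>\<^sup>+\<Phi>. ennreal (measure seed_space (?so \<Phi>)) \<partial>measure_pmf ?F)"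
      by (simp add: sp_solves_def vimage_def S.emeasure_eq_measure)
    also have "\<dots> = ennreal (EV ?F (\<lambda>\<Phi>. measure seed_space (?so \<Phi>)))"
      by (rule nn_integral_eq_integral) (auto intro: integrable_measure_pmf_finite[OF finF])
    finally have "measure (sp_space K d n) (sp_solves r) =
        EV ?F (\<lambda>\<Phi>. measure seed_space (?so \<Phi>))"
      by (simp add: measure_def integral_nonneg_AE)
    also have "\<dots> = (\<Sum>\<Phi>\<in>set_pmf ?F. pmf ?F \<Phi> * measure seed_space (?so \<Phi>))"
      by (rule intF)
    also have "\<dots> \<le> (\<Sum>\<Phi>\<in>set_pmf ?F. pmf ?F \<Phi> * (\<Sum>s\<in>good \<Phi>. \<Prod>k<n. bern (s k) (choice_prob r k (\<Psi> k (\<Phi>, s)))))"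
      using solve by (intro sum_mono mult_left_mono) auto
    also have "\<dots> = (\<Sum>x\<in>?X. pmf ?F (fst x) * (\<Prod>k<n. bern (snd x k) (choice_prob r k (\<Psi> k x))))"
      using finF fin_good by (simp add: sum_distrib_left sum.Sigma case_prod_unfold)
    also note u
    also have "(\<Sum>x\<in>?X. pmf ?F (fst x) * (\<Prod>k<n. of_bool ((u k < choice_prob r k (\<Psi> k x)) = snd x k))) =
        (\<Sum>\<Phi>\<in>set_pmf ?F. pmf ?F \<Phi> * (\<Sum>s\<in>good \<Phi>. \<Prod>k<n. of_bool (g k (\<Psi> k (\<Phi>, s)) = s k)))"
      using finF fin_good by (simp add: sum_distrib_left sum.Sigma case_prod_unfold g_def)
    also have "\<dots> \<le> (\<Sum>\<Phi>\<in>set_pmf ?F. pmf ?F \<Phi> * indicator (solved g) \<Phi>)"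
    proof (intro sum_mono mult_left_mono)
      fix \<Phi> assume \<Phi>: "\<Phi> \<in> set_pmf ?F"
      define s0 where "s0 k = (k < n \<and> out g \<Phi> k)" for k
      have sat0: "satisfies s0 \<Phi> = satisfies (out g \<Phi>) \<Phi>"
        using varsF[OF \<Phi>] by (intro satisfies_cong) (auto simp: s0_def)
      have "(\<Prod>k<n. of_bool (g k (\<Psi> k (\<Phi>, s)) = s k)) = (of_bool (s = s0) :: real)" if "s \<in> good \<Phi>" for s
      proof -
        have "(\<Prod>k<n. of_bool (g k (\<Psi> k (\<Phi>, s)) = s k)) = (of_bool (\<forall>k<n. g k (\<Psi> k (\<Phi>, s)) = s k) :: real)"
          by (cases "\<forall>k<n. g k (\<Psi> k (\<Phi>, s)) = s k") (auto simp: prod_zero_iff)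
        also have "(\<forall>k<n. g k (\<Psi> k (\<Phi>, s)) = s k) \<longleftrightarrow> (\<forall>k<n. out g \<Phi> k = s k)"
          unfolding out_prefix_iff by (simp add: \<Psi>_def)
        also have "\<dots> \<longleftrightarrow> s = s0"
        proof -
          have "\<forall>k\<ge>n. \<not> s k"
            using that by (simp add: good_def)
          then have "k < n" if "s k" for k
            using that not_le by blast
          then show ?thesis
            by (auto simp: s0_def fun_eq_iff)
        qed
        finally show ?thesis .
      qed
      then have "(\<Sum>s\<in>good \<Phi>. \<Prod>k<n. of_bool (g k (\<Psi> k (\<Phi>, s)) = s k)) = (\<Sum>s\<in>good \<Phi>. of_bool (s = s0) :: real)"
        by (intro sum.cong) auto
      also have "\<dots> = of_bool (s0 \<in> good \<Phi>)"
        using fin_good[of \<Phi>] by (simp add: of_bool_def sum.delta')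
      also have "\<dots> \<le> indicator (solved g) \<Phi>"
        using sat0 by (simp add: good_def)
      finally show "(\<Sum>s\<in>good \<Phi>. \<Prod>k<n. of_bool (g k (\<Psi> k (\<Phi>, s)) = s k)) \<le>
          (indicator (solved g) \<Phi> :: real)" .
    qed auto
    also have "\<dots> = EV ?F (indicator (solved g))"
      by (rule intF[symmetric])
    also have "\<dots> = Pr ?F (solved g)"
      by simp
    finally show ?thesis .
  qed
  ultimately show ?thesis
    using that by blast
qed

section \<open>Three correlated copies\<close>

lemma replicate_pmf_conv_Pi:
  "replicate_pmf m p = map_pmf (\<lambda>f. map f [0..<m]) (Pi_pmf {..<m} d (\<lambda>_. p))"
proof (induction m)
  case (Suc m)
  have "replicate_pmf (Suc m) p = replicate_pmf (m + 1) p"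
    by simp
  also have "\<dots> = do {xs \<leftarrow> replicate_pmf m p; x \<leftarrow> p; return_pmf (xs @ [x])}"
    unfolding replicate_pmf_distrib replicate_pmf_1 by (simp add: map_pmf_def bind_assoc_pmf bind_return_pmf)
  also have "\<dots> = do {x \<leftarrow> p; xs \<leftarrow> replicate_pmf m p; return_pmf (xs @ [x])}"
    by (rule bind_commute_pmf)
  also have "\<dots> = do {x \<leftarrow> p; f \<leftarrow> Pi_pmf {..<m} d (\<lambda>_. p); return_pmf (map (f(m := x)) [0..<Suc m])}"
  proof -
    have "map (f(m := x)) [0..<Suc m] = map f [0..<m] @ [x]" for f :: "nat \<Rightarrow> 'a" and x
      by simp
    then show ?thesis
      unfolding Suc by (simp only: map_pmf_def bind_assoc_pmf bind_return_pmf)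
  qed
  also have "\<dots> = map_pmf (\<lambda>f. map f [0..<Suc m]) (Pi_pmf (insert m {..<m}) d (\<lambda>_. p))"
    by (subst Pi_pmf_insert) (simp_all add: pair_pmf_def map_pmf_def bind_assoc_pmf bind_return_pmf)
  finally show ?case
    by (simp add: lessThan_Suc)
qed simp

lemma finite_set_replicate: "finite (set_pmf p) \<Longrightarrow> finite (set_pmf (replicate_pmf k p))"
  unfolding replicate_pmf_conv_Pi[of k p undefined] by (simp add: finite_set_Pi_pmf)

context
  fixes p :: "clause pmf"
  assumes fin: "finite (set_pmf p)"
begin

abbreviation ER :: "nat \<Rightarrow> (inst \<Rightarrow> real) \<Rightarrow> real" where
  "ER k f \<equiv> EV (replicate_pmf k p) f"

lemma ER_append: "ER (a + b) f = ER a (\<lambda>xs. ER b (\<lambda>ys. f (xs @ ys)))"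
proof -
  have fa: "finite (set_pmf (replicate_pmf a p))" and fb: "finite (set_pmf (replicate_pmf b p))"
    using fin finite_set_replicate by auto
  have "replicate_pmf (a + b) p = map_pmf (\<lambda>(xs, ys). xs @ ys) (pair_pmf (replicate_pmf a p) (replicate_pmf b p))"
    unfolding replicate_pmf_distrib by (simp add: pair_pmf_def map_pmf_def bind_assoc_pmf bind_return_pmf)
  then show ?thesis
    using expectation_pair_pmf_finite[OF fa fb, of "\<lambda>(xs, ys). f (xs @ ys)"]
    by (simp add: case_prod_unfold)
qed

lemma ER_cong: "(\<And>xs. length xs = k \<Longrightarrow> f xs = h xs) \<Longrightarrow> ER k f = ER k h"
  by (intro integral_cong_AE) (auto simp: AE_measure_pmf_iff set_replicate_pmf)

lemma ER_integrable: "integrable (measure_pmf (replicate_pmf k p)) (f :: inst \<Rightarrow> real)"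
  by (rule integrable_measure_pmf_finite[OF finite_set_replicate[OF fin]])

text \<open>The array is cut into three pairs of blocks of lengths \<open>t\<close> and
  \<open>m - t\<close>. The second and third blocks of length \<open>t\<close> do not enter
  \<open>F\<close>, and their averages disappear.\<close>

lemma expectation_copies:
  assumes "t \<le> m"
  shows "EV (Pi_pmf {..<3 * m} d (\<lambda>_. p))
      (\<lambda>ys. F (copy m t 0 ys) (copy m t 1 ys) (copy m t 2 ys)) =
    ER t (\<lambda>\<alpha>. ER (m - t) (\<lambda>\<beta>. ER (m - t) (\<lambda>\<gamma>. ER (m - t) (\<lambda>\<delta>. F (\<alpha> @ \<beta>) (\<alpha> @ \<gamma>) (\<alpha> @ \<delta>)))))"
proof -
  define k where "k = m - t"
  have m: "m = t + k" using assms by (simp add: k_def)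
  let ?c = "\<lambda>a xs. map (\<lambda>j. xs ! pos m t a j) [0..<m]"
  have "copy m t a ys = ?c a (map ys [0..<3 * m])" if "a < 3" for a ys
    unfolding copy_def using pos_less[OF _ that, of _ m t] by auto
  then have "EV (Pi_pmf {..<3 * m} d (\<lambda>_. p))
      (\<lambda>ys. F (copy m t 0 ys) (copy m t 1 ys) (copy m t 2 ys)) =
      EV (Pi_pmf {..<3 * m} d (\<lambda>_. p))
      (\<lambda>ys. F (?c 0 (map ys [0..<3 * m])) (?c 1 (map ys [0..<3 * m])) (?c 2 (map ys [0..<3 * m])))"
    by simp
  also have "\<dots> = ER (3 * m) (\<lambda>xs. F (?c 0 xs) (?c 1 xs) (?c 2 xs))"
    unfolding replicate_pmf_conv_Pi[of "3 * m" p d] by simp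
  also have "\<dots> = ER (t + (k + (t + (k + (t + k))))) (\<lambda>xs. F (?c 0 xs) (?c 1 xs) (?c 2 xs))"
  proof -
    have "3 * m = t + (k + (t + (k + (t + k))))"
      by (simp add: m)
    then show ?thesis by (simp only:)
  qed
  also have "\<dots> =
      ER t (\<lambda>\<alpha>. ER k (\<lambda>\<beta>. ER t (\<lambda>\<alpha>'. ER k (\<lambda>\<gamma>. ER t (\<lambda>\<alpha>''. ER k (\<lambda>\<delta>. F (\<alpha> @ \<beta>) (\<alpha> @ \<gamma>) (\<alpha> @ \<delta>)))))))"
    unfolding ER_append
  proof (intro ER_cong)
    fix \<alpha> \<beta> \<alpha>' \<gamma> \<alpha>'' \<delta> :: inst
    assume len: "length \<alpha> = t" "length \<beta> = k" "length \<alpha>' = t" "length \<gamma> = k" "length \<alpha>'' = t" "length \<delta> = k"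
    have "?c 0 (\<alpha> @ \<beta> @ \<alpha>' @ \<gamma> @ \<alpha>'' @ \<delta>) = \<alpha> @ \<beta>"
      "?c 1 (\<alpha> @ \<beta> @ \<alpha>' @ \<gamma> @ \<alpha>'' @ \<delta>) = \<alpha> @ \<gamma>"
      "?c 2 (\<alpha> @ \<beta> @ \<alpha>' @ \<gamma> @ \<alpha>'' @ \<delta>) = \<alpha> @ \<delta>"
      by (rule nth_equalityI; auto simp: pos_def m len nth_append)+
    then show "F (?c 0 (\<alpha> @ \<beta> @ \<alpha>' @ \<gamma> @ \<alpha>'' @ \<delta>)) (?c 1 (\<alpha> @ \<beta> @ \<alpha>' @ \<gamma> @ \<alpha>'' @ \<delta>))
        (?c 2 (\<alpha> @ \<beta> @ \<alpha>' @ \<gamma> @ \<alpha>'' @ \<delta>)) = F (\<alpha> @ \<beta>) (\<alpha> @ \<gamma>) (\<alpha> @ \<delta>)"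
      by simp
  qed
  also have "\<dots> = ER t (\<lambda>\<alpha>. ER k (\<lambda>\<beta>. ER k (\<lambda>\<gamma>. ER k (\<lambda>\<delta>. F (\<alpha> @ \<beta>) (\<alpha> @ \<gamma>) (\<alpha> @ \<delta>)))))"
    by simp
  finally show ?thesis
    by (simp add: k_def)
qed

lemma expectation_copy:
  assumes "t \<le> m" "a < 3"
  shows "EV (Pi_pmf {..<3 * m} d (\<lambda>_. p)) (\<lambda>ys. f (copy m t a ys)) = ER m f"
proof -
  have eq: "ER m f = ER t (\<lambda>\<alpha>. ER (m - t) (\<lambda>\<beta>. f (\<alpha> @ \<beta>)))"
    using ER_append[of t "m - t" f] assms(1) by simp
  consider "a = 0" | "a = 1" | "a = 2" using assms(2) by linarith
  then show ?thesis
    unfolding eq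
    using expectation_copies[OF assms(1), of d "\<lambda>x _ _. f x"] expectation_copies[OF assms(1), of d "\<lambda>_ x _. f x"]
      expectation_copies[OF assms(1), of d "\<lambda>_ _ x. f x"]
    by cases simp_all
qed

lemma expectation_copy_pair:
  fixes f :: "inst \<Rightarrow> inst \<Rightarrow> real"
  assumes "t \<le> m" "a < b" "b < 3"
  shows "EV (Pi_pmf {..<3 * m} d (\<lambda>_. p)) (\<lambda>ys. f (copy m t a ys) (copy m t b ys)) =
    EV (Pi_pmf {..<3 * m} d (\<lambda>_. p)) (\<lambda>ys. f (copy m t 0 ys) (copy m t 1 ys))"
proof -
  consider "a = 0" "b = 1" | "a = 0" "b = 2" | "a = 1" "b = 2" using assms(2,3) by linarith
  then show ?thesis
    using expectation_copies[OF assms(1), of d "\<lambda>x y _. f x y"] expectation_copies[OF assms(1), of d "\<lambda>x _ y. f x y"]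
      expectation_copies[OF assms(1), of d "\<lambda>_ x y. f x y"]
    by cases simp_all
qed

text \<open>Given the shared clauses, the three copies are independent and identically distributed.\<close>

lemma cube_le_prob_copies:
  assumes "t \<le> m"
  shows "Pr (replicate_pmf m p) S ^ 3 \<le>
    Pr (Pi_pmf {..<3 * m} d (\<lambda>_. p)) {ys. \<forall>a<3. copy m t a ys \<in> S}"
proof -
  let ?s = "indicator S :: inst \<Rightarrow> real"
  let ?E = "EV (Pi_pmf {..<3 * m} d (\<lambda>_. p))"
  define Q where "Q \<alpha> = ER (m - t) (\<lambda>\<beta>. ?s (\<alpha> @ \<beta>))" for \<alpha>
  define x where "x = Pr (replicate_pmf m p) S"
  have Q0: "0 \<le> Q \<alpha>" for \<alpha>
    by (simp add: Q_def)
  have x0: "0 \<le> x" by (simp add: x_def)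
  have "x = ER m ?s"
    by (simp add: x_def)
  also have "\<dots> = ER t Q"
    using ER_append[of t "m - t" ?s] assms by (simp add: Q_def[abs_def])
  finally have x: "x = ER t Q" .
  have "Pr (Pi_pmf {..<3 * m} d (\<lambda>_. p)) {ys. \<forall>a<3. copy m t a ys \<in> S} =
      ?E (indicator {ys. \<forall>a<3. copy m t a ys \<in> S})"
    by simp
  also have "\<dots> = ?E (\<lambda>ys. ?s (copy m t 0 ys) * ?s (copy m t 1 ys) * ?s (copy m t 2 ys))"
    by (intro Bochner_Integration.integral_cong) (auto simp: indicator_def all_less_3)
  also have "\<dots> = ER t (\<lambda>\<alpha>. Q \<alpha> * Q \<alpha> * Q \<alpha>)"
    unfolding expectation_copies[OF assms, of d "\<lambda>x y z. ?s x * ?s y * ?s z"] by (simp add: Q_def)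
  finally have eq: "Pr (Pi_pmf {..<3 * m} d (\<lambda>_. p)) {ys. \<forall>a<3. copy m t a ys \<in> S} =
      ER t (\<lambda>\<alpha>. Q \<alpha> * Q \<alpha> * Q \<alpha>)" .
  \<comment> \<open>Jensen's inequality through the tangent of the cube at the mean \<open>x\<close>
    of \<open>Q\<close>: the tangent has mean \<open>x ^ 3\<close>, and the gap to the cube factors
    as \<open>(Q \<alpha> - x)\<^sup>2 * (Q \<alpha> + 2 * x)\<close>.\<close>
  have "x ^ 3 = ER t (\<lambda>\<alpha>. 3 * x\<^sup>2 * Q \<alpha> - 2 * x ^ 3)"
    using ER_integrable x by (simp add: power2_eq_square power3_eq_cube)
  also have "\<dots> \<le> ER t (\<lambda>\<alpha>. Q \<alpha> * Q \<alpha> * Q \<alpha>)"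
  proof (rule integral_mono[OF ER_integrable ER_integrable])
    fix \<alpha>
    have "0 \<le> (Q \<alpha> - x)\<^sup>2 * (Q \<alpha> + 2 * x)"
      using Q0 x0 by simp
    then show "3 * x\<^sup>2 * Q \<alpha> - 2 * x ^ 3 \<le> Q \<alpha> * Q \<alpha> * Q \<alpha>"
      by (simp add: power2_eq_square power3_eq_cube algebra_simps)
  qed
  finally show ?thesis
    by (simp add: eq x_def)
qed

end

section \<open>Assembling the bound on the success probability\<close>

lemma prob_far_from_localized:
  assumes K: "1 \<le> K" "K \<le> n" and D: "real (n + m) \<le> D * real n" "1 \<le> D"
    and g: "local_rule r g" and \<rho>: "\<rho> = L * Suc r + r" and \<eta>: "0 < \<eta>"
  shows "Pr (replicate_pmf m (clause_pmf K n))
      {\<Phi>. \<eta> * real n < real (ham n (out g \<Phi>) (localized \<rho> g \<Phi>))} \<le>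
    chain_rate D K (Suc r) L / \<eta>"
proof -
  let ?P = "Pr (fam K n {..<m})"
  let ?E = "EV (fam K n {..<m})"
  let ?\<Phi> = "\<lambda>ys. map ys [0..<m]"
  let ?c = "\<lambda>i. {ys. chain (?\<Phi> ys) (Suc r) L i}"
  define \<epsilon> where "\<epsilon> = chain_rate D K (Suc r) L"
  have n: "0 < real n" using K by simp
  have int: "integrable (measure_pmf (fam K n {..<m})) (f :: _ \<Rightarrow> real)" for f
    by (rule integrable_measure_pmf_finite) (simp add: finite_set_Pi_pmf finite_set_clause_pmf[OF K(2)])
  have "Pr (replicate_pmf m (clause_pmf K n))
      {\<Phi>. \<eta> * real n < real (ham n (out g \<Phi>) (localized \<rho> g \<Phi>))} =
      ?E (indicator {ys. \<eta> * real n < real (ham n (out g (?\<Phi> ys)) (localized \<rho> g (?\<Phi> ys)))})"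
    unfolding replicate_pmf_conv_Pi[of m "clause_pmf K n" undefined] by (simp add: vimage_def)
  \<comment> \<open>Markov's inequality: by \<open>out_view\<close>, every disagreement occurs at
    the start of a long chain.\<close>
  also have "\<dots> \<le> ?E (\<lambda>ys. (\<Sum>i<n. indicator (?c i) ys) / (\<eta> * real n))"
  proof (rule integral_mono[OF int int])
    fix ys
    have "{i. i < n \<and> out g (?\<Phi> ys) i \<noteq> localized \<rho> g (?\<Phi> ys) i} \<subseteq> {i \<in> {..<n}. ys \<in> ?c i}"
      using out_view[OF g _ \<rho>] by (auto simp: localized_def)
    then have le: "ham n (out g (?\<Phi> ys)) (localized \<rho> g (?\<Phi> ys)) \<le> card {i \<in> {..<n}. ys \<in> ?c i}"
      unfolding ham_def by (intro card_mono) auto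
    have "(\<Sum>i<n. indicator (?c i) ys) = real (card {i \<in> {..<n}. ys \<in> ?c i})"
      by (simp add: indicator_def sum.If_cases Int_def)
    then have "real (ham n (out g (?\<Phi> ys)) (localized \<rho> g (?\<Phi> ys))) \<le> (\<Sum>i<n. indicator (?c i) ys)"
      using le by (simp only: of_nat_le_iff)
    then show "indicator {ys. \<eta> * real n < real (ham n (out g (?\<Phi> ys)) (localized \<rho> g (?\<Phi> ys)))} ys \<le>
        (\<Sum>i<n. indicator (?c i) ys) / (\<eta> * real n)"
      using \<eta> n by (simp add: indicator_def pos_le_divide_eq sum_nonneg)
  qed
  also have "\<dots> = (\<Sum>i<n. ?P (?c i)) / (\<eta> * real n)"
    using int by simp
  also have "\<dots> \<le> (real n * \<epsilon>) / (\<eta> * real n)"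
    using expected_chains[OF K D, of "Suc r" L] \<eta> n unfolding \<epsilon>_def by (intro divide_right_mono) auto
  also have "\<dots> = \<epsilon> / \<eta>"
    using n by simp
  finally show ?thesis
    by (simp only: \<epsilon>_def)
qed

text \<open>With fluctuation \<open>n / 400\<close> allowed for a distance and
  \<open>n / 1000\<close> between each output and its localized version, the margins close exactly:
  \<open>31 / 2000 + 1 / 400 + 2 / 1000 = 1 / 50\<close> and
  \<open>29 / 2000 - 1 / 400 - 2 / 1000 = 1 / 100\<close>. The window from 29/2000 to 31/2000 has
  the width \<open>n / 1000\<close> of the largest step of the mean.\<close>

lemma cube_success_le:
  fixes K n m \<rho> s :: nat
  assumes K: "1000 \<le> K" "K \<le> n" and d: "2 powr (real K - 2) * ln 2 < d" "d * real n - 1 \<le> real m"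
    and D: "real (n + m) \<le> D * real n" "1 \<le> D"
    and g: "local_rule r g" and \<rho>: "\<rho> = L * Suc r + r"
    and low: "Pr (fam K n {..<3 * m}) {ys. \<not> lowdeg (3 * m) s ys} \<le> \<delta>"
    and small: "real (infl K \<rho> s) + real n * \<delta> \<le> real n / 1000"
  defines "\<epsilon> \<equiv> chain_rate D K (Suc r) L"
    and "V \<equiv> real (3 * m) * ((2 * real (infl K \<rho> (Suc s)))\<^sup>2 + (real n)\<^sup>2 * \<delta>)"
  shows "Pr (replicate_pmf m (clause_pmf K n)) (solved g) ^ 3 \<le>
    exp (3 - 3 / 100 * real n) + 3 * (V / (real n / 400)\<^sup>2) + 3 * (1000 * \<epsilon>)"
proof -
  let ?\<mu> = "fam K n {..<3 * m}"
  let ?P = "Pr ?\<mu>"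
  let ?E = "EV ?\<mu>"
  have K1: "1 \<le> K" and n: "0 < n" using K by auto
  have finp: "finite (set_pmf (clause_pmf K n))"
    by (rule finite_set_clause_pmf[OF K(2)])
  define M where "M t = ?E (dst n \<rho> g m t 0 1)" for t
  have Mm: "M m \<le> 31 / 2000 * real n"
  proof -
    have "dst n \<rho> g m m 0 1 = (\<lambda>_. 0)"
    proof
      fix ys
      have "copy m m 0 ys = copy m m 1 ys" by (auto simp: copy_def pos_def)
      then show "dst n \<rho> g m m 0 1 ys = 0" by (simp add: dst_def ham_def)
    qed
    then have "M m = 0" by (simp add: M_def)
    then show ?thesis by simp
  qed
  \<comment> \<open>If this least \<open>t\<close> is positive, the mean was above
    \<open>31 / 2000 * n\<close> one step earlier and cannot have dropped below
    \<open>29 / 2000 * n\<close>.\<close>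
  define t where "t = (LEAST t. M t \<le> 31 / 2000 * real n)"
  have Mt: "M t \<le> 31 / 2000 * real n"
    unfolding t_def by (rule LeastI[of "\<lambda>t. M t \<le> 31 / 2000 * real n", OF Mm])
  have tm: "t \<le> m"
    unfolding t_def by (rule Least_le[of "\<lambda>t. M t \<le> 31 / 2000 * real n", OF Mm])
  have Mt': "29 / 2000 * real n \<le> M t" if t0: "0 < t"
  proof -
    obtain t' where t': "t = Suc t'" using t0 by (cases t) auto
    have "\<not> M t' \<le> 31 / 2000 * real n"
      using not_less_Least[of t' "\<lambda>t. M t \<le> 31 / 2000 * real n"] t' by (simp add: t_def)
    moreover have "M t' \<le> M t + (real (infl K \<rho> s) + real n * \<delta>)"
      unfolding M_def t' using mean_dst_Suc[OF K(2) n low] tm t' by simp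
    ultimately show ?thesis using small by simp
  qed
  have Mab: "?E (dst n \<rho> g m t a b) = M t" if "a < b" "b < 3" for a b
    unfolding M_def dst_def
    by (rule expectation_copy_pair[OF finp tm that, of undefined
          "\<lambda>\<Phi> \<Psi>. real (ham n (localized \<rho> g \<Phi>) (localized \<rho> g \<Psi>))"])
  define bad where "bad a b = {ys. real n / 400 \<le> \<bar>dst n \<rho> g m t a b ys - ?E (dst n \<rho> g m t a b)\<bar>}" for a b
  define far where "far a = {ys. 1 / 1000 * real n < real (ham n (out g (copy m t a ys)) (lcopy \<rho> g m t a ys))}" for a
  define spr where "spr = {ys. \<exists>\<sigma>. spread n t \<sigma> \<and> (\<forall>a<3. satisfies (\<sigma> a) (copy m t a ys))}"
  have Pbad: "?P (bad a b) \<le> V / (real n / 400)\<^sup>2" if "a < 3" "b < 3" for a b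
    unfolding bad_def V_def using prob_dst_deviates[OF K(2) n low tm that, of "real n / 400"] n by simp
  have Pfar: "?P (far a) \<le> 1000 * \<epsilon>" if "a < 3" for a
  proof -
    let ?S = "{\<Phi>. 1 / 1000 * real n < real (ham n (out g \<Phi>) (localized \<rho> g \<Phi>))}"
    have "?P (far a) = ?E (\<lambda>ys. indicator ?S (copy m t a ys))"
    proof -
      have "?P (far a) = ?E (indicator (far a))" by simp
      also have "\<dots> = ?E (\<lambda>ys. indicator ?S (copy m t a ys))"
        by (rule Bochner_Integration.integral_cong) (auto simp: far_def indicator_def)
      finally show ?thesis .
    qed
    also have "\<dots> = Pr (replicate_pmf m (clause_pmf K n)) ?S"
      using expectation_copy[OF finp tm that, of undefined "indicator ?S"] by simp
    also have "\<dots> \<le> \<epsilon> / (1 / 1000)"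
      unfolding \<epsilon>_def by (rule prob_far_from_localized[OF K1 K(2) D g \<rho>]) simp
    finally show ?thesis by simp
  qed
  have "Pr (replicate_pmf m (clause_pmf K n)) (solved g) ^ 3 \<le>
      ?P {ys. \<forall>a<3. copy m t a ys \<in> (solved g)}"
    by (rule cube_le_prob_copies[OF finp tm])
  also have "\<dots> \<le> ?P (spr \<union> (bad 0 1 \<union> bad 0 2 \<union> bad 1 2) \<union> (far 0 \<union> far 1 \<union> far 2))"
  proof (intro measure_pmf.finite_measure_mono subsetI)
    fix ys assume "ys \<in> {ys. \<forall>a<3. copy m t a ys \<in> (solved g)}"
    then have sat: "\<forall>a<3. satisfies (out g (copy m t a ys)) (copy m t a ys)" by simp
    show "ys \<in> spr \<union> (bad 0 1 \<union> bad 0 2 \<union> bad 1 2) \<union> (far 0 \<union> far 1 \<union> far 2)"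
    proof (rule ccontr)
      assume no: "\<not> ?thesis"
      let ?o = "\<lambda>a. out g (copy m t a ys)" and ?l = "\<lambda>a. lcopy \<rho> g m t a ys"
      have close: "real (ham n (?o a) (?l a)) \<le> real n / 1000" if "a < 3" for a
      proof -
        have "a = 0 \<or> a = 1 \<or> a = 2" using that by linarith
        then have "ys \<notin> far a" using no by auto
        then show ?thesis by (simp add: far_def)
      qed
      have conc: "\<bar>real (ham n (?l a) (?l b)) - M t\<bar> < real n / 400" if "a < b" "b < 3" for a b
      proof -
        have "(a = 0 \<and> b = 1) \<or> (a = 0 \<and> b = 2) \<or> (a = 1 \<and> b = 2)" using that by linarith
        then have "ys \<notin> bad a b" using no by auto
        then show ?thesis
          using Mab[OF that] by (simp add: bad_def dst_def)
      qed
      have "spread n t ?o"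
        unfolding spread_def
      proof (intro allI impI)
        fix a b :: nat assume ab: "a < b" "b < 3"
        have "\<bar>real (ham n (?o a) (?o b)) - real (ham n (?l a) (?l b))\<bar> \<le> real n / 1000 + real n / 1000"
          using ham_diff[of n "?o a" "?o b" "?l a" "?l b"] close[of a] close[of b] ab by simp
        then show "real (ham n (?o a) (?o b)) \<le> real n / 50 \<and>
            (0 < t \<longrightarrow> real n / 100 \<le> real (ham n (?o a) (?o b)))"
          using conc[OF ab] Mt Mt' unfolding abs_le_iff abs_less_iff by (intro conjI impI) linarith+
      qed
      then have "ys \<in> spr"
        using sat by (auto simp: spr_def)
      with no show False by blast
    qed
  qed simp
  also have "\<dots> \<le> ?P spr + (?P (bad 0 1) + ?P (bad 0 2) + ?P (bad 1 2)) + (?P (far 0) + ?P (far 1) + ?P (far 2))"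
    by (intro order_trans[OF measure_Un_le] add_mono order_refl) auto
  also have "\<dots> \<le> exp (3 - 3 / 100 * real n) + 3 * (V / (real n / 400)\<^sup>2) + 3 * (1000 * \<epsilon>)"
  proof -
    have "?P spr \<le> exp (3 - 3 / 100 * real n)"
      unfolding spr_def by (rule prob_spread_triples[OF K tm d])
    then show ?thesis
      using Pbad[of 0 1] Pbad[of 0 2] Pbad[of 1 2] Pfar[of 0] Pfar[of 1] Pfar[of 2] by simp
  qed
  finally show ?thesis .
qed

lemma power_over_fact_le_exp:
  fixes x :: real
  assumes "0 \<le> x"
  shows "x ^ k / fact k \<le> exp x"
proof -
  have "(\<Sum>i\<in>{k}. x ^ i /\<^sub>R fact i) \<le> (\<Sum>i. x ^ i /\<^sub>R fact i)"
    using assms by (intro sum_le_suminf summable_exp_generic) auto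
  then show ?thesis
    by (simp add: exp_def divide_inverse mult.commute)
qed

text \<open>First \<open>e\<close> determines \<open>L\<close> and thereby \<open>\<rho>\<close>.
  The degree bound is then about \<open>(ln n)\<^sup>2\<close>: high degrees become rarer than any
  inverse power of \<open>n\<close>, while the influence of a clause stays polylogarithmic. The
  estimate is uniform in \<open>g\<close> because the reduction supplies a different rule for each
  \<open>n\<close>.\<close>

lemma cube_success_eventually_le:
  fixes K r :: nat and d e :: real
  assumes K: "1000 \<le> K" and d: "2 powr (real K - 2) * ln 2 < d" and r: "0 < r" and e: "0 < e"
  shows "\<forall>\<^sub>F n in sequentially. \<forall>g. local_rule r g \<longrightarrow>
    Pr (formula_pmf K d n) (solved g) ^ 3 \<le> e"
proof -
  have "0 \<le> 2 powr (real K - 2) * ln 2" by simp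
  with d have d0: "0 < d" by linarith
  define D where "D = d + 1"
  define c where "c = 3 * d * real K"
  define c0 where "c0 = real (Suc (2 * Suc r) * (2 * Suc r)) * (D * real K) ^ (2 * Suc r)"
  have "(\<lambda>L. c0 ^ Suc L / fact (Suc L) * (1 / c0)) \<longlonglongrightarrow> 0 * (1 / c0)"
  proof (intro tendsto_mult tendsto_const)
    have "(\<lambda>L. c0 ^ L / fact L) \<longlonglongrightarrow> 0"
      using summable_LIMSEQ_zero[OF summable_exp[of c0]] by (simp add: field_simps)
    then show "(\<lambda>L. c0 ^ Suc L / fact (Suc L)) \<longlonglongrightarrow> 0"
      by (rule LIMSEQ_Suc)
  qed
  moreover have "0 < c0"
    unfolding c0_def D_def using d0 K by (intro mult_pos_pos zero_less_power) (auto simp del: of_nat_mult mult_Suc)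
  ultimately have "(\<lambda>L. c0 ^ L / fact (Suc L)) \<longlonglongrightarrow> 0"
    by (simp del: fact_Suc)
  then have "\<forall>\<^sub>F L in sequentially. c0 ^ L / fact (Suc L) < e / 6000"
    using e by (intro order_tendstoD) auto
  \<comment> \<open>The three localization errors contribute \<open>3 * 1000 * e / 6000\<close>,
    which is half of \<open>e\<close>.\<close>
  then obtain L where L: "c0 ^ L / fact (Suc L) < e / 6000"
    by (auto simp: eventually_sequentially)
  define \<rho> where "\<rho> = L * Suc r + r"
  have \<rho>0: "0 < \<rho>" using r by (simp add: \<rho>_def)
  define k where "k = real K"
  have k0: "0 < k" using K by (simp add: k_def)
  \<comment> \<open>\<open>I\<close>, \<open>\<delta>\<close> and \<open>W\<close> are real-variable
    majorants of the influence, of the probability of a high degree and of the deviation bound, in a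
    form suited to asymptotics.\<close>
  define I where "I n = 2 * (k * (1 + ((ln n)\<^sup>2 + 2) * k) ^ \<rho>)" for n :: real
  define \<delta> where "\<delta> n = n * (exp (c * exp 1) * exp (- ((ln n)\<^sup>2)))" for n :: real
  define W where "W n = 3 * d * n * ((2 * I n)\<^sup>2 + n\<^sup>2 * \<delta> n) / (n / 400)\<^sup>2" for n :: real
  have lim1: "(\<lambda>n. (I (real n) + real n * \<delta> (real n)) / real n) \<longlonglongrightarrow> 0"
    using k0 \<rho>0 unfolding I_def \<delta>_def by real_asymp
  have lim2: "(\<lambda>n. exp (3 - 3 / 100 * real n) + 3 * W (real n)) \<longlonglongrightarrow> 0"
    using k0 \<rho>0 d0 unfolding W_def I_def \<delta>_def by real_asymp
  have ev1: "\<forall>\<^sub>F n in sequentially. (I (real n) + real n * \<delta> (real n)) / real n < 1 / 1000"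
    using lim1 by (intro order_tendstoD) auto
  have ev2: "\<forall>\<^sub>F n in sequentially. exp (3 - 3 / 100 * real n) + 3 * W (real n) < e / 2"
    using lim2 e by (intro order_tendstoD) auto
  have ev3: "\<forall>\<^sub>F n in sequentially. K \<le> n"
    by (rule eventually_ge_at_top)
  from ev1 ev2 ev3 show ?thesis
  proof eventually_elim
    case (elim n)
    show ?case
    proof (intro allI impI)
      fix g assume g: "local_rule r g"
      define m where "m = nat \<lfloor>d * real n\<rfloor>"
      define s where "s = nat \<lceil>(ln (real n))\<^sup>2\<rceil>"
      have n: "0 < n" using elim K by simp
      have dn: "0 \<le> d * real n" using d0 by simp
      then have m: "real m \<le> d * real n" "d * real n - 1 \<le> real m"
        unfolding m_def by linarith+
      have s: "(ln (real n))\<^sup>2 \<le> real s" "real s \<le> (ln (real n))\<^sup>2 + 1"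
        unfolding s_def by (simp_all add: of_nat_ceiling)
      have Dn: "real (n + m) \<le> D * real n" "1 \<le> D"
        using m d0 by (auto simp: D_def algebra_simps)
      have low: "Pr (fam K n {..<3 * m}) {ys. \<not> lowdeg (3 * m) s ys} \<le> \<delta> (real n)"
      proof -
        have c0': "0 \<le> c" using d0 by (simp add: c_def)
        have "Pr (fam K n {..<3 * m}) {ys. \<not> lowdeg (3 * m) s ys} \<le>
            real n * ((real (3 * m) * real K / real n) ^ Suc s / fact (Suc s))"
          by (rule prob_not_lowdeg[OF elim(3) n])
        also have "\<dots> \<le> real n * (c ^ Suc s / fact (Suc s))"
        proof (intro mult_left_mono divide_right_mono power_mono)
          have "3 * real m * real K \<le> 3 * (d * real n) * real K"
            using m by (intro mult_right_mono mult_left_mono) auto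
          then show "real (3 * m) * real K / real n \<le> c"
            using n by (simp add: c_def pos_divide_le_eq mult_ac)
        qed auto
        \<comment> \<open>Splitting off \<open>exp (- Suc s)\<close> leaves one term of the
          exponential series at \<open>c * exp 1\<close>, a bound independent of
          \<open>s\<close>.\<close>
        also have "c ^ Suc s / fact (Suc s) = (c * exp 1) ^ Suc s / fact (Suc s) * exp (- real (Suc s))"
          by (simp add: power_mult_distrib exp_minus field_simps flip: exp_of_nat_mult del: fact_Suc of_nat_Suc power_Suc)
        also have "real n * \<dots> \<le> real n * (exp (c * exp 1) * exp (- ((ln (real n))\<^sup>2)))"
        proof (intro mult_left_mono mult_mono)
          show "(c * exp 1) ^ Suc s / fact (Suc s) \<le> exp (c * exp 1)"
            using c0' by (intro power_over_fact_le_exp) simp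
          show "exp (- real (Suc s)) \<le> exp (- ((ln (real n))\<^sup>2))"
            using s by simp
        qed (use c0' in auto)
        finally show ?thesis by (simp add: \<delta>_def)
      qed
      have infl: "real (infl K \<rho> s') \<le> I (real n)" if "s' \<le> Suc s" for s'
      proof -
        have "real s' \<le> (ln (real n))\<^sup>2 + 2"
          using that s by linarith
        then have "(1 + real s' * k) ^ \<rho> \<le> (1 + ((ln (real n))\<^sup>2 + 2) * k) ^ \<rho>"
          using k0 by (intro power_mono add_left_mono mult_right_mono) auto
        then have "k * (1 + real s' * k) ^ \<rho> \<le> k * (1 + ((ln (real n))\<^sup>2 + 2) * k) ^ \<rho>"
          using k0 by (intro mult_left_mono) auto
        then show ?thesis
          by (simp add: infl_def I_def k_def)
      qed
      have \<delta>0: "0 \<le> \<delta> (real n)" by (simp add: \<delta>_def)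
      have "(I (real n) + real n * \<delta> (real n)) < real n / 1000"
        using elim(1) n by (simp add: pos_divide_less_eq)
      then have small: "real (infl K \<rho> s) + real n * \<delta> (real n) \<le> real n / 1000"
        using infl[of s] by linarith
      have "Pr (formula_pmf K d n) (solved g) ^ 3 \<le>
          exp (3 - 3 / 100 * real n) +
          3 * (real (3 * m) * ((2 * real (infl K \<rho> (Suc s)))\<^sup>2 + (real n)\<^sup>2 * \<delta> (real n)) / (real n / 400)\<^sup>2) +
          3 * (1000 * (c0 ^ L / fact (Suc L)))"
        unfolding formula_pmf_def m_def[symmetric] c0_def chain_rate_def[symmetric]
        by (rule cube_success_le[OF K elim(3) d m(2) Dn g \<rho>_def low small])
      also have "\<dots> \<le> exp (3 - 3 / 100 * real n) + 3 * W (real n) + 3 * (1000 * (e / 6000))"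
      proof -
        have "real (3 * m) * ((2 * real (infl K \<rho> (Suc s)))\<^sup>2 + (real n)\<^sup>2 * \<delta> (real n)) / (real n / 400)\<^sup>2 \<le> W (real n)"
          unfolding W_def
        proof (intro divide_right_mono mult_mono add_mono power_mono)
          show "real (3 * m) \<le> 3 * d * real n" using m by simp
          show "real (infl K \<rho> (Suc s)) \<le> I (real n)" using infl[of "Suc s"] by simp
        qed (use d0 \<delta>0 in auto)
        with L show ?thesis by (intro add_mono mult_left_mono) auto
      qed
      also have "\<dots> \<le> e"
        using elim(2) by simp
      finally show "Pr (formula_pmf K d n) (solved g) ^ 3 \<le> e" .
    qed
  qed
qed

theorem corollary2p7:
  shows "\<exists>K0::nat. \<forall>K\<ge>K0. \<forall>(d::real) (r::nat). d > 2 powr (real K - 2) * ln 2 \<longrightarrow> r > 0 \<longrightarrow>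
    (\<lambda>n. measure (sp_space K d n) (sp_solves r)) \<longlonglongrightarrow> 0"
proof (intro exI[of _ 1000] allI impI)
  fix K r :: nat and d :: real
  assume K: "1000 \<le> K" and d: "2 powr (real K - 2) * ln 2 < d" and r: "0 < r"
  show "(\<lambda>n. measure (sp_space K d n) (sp_solves r)) \<longlonglongrightarrow> 0"
  proof (rule tendstoI)
    fix e :: real assume e: "0 < e"
    have "\<forall>\<^sub>F n in sequentially. K \<le> n"
      by (rule eventually_ge_at_top)
    moreover have "\<forall>\<^sub>F n in sequentially. \<forall>g. local_rule r g \<longrightarrow>
        Pr (formula_pmf K d n) (solved g) ^ 3 \<le> (e / 2) ^ 3"
      using e by (intro cube_success_eventually_le[OF K d r]) simp
    ultimately show "\<forall>\<^sub>F n in sequentially. dist (measure (sp_space K d n) (sp_solves r)) 0 < e"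
    proof eventually_elim
      case (elim n)
      obtain g where g: "local_rule r g" "measure (sp_space K d n) (sp_solves r) \<le>
          Pr (formula_pmf K d n) (solved g)"
        using sp_solves_le_local_rule[OF elim(1)] .
      have "Pr (formula_pmf K d n) (solved g) \<le> e / 2"
        using elim(2) g(1) e power_mono_iff[of "Pr (formula_pmf K d n) (solved g)" "e / 2" 3]
        by simp
      with g(2) e show ?case
        by simp
    qed
  qed
qed

end
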